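(* Let $t\mapsto X(t)$ be a family of operators indexed by a real parameter $t$ which is a smooth ($C^\infty$) function of $t$ in the norm topology, and assume that the spectra $\sigma(X(t))$ lie within a compact set for all $t$. Let $f$ be a complex-valued and differentiable function. Then $$\frac{d f(X(t))}{dt}=T_{f^{[1]}}^{X(t),X(t)}\left(\frac{dX(t)}{dt}\right),$$ where the right-hand side is the generalized double operator integral with function $f^{[1]}$, the first divided difference of $f$.
   Context: The first divided difference is $f^{[1]}(x_1,x_2)=\frac{f(x_1)-f(x_2)}{x_1-x_2}$, extended to $x_1=x_2$ by $f'(x_1)$. All operators act on a complex Hilbert space, with identity $I$; they need not be self-adjoint. Each parameter operator $X$ is assumed to admit a spectral decomposition $X=\int_{\sigma(X)}\lambda\,dE_X(\lambda)+\int_{\sigma(X)}(X-\lambda I)\,dE_X(\lambda)$, where $\sigma(X)$ is the spectrum and $E_X$ is a spectral measure on $\sigma(X)$ (projection-valued, projections not necessarily orthogonal) with $\int_{\sigma(X)}dE_X(\lambda)=I$ and, formally, with $\delta(\lambda,\lambda')$ the delta symbol, $dE_X(\lambda)\,dE_X(\lambda')=\delta(\lambda,\lambda')\,dE_X(\lambda)$, $dE_X(\lambda')(X-\lambda I)dE_X(\lambda)=(X-\lambda I)dE_X(\lambda)dE_X(\lambda')=\delta(\lambda,\lambda')(X-\lambda I)dE_X(\lambda)$, and $(X-\lambda I)dE_X(\lambda)\,(X-\lambda' I)dE_X(\lambda')=\delta(\lambda,\lambda')(X-\lambda I)^2dE_X(\lambda)$. For each $\lambda\in\sigma(X)$, $(X-\lambda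 I)dE_X(\lambda)$ is nilpotent, of order $m_\lambda\ge 1$: $[(X-\lambda I)dE_X(\lambda)]^\ell=0$ for $\ell\ge m_\lambda$. An integral $\int g(\lambda)(X-\lambda I)^q dE_X(\lambda)$ is read by expanding $(X-\lambda I)^q$ in powers of $X$ and $\lambda$. All integrals are assumed to be well defined. Functional calculus: $$f(X)=\int_{\sigma(X)}f(\lambda)\,dE_X(\lambda)+\int_{\sigma(X)}\sum_{q=1}^{m_\lambda-1}\frac{f^{(q)}(\lambda)}{q!}(X-\lambda I)^q\,dE_X(\lambda).$$ Generalized double operator integral (GDOI): for operators $X_1,X_2,Y$ and a bivariate analytic function $\beta$, $$T_\beta^{X_1,X_2}(Y)=\int_{\sigma(X_1)}\int_{\sigma(X_2)}\sum_{q_1=0}^{m_{\lambda_1}-1}\sum_{q_2=0}^{m_{\lambda_2}-1}\frac{\beta^{(q_1,q_2)}(\lambda_1,\lambda_2)}{q_1!\,q_2!}(X_1-\lambda_1I)^{q_1}dE_{X_1}(\lambda_1)\,Y\,(X_2-\lambda_2I)^{q_2}dE_{X_2}(\lambda_2),$$ where $\beta^{(q_1,q_2)}$ is the partial derivative of order $q_1$ in the first and $q_2$ in the second variable, $\beta^{(0,0)}=\beta$, and $(X-\lambda I)^0=I$. Here both parameter operators are $X(t)$. "Differentiable" refers to functions of a complex variable on a domain containing the spectra. *)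

theory Defs
  imports "HOL-Complex_Analysis.Complex_Analysis"
begin

text \<open>The inner product is linear in its second argument.\<close>

class complex_hilbert_space = banach +
  fixes scaleC :: "complex \<Rightarrow> 'a \<Rightarrow> 'a"  (infixr \<open>*\<^sub>C\<close> 75)
    and cinner :: "'a \<Rightarrow> 'a \<Rightarrow> complex"
  assumes scaleR_scaleC: "r *\<^sub>R x = complex_of_real r *\<^sub>C x"
    and scaleC_add_right: "a *\<^sub>C (x + y) = a *\<^sub>C x + a *\<^sub>C y"
    and scaleC_add_left: "(a + b) *\<^sub>C x = a *\<^sub>C x + b *\<^sub>C x"
    and scaleC_scaleC: "a *\<^sub>C b *\<^sub>C x = (a * b) *\<^sub>C x"
    and scaleC_one: "1 *\<^sub>C x = x"
    and cinner_commute: "cinner x y = cnj (cinner y x)"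
    and cinner_add_right: "cinner x (y + z) = cinner x y + cinner x z"
    and cinner_scaleC_right: "cinner x (a *\<^sub>C y) = a * cinner x y"
    and norm_eq_sqrt_cinner: "norm x = sqrt (Re (cinner x x))"
begin

lemma cinner_scaleC_left: "cinner (a *\<^sub>C x) y = cnj a * cinner x y"
  by (metis cinner_commute cinner_scaleC_right complex_cnj_mult)

lemma norm_scaleC: "norm (a *\<^sub>C x) = cmod a * norm x"
proof -
  have "cinner (a *\<^sub>C x) (a *\<^sub>C x) = complex_of_real ((cmod a)\<^sup>2) * cinner x x"
    unfolding complex_norm_square cinner_scaleC_left cinner_scaleC_right by (simp add: mult_ac)
  then show ?thesis
    by (simp add: norm_eq_sqrt_cinner real_sqrt_mult)
qed

end

lemma bounded_linear_scaleC:
  "bounded_linear (\<lambda>x :: 'a :: complex_hilbert_space. a *\<^sub>C x)"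
proof (rule bounded_linear_intro)
  show "a *\<^sub>C (x + y) = a *\<^sub>C x + a *\<^sub>C y" for x y :: 'a
    by (rule scaleC_add_right)
  show "a *\<^sub>C r *\<^sub>R x = r *\<^sub>R a *\<^sub>C x" for r and x :: 'a
    by (simp add: scaleR_scaleC scaleC_scaleC mult.commute)
  show "norm (a *\<^sub>C x) \<le> norm x * cmod a" for x :: 'a
    by (simp add: norm_scaleC mult.commute)
qed

text \<open>The library type of bounded operators consists of the real-linear ones; complex
  linearity is imposed separately. The norm on this type is the operator norm.\<close>

type_synonym 'a operator = "'a \<Rightarrow>\<^sub>L 'a"

definition complex_linear :: "('a :: complex_hilbert_space) operator \<Rightarrow> bool" where
  "complex_linear A \<longleftrightarrow> (\<forall>c x. blinfun_apply A (c *\<^sub>C x) = c *\<^sub>C blinfun_apply A x)"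

text \<open>The operator \<open>c I\<close>; the operator \<open>c A\<close> is written \<open>scalar_op c o\<^sub>L A\<close>.\<close>

definition scalar_op :: "complex \<Rightarrow> ('a :: complex_hilbert_space) operator" where
  "scalar_op c = Blinfun (\<lambda>x. c *\<^sub>C x)"

lemma scalar_op_apply: "blinfun_apply (scalar_op c) x = c *\<^sub>C x"
  by (simp add: scalar_op_def bounded_linear_Blinfun_apply bounded_linear_scaleC)

definition op_power :: "('a :: complex_hilbert_space) operator \<Rightarrow> nat \<Rightarrow> 'a operator" where
  "op_power A n = ((\<lambda>B. A o\<^sub>L B) ^^ n) id_blinfun"

definition spectrum :: "('a :: complex_hilbert_space) operator \<Rightarrow> complex set" where
  "spectrum A = {z. \<not> (\<exists>R. complex_linear R \<and>
     (A - scalar_op z) o\<^sub>L R = id_blinfun \<and> R o\<^sub>L (A - scalar_op z) = id_blinfun)}"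

text \<open>A spectral measure on \<open>S\<close>: projections, not necessarily orthogonal, given on the Borel
  subsets of \<open>S\<close> and countably additive in the strong operator topology. The product rule
  is the integrated form of \<open>dE(z) dE(z') = \<delta>(z,z') dE(z)\<close>.\<close>

definition spectral_measure ::
  "complex set \<Rightarrow> (complex set \<Rightarrow> ('a :: complex_hilbert_space) operator) \<Rightarrow> bool" where
  "spectral_measure S E \<longleftrightarrow>
     S \<in> sets borel \<and>
     (\<forall>B \<in> sets borel. B \<subseteq> S \<longrightarrow> complex_linear (E B)) \<and>
     (\<forall>B \<in> sets borel. \<forall>C \<in> sets borel. B \<subseteq> S \<longrightarrow> C \<subseteq> S \<longrightarrow> E B o\<^sub>L E C = E (B \<inter> C)) \<and>
     E S = id_blinfun \<and>
     (\<forall>B. range B \<subseteq> sets borel \<longrightarrow> (\<forall>n. B n \<subseteq> S) \<longrightarrow> disjoint_family B \<longrightarrow>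
        (\<forall>x. (\<lambda>n :: nat. blinfun_apply (E (B n)) x) sums blinfun_apply (E (\<Union>n. B n)) x))"

text \<open>Integrals against \<open>E\<close> are limits, in the strong operator topology, of Riemann sums over
  finite Borel partitions \<open>P\<close> of \<open>S\<close> with tags \<open>\<tau> B \<in> B\<close>, along refinement of \<open>P\<close>. The
  integrand may be operator valued. In the Riemann sums of \<open>g(z) (X - zI)^q dE(z)\<close> one may
  expand the power: they are the sums \<open>\<Sum>j. (q choose j) X^j G_j\<close>, where \<open>G_j\<close> is a Riemann
  sum of \<open>g(z) (-z)^(q-j) dE(z)\<close>.\<close>

definition borel_partition :: "complex set \<Rightarrow> complex set set \<Rightarrow> bool" where
  "borel_partition S P \<longleftrightarrow> finite P \<and> partition_on S P \<and> P \<subseteq> sets borel"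

definition tagged_refinements ::
  "complex set \<Rightarrow> (complex set set \<times> (complex set \<Rightarrow> complex)) filter" where
  "tagged_refinements S =
     (INF P \<in> {P. borel_partition S P}.
        principal {(Q, \<tau>). borel_partition S Q \<and> refines S Q P \<and> (\<forall>B \<in> Q. \<tau> B \<in> B)})"

definition has_op_integral ::
  "(complex set \<Rightarrow> ('a :: complex_hilbert_space) operator) \<Rightarrow> complex set \<Rightarrow>
   (complex \<Rightarrow> 'a operator) \<Rightarrow> 'a operator \<Rightarrow> bool" where
  "has_op_integral E S \<Phi> A \<longleftrightarrow>
     (\<forall>x. ((\<lambda>(P, \<tau>). \<Sum>B\<in>P. blinfun_apply (\<Phi> (\<tau> B) o\<^sub>L E B) x) \<longlongrightarrow> blinfun_apply A x)
            (tagged_refinements S))"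

definition op_integrable where
  "op_integrable E S \<Phi> \<longleftrightarrow> (\<exists>A. has_op_integral E S \<Phi> A)"

definition op_integral where
  "op_integral E S \<Phi> = (THE A. has_op_integral E S \<Phi> A)"

text \<open>Double integrals of \<open>\<Phi>\<^sub>1(z\<^sub>1,z\<^sub>2) dE\<^sub>1(z\<^sub>1) Y \<Phi>\<^sub>2(z\<^sub>1,z\<^sub>2) dE\<^sub>2(z\<^sub>2)\<close> and of finite sums of
  such expressions: \<open>\<Psi> z\<^sub>1 D\<^sub>1 z\<^sub>2 D\<^sub>2\<close> is the integrand with \<open>D\<^sub>1\<close>, \<open>D\<^sub>2\<close> in place of \<open>dE\<^sub>1(z\<^sub>1)\<close>,
  \<open>dE\<^sub>2(z\<^sub>2)\<close>.\<close>

definition has_double_op_integral ::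
  "(complex set \<Rightarrow> ('a :: complex_hilbert_space) operator) \<Rightarrow> complex set \<Rightarrow>
   (complex set \<Rightarrow> 'a operator) \<Rightarrow> complex set \<Rightarrow>
   (complex \<Rightarrow> 'a operator \<Rightarrow> complex \<Rightarrow> 'a operator \<Rightarrow> 'a operator) \<Rightarrow> 'a operator \<Rightarrow> bool" where
  "has_double_op_integral E\<^sub>1 S\<^sub>1 E\<^sub>2 S\<^sub>2 \<Psi> A \<longleftrightarrow>
     (\<forall>x. ((\<lambda>((P, \<tau>), (Q, \<rho>)). \<Sum>B\<in>P. \<Sum>C\<in>Q. blinfun_apply (\<Psi> (\<tau> B) (E\<^sub>1 B) (\<rho> C) (E\<^sub>2 C)) x)
             \<longlongrightarrow> blinfun_apply A x)
            (tagged_refinements S\<^sub>1 \<times>\<^sub>F tagged_refinements S\<^sub>2))"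

text \<open>The spectral decomposition of \<open>X\<close>. With \<open>N B\<close> the integral of \<open>(X - zI) dE(z)\<close> over \<open>B\<close>,
  the formal identities between the \<open>dE(z)\<close> and \<open>(X - zI) dE(z)\<close> become identities for all
  pairs of Borel sets, and the nilpotency of \<open>(X - zI) dE(z)\<close> of order \<open>m z\<close> becomes
  \<open>(N B)^l = 0\<close> whenever \<open>m \<le> l\<close> on \<open>B\<close>; for \<open>B = {z}\<close> this is \<open>((X - zI) E {z})^l = 0\<close>. The
  condition \<open>1 \<le> l\<close> matters only for empty \<open>B\<close>.\<close>

definition spectral_decomposition ::
  "('a :: complex_hilbert_space) operator \<Rightarrow> (complex set \<Rightarrow> 'a operator) \<Rightarrow> (complex \<Rightarrow> nat) \<Rightarrow> bool"
  where
  "spectral_decomposition X E m \<longleftrightarrow>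
     (let S = spectrum X; N = (\<lambda>B. op_integral E B (\<lambda>z. X - scalar_op z)) in
       spectral_measure S E \<and>
       X = op_integral E S scalar_op + op_integral E S (\<lambda>z. X - scalar_op z) \<and>
       (\<forall>B \<in> sets borel. \<forall>C \<in> sets borel. B \<subseteq> S \<longrightarrow> C \<subseteq> S \<longrightarrow>
          E C o\<^sub>L N B = N (B \<inter> C) \<and>
          N B o\<^sub>L E C = N (B \<inter> C) \<and>
          N B o\<^sub>L N C = op_integral E (B \<inter> C) (\<lambda>z. op_power (X - scalar_op z) 2)) \<and>
       (\<forall>z \<in> S. 1 \<le> m z) \<and>
       m \<in> restrict_space borel S \<rightarrow>\<^sub>M count_space UNIV \<and>
       (\<forall>B \<in> sets borel. \<forall>l \<ge> 1. B \<subseteq> S \<longrightarrow> (\<forall>z \<in> B. m z \<le> l) \<longrightarrow> op_power (N B) l = 0))"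

definition nilpotent_integrand ::
  "('a :: complex_hilbert_space) operator \<Rightarrow> (complex \<Rightarrow> nat) \<Rightarrow> (complex \<Rightarrow> complex) \<Rightarrow>
   complex \<Rightarrow> 'a operator" where
  "nilpotent_integrand X m f z =
     (\<Sum>q = 1..m z - 1.
        scalar_op ((deriv ^^ q) f z / fact q) o\<^sub>L op_power (X - scalar_op z) q)"

definition op_fun_defined ::
  "('a :: complex_hilbert_space) operator \<Rightarrow> (complex set \<Rightarrow> 'a operator) \<Rightarrow> (complex \<Rightarrow> nat) \<Rightarrow>
   (complex \<Rightarrow> complex) \<Rightarrow> bool" where
  "op_fun_defined X E m f \<longleftrightarrow>
     op_integrable E (spectrum X) (\<lambda>z. scalar_op (f z)) \<and>
     op_integrable E (spectrum X) (nilpotent_integrand X m f)"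

definition op_fun ::
  "('a :: complex_hilbert_space) operator \<Rightarrow> (complex set \<Rightarrow> 'a operator) \<Rightarrow> (complex \<Rightarrow> nat) \<Rightarrow>
   (complex \<Rightarrow> complex) \<Rightarrow> 'a operator" where
  "op_fun X E m f =
     op_integral E (spectrum X) (\<lambda>z. scalar_op (f z)) +
     op_integral E (spectrum X) (nilpotent_integrand X m f)"

definition partial_deriv ::
  "nat \<Rightarrow> nat \<Rightarrow> (complex \<Rightarrow> complex \<Rightarrow> complex) \<Rightarrow> complex \<Rightarrow> complex \<Rightarrow> complex" where
  "partial_deriv q\<^sub>1 q\<^sub>2 \<beta> z\<^sub>1 z\<^sub>2 =
     (deriv ^^ q\<^sub>1) (\<lambda>x. (deriv ^^ q\<^sub>2) (\<lambda>y. \<beta> x y) z\<^sub>2) z\<^sub>1"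

definition has_gdoi where
  "has_gdoi X\<^sub>1 E\<^sub>1 m\<^sub>1 X\<^sub>2 E\<^sub>2 m\<^sub>2 \<beta> Y A \<longleftrightarrow>
     has_double_op_integral E\<^sub>1 (spectrum X\<^sub>1) E\<^sub>2 (spectrum X\<^sub>2)
       (\<lambda>z\<^sub>1 D\<^sub>1 z\<^sub>2 D\<^sub>2. \<Sum>q\<^sub>1<m\<^sub>1 z\<^sub>1. \<Sum>q\<^sub>2<m\<^sub>2 z\<^sub>2.
          scalar_op (partial_deriv q\<^sub>1 q\<^sub>2 \<beta> z\<^sub>1 z\<^sub>2 / (fact q\<^sub>1 * fact q\<^sub>2)) o\<^sub>L
          op_power (X\<^sub>1 - scalar_op z\<^sub>1) q\<^sub>1 o\<^sub>L D\<^sub>1 o\<^sub>L Y o\<^sub>L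
          op_power (X\<^sub>2 - scalar_op z\<^sub>2) q\<^sub>2 o\<^sub>L D\<^sub>2) A"

definition gdoi_defined where
  "gdoi_defined X\<^sub>1 E\<^sub>1 m\<^sub>1 X\<^sub>2 E\<^sub>2 m\<^sub>2 \<beta> Y \<longleftrightarrow> (\<exists>A. has_gdoi X\<^sub>1 E\<^sub>1 m\<^sub>1 X\<^sub>2 E\<^sub>2 m\<^sub>2 \<beta> Y A)"

definition gdoi where
  "gdoi X\<^sub>1 E\<^sub>1 m\<^sub>1 X\<^sub>2 E\<^sub>2 m\<^sub>2 \<beta> Y = (THE A. has_gdoi X\<^sub>1 E\<^sub>1 m\<^sub>1 X\<^sub>2 E\<^sub>2 m\<^sub>2 \<beta> Y A)"

definition divided_difference :: "(complex \<Rightarrow> complex) \<Rightarrow> complex \<Rightarrow> complex \<Rightarrow> complex" where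
  "divided_difference f x\<^sub>1 x\<^sub>2 =
     (if x\<^sub>1 = x\<^sub>2 then deriv f x\<^sub>1 else (f x\<^sub>1 - f x\<^sub>2) / (x\<^sub>1 - x\<^sub>2))"

definition smooth :: "(real \<Rightarrow> 'b :: real_normed_vector) \<Rightarrow> bool" where
  "smooth X \<longleftrightarrow>
     (\<forall>n t. ((\<lambda>g s. vector_derivative g (at s)) ^^ n) X differentiable at t)"

end

theory Submission
  imports Defs
begin

text \<open>
  Both sides are expressed through the resolvent of \<open>X\<close>. Weighted boundary edges of a fine square
  grid around the spectrum of \<open>X(t)\<close> carry a Cauchy formula for \<open>f\<close>, hence for its derivatives and for
  the partial derivatives of its divided difference. On a set where the nilpotency order is a
  constant \<open>k\<close>, the Taylor sum of order \<open>k\<close> of \<open>1/(\<zeta> - z)\<close> in \<open>X - zI\<close> differs from the resolvent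
  by a multiple of \<open>(X - zI)\<^sup>k\<close>, and the Riemann sums of this remainder tend to \<open>0\<close> in norm because
  the Riemann sums of \<open>X - zI\<close> tend to the nilpotent part of \<open>X\<close>. So \<open>f(X)\<close> is the contour integral of
  \<open>f(\<zeta>) R(\<zeta>)\<close>, and the generalized double operator integral of \<open>Y\<close> is that of \<open>f(\<zeta>) R(\<zeta>) Y R(\<zeta>)\<close>,
  where \<open>R(\<zeta>) = (\<zeta>I - X)\<^sup>-\<^sup>1\<close>. The contour serves all parameters near \<open>t\<close>, and the resolvent identity
  gives the derivative of the contour integral.
\<close>

section \<open>A Cauchy formula around a compact set\<close>

text \<open>Nothing is known about how the spectral measures E(s) and the orders m(s) vary with s,
  so difference quotients cannot be taken through them. The contour form removes them: it depends on
  s only through the resolvent of X(s), which inherits differentiability from X. Two obstacles shape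
  the passage to it. First, m need not be bounded on the spectrum, so no single truncation order
  serves. Everything is computed after multiplication by the projection of a set where m is
  constant; these projections add up strongly to the identity, so bounded operators that agree on
  all of them are equal, and the assumed existence of the integrals provides such operators. Second,
  the integrals are only strong limits, whereas powers of Riemann sums and limits under a contour
  integral call for norm estimates. These come from a uniform bound on the projections, which strong
  countable additivity implies. With it the Riemann sums of z dE(z) converge in norm, although E
  need not have finite variation in norm.\<close>

lemma contour_integral_linepath_power_deriv:
  fixes g :: "complex \<Rightarrow> complex"
  assumes g: "continuous_on (closed_segment a b) g" and z: "z \<notin> closed_segment a b"
  shows "((\<lambda>z. contour_integral (linepath a b) (\<lambda>u. g u / (u - z) ^ Suc q)) has_field_derivative
           of_nat (Suc q) * contour_integral (linepath a b) (\<lambda>u. g u / (u - z) ^ Suc (Suc q))) (at z)"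
proof -
  have int: "((\<lambda>u. g u / (u - y) ^ Suc q) has_contour_integral
       contour_integral (linepath a b) (\<lambda>u. g u / (u - y) ^ Suc q)) (linepath a b)"
    if "y \<in> UNIV - path_image (linepath a b)" for y
    using that
    by (intro has_contour_integral_integral contour_integrable_continuous_linepath continuous_intros g) auto
  have "z \<in> UNIV - path_image (linepath a b)"
    using z by simp
  from Cauchy_next_derivative(2)[OF _ _ int _ open_UNIV _ this, of "cmod (b - a)"] g
  show ?thesis
    by simp
qed

text \<open>With \<open>Q\<close> a set of grid squares and \<open>h q\<close> the integral along an
  edge of \<open>q\<close>, an edge shared by two neighbours in \<open>Q\<close> occurs with both
  signs and cancels. The surviving terms are the boundary edges with their signs.\<close>

lemma sum_diff_shift:
  fixes h :: "'q \<Rightarrow> complex"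
  assumes "finite Q" "inj s"
  shows "(\<Sum>q\<in>Q. h q - h (s q)) =
    (\<Sum>q\<in>(Q - s ` Q) \<union> (s ` Q - Q). (of_bool (q \<in> Q) - of_bool (q \<in> s ` Q)) * h q)"
proof -
  have "(\<Sum>q\<in>Q. h q - h (s q)) = (\<Sum>q\<in>Q. h q) - (\<Sum>q\<in>s ` Q. h q)"
    using assms by (simp add: sum_subtractf sum.reindex inj_on_def inj_def)
  also have "\<dots> = (\<Sum>q\<in>Q - s ` Q. h q) - (\<Sum>q\<in>s ` Q - Q. h q)"
    using sum.Int_Diff[of Q h "s ` Q"] sum.Int_Diff[of "s ` Q" h Q] assms
    by (simp add: Int_commute)
  also have "\<dots> = (\<Sum>q\<in>Q - s ` Q. (of_bool (q \<in> Q) - of_bool (q \<in> s ` Q)) * h q)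
      + (\<Sum>q\<in>s ` Q - Q. (of_bool (q \<in> Q) - of_bool (q \<in> s ` Q)) * h q)"
    by (simp add: sum_negf)
  also have "\<dots> = (\<Sum>q\<in>(Q - s ` Q) \<union> (s ` Q - Q). (of_bool (q \<in> Q) - of_bool (q \<in> s ` Q)) * h q)"
    using assms by (intro sum.union_disjoint [symmetric]) auto
  finally show ?thesis .
qed

text \<open>All four edges are run in the direction of increasing coordinate, so that adjacent
  squares see their common edge as the same path with opposite signs.\<close>

lemma contour_integral_rectpath:
  assumes g: "continuous_on (path_image (rectpath a1 a3)) g" and "Re a1 \<le> Re a3" "Im a1 \<le> Im a3"
  shows "contour_integral (rectpath a1 a3) g =
    contour_integral (linepath a1 (Complex (Re a3) (Im a1))) g
    + contour_integral (linepath (Complex (Re a3) (Im a1)) a3) g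
    - contour_integral (linepath (Complex (Re a1) (Im a3)) a3) g
    - contour_integral (linepath a1 (Complex (Re a1) (Im a3))) g"
proof -
  define a2 a4 where "a2 = Complex (Re a3) (Im a1)" and "a4 = Complex (Re a1) (Im a3)"
  have pi: "path_image (rectpath a1 a3) =
     closed_segment a1 a2 \<union> closed_segment a2 a3 \<union> closed_segment a3 a4 \<union> closed_segment a4 a1"
    by (simp add: rectpath_def Let_def path_image_join a2_def a4_def Un_assoc)
  have c: "continuous_on (closed_segment a1 a2) g" "continuous_on (closed_segment a2 a3) g"
     "continuous_on (closed_segment a3 a4) g" "continuous_on (closed_segment a4 a1) g"
    by (rule continuous_on_subset[OF g], use pi in blast)+
  then have i: "g contour_integrable_on linepath a1 a2" "g contour_integrable_on linepath a2 a3"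
      "g contour_integrable_on linepath a3 a4" "g contour_integrable_on linepath a4 a1"
    by (auto intro: contour_integrable_continuous_linepath)
  have "contour_integral (rectpath a1 a3) g = contour_integral (linepath a1 a2) g
     + contour_integral (linepath a2 a3) g + contour_integral (linepath a3 a4) g
     + contour_integral (linepath a4 a1) g"
    using i by (simp add: rectpath_def Let_def a2_def [symmetric] a4_def [symmetric] contour_integrable_joinI valid_path_join)
  then show ?thesis
    using contour_integral_reverse_linepath[OF c(3)] contour_integral_reverse_linepath[OF c(4)]
    by (simp add: a2_def a4_def)
qed

text \<open>The formula holds on an open neighbourhood \<open>W\<close> of \<open>C\<close>, so that
  it can be differentiated in \<open>z\<close> and shared by all operators with spectrum in
  \<open>W\<close>. Winding numbers are computed for rectangles only; the weights carry the
  orientation of the boundary.\<close>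

lemma Cauchy_cycle:
  fixes f :: "complex \<Rightarrow> complex"
  assumes C: "compact C" and U: "open U" and CU: "C \<subseteq> U" and f: "f holomorphic_on U"
  obtains I :: "(bool \<times> int \<times> int) set" and w a b W where
    "finite I" "open W" "C \<subseteq> W" "W \<subseteq> U"
    "\<And>i. i \<in> I \<Longrightarrow> closed_segment (a i) (b i) \<subseteq> U - W"
    "\<And>z. z \<in> W \<Longrightarrow> f z = (\<Sum>i\<in>I. w i * contour_integral (linepath (a i) (b i)) (\<lambda>u. f u / (u - z)))"
proof -
  have "compact C \<and> closed (- U) \<and> C \<inter> - U = {}"
    using assms by auto
  then obtain \<epsilon> where \<epsilon>: "\<epsilon> > 0" "\<And>x y. x \<in> C \<Longrightarrow> y \<notin> U \<Longrightarrow> \<epsilon> \<le> dist x y"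
    using separate_compact_closed[of C "- U"] by auto
  \<comment> \<open>Points of a square are within \<open>2 * d\<close> of its corner. The corners of
    squares in \<open>Q\<close> are within \<open>3 * d\<close> of \<open>C\<close>, so these
    squares stay within \<open>5 * d < \<epsilon>\<close> of \<open>C\<close>, inside
    \<open>U\<close>. Conversely, a square with a point within \<open>d\<close> of \<open>C\<close>
    belongs to \<open>Q\<close>.\<close>
  define d where "d = \<epsilon> / 6"
  have d: "d > 0" and d6: "\<epsilon> = 6 * d" using \<epsilon> by (auto simp: d_def)
  define p where "p = (\<lambda>(i::int, j::int). Complex (d * of_int i) (d * of_int j))"
  define sh sv where "sh = (\<lambda>(i::int, j::int). (i, j + 1))" and "sv = (\<lambda>(i::int, j::int). (i + 1, j))"
  have p_simps [simp]: "p (sh q) = p q + \<i> * d" "p (sv q) = p q + d" for q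
    by (auto simp: p_def sh_def sv_def complex_eq_iff algebra_simps split: prod.splits)
  have inj: "inj sh" "inj sv" by (auto simp: inj_def sh_def sv_def)
  define sq where "sq = (\<lambda>q. cbox (p q) (p q + Complex d d))"
  define Q where "Q = {q. \<exists>c\<in>C. dist (p q) c \<le> 3 * d}"
  have in_sq: "u \<in> sq q \<longleftrightarrow> Re (p q) \<le> Re u \<and> Re u \<le> Re (p q) + d \<and> Im (p q) \<le> Im u \<and> Im u \<le> Im (p q) + d" for u q
    by (auto simp: sq_def in_cbox_complex_iff)
  have dist_sq: "dist (p q) u \<le> 2 * d" if "u \<in> sq q" for q u
  proof -
    have "dist (p q) u \<le> \<bar>Re (p q - u)\<bar> + \<bar>Im (p q - u)\<bar>"
      unfolding dist_norm by (rule cmod_le)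
    also have "\<dots> \<le> d + d"
      using that by (intro add_mono) (auto simp: in_sq)
    finally show ?thesis by simp
  qed
  have sq_U: "sq q \<subseteq> U" if q: "q \<in> Q" for q
  proof
    fix u assume u: "u \<in> sq q"
    obtain c where c: "c \<in> C" "dist (p q) c \<le> 3 * d" using q by (auto simp: Q_def)
    have "dist c u < \<epsilon>"
      using dist_sq[OF u] c(2) dist_triangle[of c u "p q"] d by (simp add: d6 dist_commute)
    then show "u \<in> U" using \<epsilon>(2)[OF c(1), of u] by fastforce
  qed
  have near: "q \<in> Q" if "z \<in> C" "u \<in> sq q" "dist u z \<le> d" for q z u
    using that dist_sq[OF that(2)] dist_triangle[of "p q" z u] unfolding Q_def by force
  have finQ: "finite Q"
  proof -
    obtain R where R: "\<And>c. c \<in> C \<Longrightarrow> norm c \<le> R"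
      using compact_imp_bounded[OF C] by (auto simp: bounded_iff)
    define n where "n = \<lceil>(R + 3 * d) / d\<rceil>"
    have "Q \<subseteq> {-n..n} \<times> {-n..n}"
    proof
      fix q assume "q \<in> Q"
      then obtain c where c: "c \<in> C" "dist (p q) c \<le> 3 * d" by (auto simp: Q_def)
      obtain i j where q: "q = (i, j)" by fastforce
      have "norm (p q) \<le> R + 3 * d"
        using c R[OF c(1)] norm_triangle_ineq2[of "p q" c] by (simp add: dist_norm)
      then have "\<bar>d * of_int i\<bar> \<le> R + 3 * d" "\<bar>d * of_int j\<bar> \<le> R + 3 * d"
        using abs_Re_le_cmod[of "p q"] abs_Im_le_cmod[of "p q"] by (auto simp: q p_def)
      then have "\<bar>of_int i\<bar> \<le> (R + 3 * d) / d" "\<bar>of_int j\<bar> \<le> (R + 3 * d) / d"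
        using d by (auto simp: abs_mult field_simps)
      then have "\<bar>i\<bar> \<le> n" "\<bar>j\<bar> \<le> n" unfolding n_def by linarith+
      then show "q \<in> {-n..n} \<times> {-n..n}" by (auto simp: q)
    qed
    then show ?thesis by (rule finite_subset) auto
  qed
  have ex_sq: "\<exists>q. u \<in> sq q" for u
  proof -
    have "d * of_int \<lfloor>x / d\<rfloor> \<le> x \<and> x \<le> d * of_int \<lfloor>x / d\<rfloor> + d" for x
    proof -
      have "d * of_int \<lfloor>x / d\<rfloor> \<le> d * (x / d)" "d * (x / d) \<le> d * (of_int \<lfloor>x / d\<rfloor> + 1)"
        using d floor_correct[of "x / d"] by (simp_all only: mult_le_cancel_left_pos) linarith+
      then show ?thesis using d by (simp add: algebra_simps)
    qed
    then have "u \<in> sq (\<lfloor>Re u / d\<rfloor>, \<lfloor>Im u / d\<rfloor>)"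
      by (auto simp: in_sq p_def)
    then show ?thesis by blast
  qed
  \<comment> \<open>An index consists of a kind of edge, \<open>False\<close> for horizontal and
    \<open>True\<close> for vertical, and the grid point where the edge starts. Counterclockwise, a
    horizontal edge is the bottom (+) of its square and the top (-) of the square below; a vertical
    edge is the left side (-) of its square and the right side (+) of the square to the
    left.\<close>
  define S where "S = (\<lambda>s. (Q - s ` Q) \<union> (s ` Q - Q) :: (int \<times> int) set)"
  define I where "I = Pair False ` S sh \<union> Pair True ` S sv"
  define a where "a = (\<lambda>i :: bool \<times> int \<times> int. p (snd i))"
  define b where "b = (\<lambda>i :: bool \<times> int \<times> int. if fst i then p (snd i) + \<i> * d else p (snd i) + d)"
  define w :: "bool \<times> int \<times> int \<Rightarrow> complex" where
    "w = (\<lambda>i. (if fst i then of_bool (snd i \<in> sv ` Q) - of_bool (snd i \<in> Q)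
       else of_bool (snd i \<in> Q) - of_bool (snd i \<in> sh ` Q)) / (2 * pi * \<i>))"
  have finS: "finite (S s)" for s unfolding S_def using finQ by auto
  have finI: "finite I" unfolding I_def using finS by auto
  define \<Gamma> where "\<Gamma> = (\<Union>i\<in>I. closed_segment (a i) (b i))"
  have seg_h: "closed_segment (p (sh q)) (p (sh q) + d) \<subseteq> sq q"
     "closed_segment (p q) (p q + d) \<subseteq> sq q" for q
    unfolding sq_def using d by (intro closed_segment_subset convex_box; simp add: in_cbox_complex_iff)+
  have seg_v: "closed_segment (p (sv q)) (p (sv q) + \<i> * d) \<subseteq> sq q"
     "closed_segment (p q) (p q + \<i> * d) \<subseteq> sq q" for q
    unfolding sq_def using d by (intro closed_segment_subset convex_box; simp add: in_cbox_complex_iff)+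
  \<comment> \<open>A boundary edge has a square of \<open>Q\<close> on one side and a square
    outside \<open>Q\<close> on the other. The former puts it inside \<open>U\<close>; the latter
    keeps it off \<open>C\<close>, since every square that meets \<open>C\<close> is in
    \<open>Q\<close>.\<close>
  have seg_in: "\<exists>q\<in>Q. \<exists>r. r \<notin> Q \<and> closed_segment (a i) (b i) \<subseteq> sq q \<and> closed_segment (a i) (b i) \<subseteq> sq r"
    if i: "i \<in> I" for i
  proof -
    have surj: "\<exists>r. q = sh r" "\<exists>r. q = sv r" for q
      by (rule exI[of _ "(fst q, snd q - 1)"], simp add: sh_def)
        (rule exI[of _ "(fst q - 1, snd q)"], simp add: sv_def)
    show ?thesis
    proof (cases "fst i")
      case False
      then have q: "snd i \<in> S sh" using i by (auto simp: I_def)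
      obtain r where r: "snd i = sh r" using surj by blast
      have "(r \<in> Q \<and> snd i \<notin> Q) \<or> (r \<notin> Q \<and> snd i \<in> Q)"
        using q inj_image_mem_iff[OF inj(1), of r Q] by (auto simp: S_def r)
      then show ?thesis
        using False seg_h(1)[of r] seg_h(2)[of "snd i"] unfolding a_def b_def r[symmetric]
        by (simp only: if_False) blast
    next
      case True
      then have q: "snd i \<in> S sv" using i by (auto simp: I_def)
      obtain r where r: "snd i = sv r" using surj by blast
      have "(r \<in> Q \<and> snd i \<notin> Q) \<or> (r \<notin> Q \<and> snd i \<in> Q)"
        using q inj_image_mem_iff[OF inj(2), of r Q] by (auto simp: S_def r)
      then show ?thesis
        using True seg_v(1)[of r] seg_v(2)[of "snd i"] unfolding a_def b_def r[symmetric]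
        by (simp only: if_True) blast
    qed
  qed
  have \<Gamma>U: "\<Gamma> \<subseteq> U" unfolding \<Gamma>_def using seg_in sq_U by blast
  have "closed \<Gamma>" unfolding \<Gamma>_def using finI by (intro closed_UN) auto
  define W where "W = interior (\<Union>q\<in>Q. sq q) - \<Gamma>"
  have W: "open W" "W \<subseteq> U" "W \<inter> \<Gamma> = {}"
    unfolding W_def using \<open>closed \<Gamma>\<close> sq_U interior_subset[of "\<Union>q\<in>Q. sq q"] by (blast intro: open_Diff)+
  have CW: "C \<subseteq> W"
  proof
    fix z assume z: "z \<in> C"
    have "ball z d \<subseteq> (\<Union>q\<in>Q. sq q)"
    proof
      fix u assume u: "u \<in> ball z d"
      obtain q where "u \<in> sq q" using ex_sq by blast
      then show "u \<in> (\<Union>q\<in>Q. sq q)" using near[OF z, of u q] u by (auto simp: dist_commute)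
    qed
    moreover have "z \<in> ball z d" using d by simp
    ultimately have "z \<in> interior (\<Union>q\<in>Q. sq q)" by (meson interior_maximal open_ball subsetD)
    moreover have "z \<notin> \<Gamma>"
    proof
      assume "z \<in> \<Gamma>"
      then obtain i where "i \<in> I" "z \<in> closed_segment (a i) (b i)" by (auto simp: \<Gamma>_def)
      then obtain r where "r \<notin> Q" "z \<in> sq r" using seg_in by blast
      then show False using near[OF z, of z r] d by simp
    qed
    ultimately show "z \<in> W" by (simp add: W_def)
  qed
  have segIU: "closed_segment (a i) (b i) \<subseteq> U - W" if "i \<in> I" for i
    using that \<Gamma>U W(3) unfolding \<Gamma>_def by blast
  have contf: "continuous_on U f" using f by (rule holomorphic_on_imp_continuous_on)
  define F where "F = (\<lambda>z. \<Sum>i\<in>I. w i * contour_integral (linepath (a i) (b i)) (\<lambda>u. f u / (u - z)))"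
  define grid where "grid = {z. (\<exists>k. Re z = d * of_int k) \<or> (\<exists>k. Im z = d * of_int k)}"
  \<comment> \<open>off the grid lines, interior edges cancel and exactly one square of \<open>Q\<close> contains \<open>z\<close>\<close>
  have generic: "F z = f z" if z: "z \<in> W" "z \<notin> grid" for z
  proof -
    let ?g = "\<lambda>u. f u / (u - z)"
    define H V where "H = (\<lambda>q. contour_integral (linepath (p q) (p q + d)) ?g)"
      and "V = (\<lambda>q. contour_integral (linepath (p q) (p q + \<i> * d)) ?g)"
    let ?r = "\<lambda>q. rectpath (p q) (p q + Complex d d)"
    have notin: "z \<notin> path_image (?r q)" for q
    proof
      assume "z \<in> path_image (?r q)"
      then have "Re z = Re (p q) \<or> Re z = Re (p (sv q)) \<or> Im z = Im (p q) \<or> Im z = Im (p (sh q))"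
        using d by (auto simp: path_image_rectpath)
      then show False using z(2) unfolding grid_def p_def by (auto split: prod.splits)
    qed
    have sub: "path_image (?r q) \<subseteq> sq q" for q
      unfolding sq_def using d by (intro path_image_rectpath_subset_cbox) auto
    have rect1: "contour_integral (?r q) ?g = H q + V (sv q) - H (sh q) - V q" if q: "q \<in> Q" for q
    proof -
      have "continuous_on (path_image (?r q)) ?g"
        using sub[of q] sq_U[OF q] notin[of q]
        by (intro continuous_intros continuous_on_subset[OF contf]) auto
      moreover have eqs: "Complex (Re (p q + Complex d d)) (Im (p q)) = p q + d"
          "Complex (Re (p q)) (Im (p q + Complex d d)) = p q + \<i> * d"
          "p q + d + \<i> * d = p q + Complex d d" "p q + \<i> * d + d = p q + Complex d d"
        by (auto simp: complex_eq_iff)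
      moreover have "Re (p q) \<le> Re (p q + Complex d d)" "Im (p q) \<le> Im (p q + Complex d d)"
        using d by auto
      ultimately show ?thesis
        using contour_integral_rectpath[of "p q" "p q + Complex d d" ?g]
        unfolding H_def V_def p_simps eqs by blast
    qed
    have rect2: "contour_integral (?r q) ?g = 2 * pi * \<i> * of_bool (z \<in> sq q) * f z" if q: "q \<in> Q" for q
    proof -
      have wn: "winding_number (?r q) z = of_bool (z \<in> sq q)"
      proof (cases "z \<in> sq q")
        case True
        then have "z \<in> box (p q) (p q + Complex d d)"
          using notin[of q] d by (auto simp: path_image_rectpath_cbox_minus_box sq_def)
        then show ?thesis using True by (simp add: winding_number_rectpath)
      next
        case False
        then show ?thesis using d by (simp add: winding_number_rectpath_outside sq_def)
      qed
      have "(?g has_contour_integral (2*pi * \<i> * winding_number (?r q) z * f z)) (?r q)"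
      proof (rule Cauchy_integral_formula_global[OF U f])
        show "z \<in> U" using z W by auto
        show "path_image (?r q) \<subseteq> U - {z}" using sub[of q] sq_U[OF q] notin[of q] by auto
        fix y assume "y \<notin> U"
        then have "y \<notin> cbox (p q) (p q + Complex d d)" using sq_U[OF q] by (auto simp: sq_def)
        then show "winding_number (?r q) y = 0" using d by (intro winding_number_rectpath_outside) auto
      qed auto
      then show ?thesis unfolding wn by (rule contour_integral_unique)
    qed
    obtain q0 where q0: "q0 \<in> Q" "z \<in> sq q0"
      using z(1) interior_subset[of "\<Union>q\<in>Q. sq q"] by (auto simp: W_def)
    have uniq: "q = q0" if "z \<in> sq q" for q
    proof -
      have ineq: "k = l" if "d * of_int k \<le> x" "x \<le> d * of_int k + d" "d * of_int l \<le> x" "x \<le> d * of_int l + d"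
         "\<not> (\<exists>k. x = d * of_int k)" for k l :: int and x
      proof -
        have "x \<noteq> d * of_int (k + 1)" "x \<noteq> d * of_int (l + 1)" "x \<noteq> d * of_int k" "x \<noteq> d * of_int l"
          using that(5) by metis+
        then have "d * of_int k < d * of_int (l + 1)" "d * of_int l < d * of_int (k + 1)"
          using that(1-4) by (auto simp: algebra_simps)
        then have "real_of_int k < of_int (l + 1)" "real_of_int l < of_int (k + 1)" using d by simp_all
        then show ?thesis by linarith
      qed
      have "fst q = fst q0"
        by (rule ineq[where x="Re z"])
          (use that q0(2) z(2) in \<open>simp_all add: in_sq p_def grid_def split_beta\<close>)
      moreover have "snd q = snd q0"
        by (rule ineq[where x="Im z"])
          (use that q0(2) z(2) in \<open>simp_all add: in_sq p_def grid_def split_beta\<close>)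
      ultimately show ?thesis by (rule prod_eqI)
    qed
    have "2 * pi * \<i> * f z = (\<Sum>q\<in>Q. contour_integral (?r q) ?g)"
    proof -
      have "(\<Sum>q\<in>Q. contour_integral (?r q) ?g) = (\<Sum>q\<in>Q. if q = q0 then 2 * pi * \<i> * f z else 0)"
      proof (rule sum.cong [OF refl])
        fix q assume "q \<in> Q"
        then show "contour_integral (?r q) ?g = (if q = q0 then 2 * pi * \<i> * f z else 0)"
        proof (cases "q = q0")
          case True
          have "contour_integral (?r q) ?g = 2 * pi * \<i> * of_bool (z \<in> sq q) * f z"
            by (rule rect2) fact
          moreover have "z \<in> sq q" using True q0(2) by (simp only:)
          ultimately show ?thesis using True by (simp only: of_bool_eq mult_1_right if_True refl)
        next
          case False
          have "contour_integral (?r q) ?g = 2 * pi * \<i> * of_bool (z \<in> sq q) * f z"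
            by (rule rect2) fact
          moreover have "z \<notin> sq q" using False uniq by blast
          ultimately show ?thesis using False by (simp only: of_bool_eq mult_zero_left mult_zero_right if_False)
        qed
      qed
      then show ?thesis using q0(1) finQ by (simp only: sum.delta if_True)
    qed
    also have "\<dots> = (\<Sum>q\<in>Q. H q - H (sh q)) - (\<Sum>q\<in>Q. V q - V (sv q))"
      by (simp add: rect1 sum_subtractf sum.distrib)
    also have "\<dots> = (\<Sum>q\<in>S sh. (of_bool (q \<in> Q) - of_bool (q \<in> sh ` Q)) * H q)
                  + (\<Sum>q\<in>S sv. (of_bool (q \<in> sv ` Q) - of_bool (q \<in> Q)) * V q)"
    proof -
      have "(\<Sum>q\<in>S sv. (of_bool (q \<in> sv ` Q) - of_bool (q \<in> Q)) * V q)
          = (\<Sum>q\<in>S sv. - ((of_bool (q \<in> Q) - of_bool (q \<in> sv ` Q)) * V q))"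
        by (intro sum.cong) (auto simp: algebra_simps)
      then show ?thesis
        unfolding sum_diff_shift[OF finQ inj(1)] sum_diff_shift[OF finQ inj(2)] sum_negf
        by (simp add: S_def)
    qed
    also have "\<dots> = 2 * pi * \<i> * F z"
    proof -
      have "F z = (\<Sum>i\<in>Pair False ` S sh. w i * contour_integral (linepath (a i) (b i)) ?g)
         + (\<Sum>i\<in>Pair True ` S sv. w i * contour_integral (linepath (a i) (b i)) ?g)"
        unfolding F_def I_def using finS by (intro sum.union_disjoint) auto
      also have "\<dots> = (\<Sum>q\<in>S sh. (of_bool (q \<in> Q) - of_bool (q \<in> sh ` Q)) * H q / (2 * pi * \<i>))
                  + (\<Sum>q\<in>S sv. (of_bool (q \<in> sv ` Q) - of_bool (q \<in> Q)) * V q / (2 * pi * \<i>))"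
        by (simp add: sum.reindex inj_on_def a_def b_def w_def H_def V_def)
      finally show ?thesis by (simp add: sum_divide_distrib[symmetric] field_simps)
    qed
    finally show ?thesis by simp
  qed
  have Fcont: "isCont F z" if "z \<in> W" for z
    unfolding F_def
  proof (intro continuous_intros)
    fix i assume i: "i \<in> I"
    have "continuous_on (closed_segment (a i) (b i)) f" "z \<notin> closed_segment (a i) (b i)"
      using segIU[OF i] that continuous_on_subset[OF contf] by auto
    from contour_integral_linepath_power_deriv[OF this, of 0]
    show "isCont (\<lambda>z. contour_integral (linepath (a i) (b i)) (\<lambda>u. f u / (u - z))) z"
      by (auto intro: DERIV_isCont)
  qed
  have "f z = F z" if z: "z \<in> W" for z
  proof -
    \<comment> \<open>A point that may lie on a grid line is approached along the diagonal: for
      small \<open>e > 0\<close> neither coordinate of \<open>v e\<close> is a multiple of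
      \<open>d\<close>, so the off-grid case applies there, and both sides are continuous at
      \<open>z\<close>.\<close>
    define v where "v = (\<lambda>e. z + complex_of_real e * Complex 1 1)"
    have v: "(v \<longlongrightarrow> z) (at_right 0)" unfolding v_def by (auto intro!: tendsto_eq_intros)
    have ev: "eventually (\<lambda>e::real. \<nexists>k. x + e = d * of_int k) (at_right 0)" for x
    proof -
      define y where "y = d * of_int (\<lfloor>x / d\<rfloor> + 1) - x"
      have "y > 0" using d floor_correct[of "x / d"] by (simp add: y_def field_simps)
      then have "eventually (\<lambda>e. e \<in> {0<..<y}) (at_right 0)" by (rule eventually_at_right_real)
      then show ?thesis
      proof (rule eventually_mono)
        fix e assume e: "e \<in> {0<..<y}"
        show "\<nexists>k. x + e = d * of_int k"
        proof
          assume "\<exists>k. x + e = d * of_int k"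
          then obtain k where k: "x + e = d * of_int k" by blast
          have "d * of_int k < d * of_int (\<lfloor>x / d\<rfloor> + 1)" using e k by (auto simp: y_def)
          then have "k \<le> \<lfloor>x / d\<rfloor>" using d by (metis linorder_not_le mult_less_cancel_left_pos of_int_less_iff zle_add1_eq_le)
          moreover have "x / d < of_int k" using e k d by (simp add: field_simps)
          ultimately show False using floor_correct[of "x / d"] by linarith
        qed
      qed
    qed
    have evW: "eventually (\<lambda>e. v e \<in> W) (at_right 0)"
      using v W(1) z by (simp add: topological_tendstoD)
    have "eventually (\<lambda>e. F (v e) = f (v e)) (at_right 0)"
      using evW ev[of "Re z"] ev[of "Im z"]
    proof eventually_elim
      case (elim e)
      then have "v e \<notin> grid" by (auto simp: v_def grid_def)
      then show ?case using generic elim by blast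
    qed
    moreover have "((\<lambda>e. F (v e)) \<longlongrightarrow> F z) (at_right 0)"
      using isCont_tendsto_compose[OF Fcont[OF z] v] .
    ultimately have "((\<lambda>e. f (v e)) \<longlongrightarrow> F z) (at_right 0)"
      by (simp add: filterlim_cong)
    moreover have "isCont f z" using contf U W z continuous_on_eq_continuous_at by blast
    then have "((\<lambda>e. f (v e)) \<longlongrightarrow> f z) (at_right 0)" using isCont_tendsto_compose v by blast
    ultimately show ?thesis using tendsto_unique[of "at_right (0::real)"] by (metis trivial_limit_at_right_real)
  qed
  then show thesis
    unfolding F_def using segIU by (intro that[OF finI W(1) CW W(2), of a b w])
qed

section \<open>Operators and resolvents\<close>

interpretation op_comp: bounded_bilinear "(o\<^sub>L)"
  by (rule bounded_bilinear_blinfun_compose)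

lemma op_comp_assoc: "(A o\<^sub>L B) o\<^sub>L C = A o\<^sub>L (B o\<^sub>L C)"
  by (rule blinfun_eqI) simp

lemma op_comp_id [simp]: "id_blinfun o\<^sub>L A = A" "A o\<^sub>L id_blinfun = A"
  by (auto intro: blinfun_eqI)

lemma scalar_op_add: "scalar_op (a + b) = scalar_op a + scalar_op b"
  by (rule blinfun_eqI) (simp add: scalar_op_apply scaleC_add_left blinfun.add_left)

lemma scalar_op_mult: "scalar_op (a * b) = scalar_op a o\<^sub>L scalar_op b"
  by (rule blinfun_eqI) (simp add: scalar_op_apply scaleC_scaleC)

lemma scalar_op_of_real: "scalar_op (complex_of_real r) = r *\<^sub>R id_blinfun"
  by (rule blinfun_eqI) (simp add: scalar_op_apply scaleR_scaleC blinfun.scaleR_left)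

lemma scalar_op_1 [simp]: "scalar_op 1 = id_blinfun"
  using scalar_op_of_real[of 1] by simp

lemma norm_scalar_op_le: "norm (scalar_op c :: ('a :: complex_hilbert_space) operator) \<le> cmod c"
  by (rule norm_blinfun_bound) (simp_all add: scalar_op_apply norm_scaleC)

lemma bounded_linear_scalar_op: "bounded_linear (scalar_op :: complex \<Rightarrow> ('a :: complex_hilbert_space) operator)"
proof (rule bounded_linear_intro)
  show "scalar_op (r *\<^sub>R c) = r *\<^sub>R (scalar_op c :: 'a operator)" for r and c :: complex
    by (simp add: scaleR_conv_of_real scalar_op_mult scalar_op_of_real op_comp.scaleR_left)
  show "norm (scalar_op c :: 'a operator) \<le> norm c * 1" for c
    using norm_scalar_op_le[of c] by simp
qed (rule scalar_op_add)

lemma scalar_op_0 [simp]: "scalar_op 0 = 0"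
  by (rule linear_0[OF bounded_linear.linear[OF bounded_linear_scalar_op]])

lemma scalar_op_diff: "scalar_op (a - b) = scalar_op a - scalar_op b"
  by (rule linear_diff[OF bounded_linear.linear[OF bounded_linear_scalar_op]])

lemma scalar_op_sum: "scalar_op (\<Sum>i\<in>I. c i) = (\<Sum>i\<in>I. scalar_op (c i))"
  by (rule linear_sum[OF bounded_linear.linear[OF bounded_linear_scalar_op]])

lemmas tendsto_scalar_op = bounded_linear.tendsto[OF bounded_linear_scalar_op]

lemma norm_op_comp_le: "norm (A o\<^sub>L B) \<le> norm A * norm B"
  by (rule norm_blinfun_compose)

lemma norm_op_comp_le3: "norm (A o\<^sub>L B o\<^sub>L C) \<le> norm A * norm B * norm C"
  by (meson mult_right_mono norm_ge_zero norm_op_comp_le order_trans)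

lemma complex_linear_scalar_commute:
  "complex_linear A \<Longrightarrow> A o\<^sub>L scalar_op c = scalar_op c o\<^sub>L A"
  by (rule blinfun_eqI) (simp add: complex_linear_def scalar_op_apply)

lemma complex_linear_id [simp, intro]: "complex_linear id_blinfun"
  by (simp add: complex_linear_def)

lemma complex_linear_scalar_op [simp, intro]: "complex_linear (scalar_op c)"
  by (simp add: complex_linear_def scalar_op_apply scaleC_scaleC mult.commute)

lemma complex_linear_add [intro]: "complex_linear A \<Longrightarrow> complex_linear B \<Longrightarrow> complex_linear (A + B)"
  by (simp add: complex_linear_def blinfun.add_left scaleC_add_right)

lemma complex_linear_comp [intro]: "complex_linear A \<Longrightarrow> complex_linear B \<Longrightarrow> complex_linear (A o\<^sub>L B)"
  by (simp add: complex_linear_def)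

lemma complex_linear_uminus [intro]: "complex_linear A \<Longrightarrow> complex_linear (- A)"
  by (simp add: complex_linear_def blinfun.minus_left linear_neg[OF bounded_linear.linear[OF bounded_linear_scaleC]])

lemma complex_linear_diff [intro]: "complex_linear A \<Longrightarrow> complex_linear B \<Longrightarrow> complex_linear (A - B)"
  using complex_linear_add[of A "- B"] complex_linear_uminus[of B] by simp

lemma op_power_0 [simp]: "op_power A 0 = id_blinfun"
  by (simp add: op_power_def)

lemma op_power_Suc: "op_power A (Suc n) = A o\<^sub>L op_power A n"
  by (simp add: op_power_def)

lemma complex_linear_op_power [intro]: "complex_linear A \<Longrightarrow> complex_linear (op_power A n)"
  by (induction n) (auto simp: op_power_Suc)

lemma op_power_commute: "A o\<^sub>L B = B o\<^sub>L A \<Longrightarrow> op_power A n o\<^sub>L B = B o\<^sub>L op_power A n"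
  by (induction n) (simp_all add: op_power_Suc op_comp_assoc, metis op_comp_assoc)

lemma op_power_comp:
  "A o\<^sub>L B = B o\<^sub>L A \<Longrightarrow> op_power (A o\<^sub>L B) n = op_power A n o\<^sub>L op_power B n"
  by (induction n) (simp_all add: op_power_Suc, metis op_comp_assoc op_power_commute)

lemma op_power_idem: "E o\<^sub>L E = E \<Longrightarrow> n \<ge> 1 \<Longrightarrow> op_power E n = E"
  by (induction n) (auto simp: op_power_Suc le_Suc_eq)

lemma norm_op_power_le: "norm (op_power A n) \<le> norm A ^ n"
proof (induction n)
  case 0
  show ?case by (simp add: norm_blinfun_id_le)
next
  case (Suc n)
  have "norm (op_power A (Suc n)) \<le> norm A * norm (op_power A n)"
    by (simp add: op_power_Suc norm_op_comp_le)
  also have "\<dots> \<le> norm A * norm A ^ n"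
    using Suc by (intro mult_left_mono) auto
  finally show ?case by simp
qed

lemma tendsto_op_power: "(A \<longlongrightarrow> L) F \<Longrightarrow> ((\<lambda>x. op_power (A x) n) \<longlongrightarrow> op_power L n) F"
  by (induction n) (auto simp: op_power_Suc intro: op_comp.tendsto)

section \<open>Inverses, resolvents and the spectrum\<close>

definition op_inverse :: "('a :: complex_hilbert_space) operator \<Rightarrow> 'a operator \<Rightarrow> bool" where
  "op_inverse A R \<longleftrightarrow> A o\<^sub>L R = id_blinfun \<and> R o\<^sub>L A = id_blinfun"

lemma op_inverse_unique: "op_inverse A R \<Longrightarrow> op_inverse A R' \<Longrightarrow> R = R'"
  unfolding op_inverse_def by (metis op_comp_assoc op_comp_id)

text \<open>\<open>spectrum\<close> asks for a complex linear inverse, while a Neumann series yields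
  an inverse in the space of real-linear operators. For a complex linear operator the two notions
  agree.\<close>

lemma complex_linear_op_inverse:
  assumes "complex_linear A" "op_inverse A R" shows "complex_linear R"
  unfolding complex_linear_def
proof (intro allI)
  fix c x
  have AR: "blinfun_apply A (blinfun_apply R y) = y" and RA: "blinfun_apply R (blinfun_apply A y) = y" for y
    using assms(2) unfolding op_inverse_def
    by (metis blinfun_apply_blinfun_compose blinfun_apply_id_blinfun id_apply)+
  have "blinfun_apply R (c *\<^sub>C x) = blinfun_apply R (c *\<^sub>C blinfun_apply A (blinfun_apply R x))"
    by (simp add: AR)
  also have "\<dots> = blinfun_apply R (blinfun_apply A (c *\<^sub>C blinfun_apply R x))"
    using assms(1) by (simp add: complex_linear_def)
  finally show "blinfun_apply R (c *\<^sub>C x) = c *\<^sub>C blinfun_apply R x"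
    by (simp add: RA)
qed

lemma Neumann_inverse:
  fixes T :: "('a :: complex_hilbert_space) operator"
  assumes T: "norm T \<le> 1 / 2"
  obtains R where "op_inverse (id_blinfun - T) R" "norm R \<le> 2"
proof -
  have le: "norm (op_power T n) \<le> (1 / 2) ^ n" for n
    using norm_op_power_le[of T n] power_mono[OF T, of n] by simp
  have sm: "summable (\<lambda>n. norm (op_power T n))"
    by (rule summable_comparison_test'[OF summable_geometric[of "1/2 :: real"]]) (use le in auto)
  then have s: "summable (\<lambda>n. op_power T n)" by (rule summable_norm_cancel)
  define R where "R = (\<Sum>n. op_power T n)"
  have split: "R = id_blinfun + (\<Sum>n. op_power T (Suc n))"
    using suminf_split_head[OF s] by (simp add: R_def)
  have 1: "T o\<^sub>L R = (\<Sum>n. op_power T (Suc n))"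
    unfolding R_def op_power_Suc
    by (rule bounded_linear.suminf[OF op_comp.bounded_linear_right s])
  have 2: "R o\<^sub>L T = (\<Sum>n. op_power T (Suc n))"
    unfolding R_def op_power_Suc op_power_commute[OF refl, symmetric]
    by (rule bounded_linear.suminf[OF op_comp.bounded_linear_left s])
  have "op_inverse (id_blinfun - T) R"
    using 1 2 split by (simp add: op_inverse_def op_comp.diff_left op_comp.diff_right)
  moreover have "norm R \<le> (\<Sum>n. norm (op_power T n))"
    unfolding R_def by (rule summable_norm[OF sm])
  moreover have "\<dots> \<le> (\<Sum>n. (1 / 2) ^ n)"
    by (rule suminf_le[OF le sm summable_geometric]) simp
  ultimately show thesis using that suminf_geometric[of "1/2::real"] by simp
qed

lemma op_inverse_perturb:
  fixes A :: "('a :: complex_hilbert_space) operator"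
  assumes R: "op_inverse A R" and B: "norm (B - A) * norm R \<le> 1 / 2"
  obtains R' where "op_inverse B R'" "norm R' \<le> 2 * norm R"
proof -
  define T where "T = (A - B) o\<^sub>L R"
  have "norm T \<le> norm (A - B) * norm R" by (simp add: T_def norm_op_comp_le)
  then have "norm T \<le> 1 / 2" using B by (simp add: norm_minus_commute)
  then obtain S where S: "op_inverse (id_blinfun - T) S" "norm S \<le> 2" by (rule Neumann_inverse)
  \<comment> \<open>Since \<open>R o\<^sub>L A\<close> is the identity,
    \<open>T o\<^sub>L A = A - B\<close>.\<close>
  have B: "B = (id_blinfun - T) o\<^sub>L A"
    using R by (simp add: T_def op_inverse_def op_comp.diff_left op_comp_assoc)
  have "op_inverse B (R o\<^sub>L S)"
  proof -
    have "B o\<^sub>L (R o\<^sub>L S) = (id_blinfun - T) o\<^sub>L ((A o\<^sub>L R) o\<^sub>L S)"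
      "(R o\<^sub>L S) o\<^sub>L B = R o\<^sub>L ((S o\<^sub>L (id_blinfun - T)) o\<^sub>L A)"
      unfolding B by (simp_all only: op_comp_assoc)
    then show ?thesis using R S by (simp add: op_inverse_def)
  qed
  moreover have "norm (R o\<^sub>L S) \<le> 2 * norm R"
    using norm_op_comp_le[of R S] mult_left_mono[OF S(2), of "norm R"] by simp
  ultimately show thesis by (rule that)
qed

text \<open>The sign is that of the Cauchy kernel, opposite to the one in \<open>spectrum\<close>.
  Two-sided inverses are unique, so the choice is determined off the spectrum.\<close>

definition resolvent :: "('a :: complex_hilbert_space) operator \<Rightarrow> complex \<Rightarrow> 'a operator" where
  "resolvent X z = (SOME R. op_inverse (scalar_op z - X) R)"

lemma notin_spectrumI:
  assumes "complex_linear X" "op_inverse (scalar_op z - X) R"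
  shows "z \<notin> spectrum X"
proof -
  have "complex_linear R" using assms by (intro complex_linear_op_inverse[OF _ assms(2)]) auto
  then show ?thesis
    using assms(2) unfolding spectrum_def op_inverse_def
    by (auto intro!: exI[of _ "- R"] simp: op_comp.minus_right op_comp.minus_left op_comp.diff_left op_comp.diff_right)
qed

lemma resolvent_eqI: "op_inverse (scalar_op z - X) R \<Longrightarrow> resolvent X z = R"
  unfolding resolvent_def by (metis op_inverse_unique someI)

lemma
  assumes "z \<notin> spectrum X"
  shows op_inverse_resolvent: "op_inverse (scalar_op z - X) (resolvent X z)"
    and complex_linear_resolvent: "complex_linear (resolvent X z)"
proof -
  obtain R where R: "complex_linear R" "(X - scalar_op z) o\<^sub>L R = id_blinfun"
      "R o\<^sub>L (X - scalar_op z) = id_blinfun"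
    using assms by (auto simp: spectrum_def)
  then have "op_inverse (scalar_op z - X) (- R)"
    by (simp add: op_inverse_def op_comp.minus_right op_comp.minus_left op_comp.diff_left op_comp.diff_right)
  moreover from this have "resolvent X z = - R" by (rule resolvent_eqI)
  ultimately show "op_inverse (scalar_op z - X) (resolvent X z)" "complex_linear (resolvent X z)"
    using R(1) by auto
qed

lemma resolvent_perturb:
  assumes "complex_linear X'" "z \<notin> spectrum X"
    and "norm ((scalar_op z' - X') - (scalar_op z - X)) * norm (resolvent X z) \<le> 1 / 2"
  shows "z' \<notin> spectrum X'" "norm (resolvent X' z') \<le> 2 * norm (resolvent X z)"
proof -
  obtain R' where "op_inverse (scalar_op z' - X') R'" "norm R' \<le> 2 * norm (resolvent X z)"
    using op_inverse_perturb[OF op_inverse_resolvent[OF assms(2)] assms(3)] by blast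
  then show "z' \<notin> spectrum X'" "norm (resolvent X' z') \<le> 2 * norm (resolvent X z)"
    using notin_spectrumI[OF assms(1)] resolvent_eqI by metis+
qed

text \<open>Point and operator vary at once: with \<open>X' = X\<close> this gives continuity in
  \<open>z\<close>, with \<open>z' = z\<close> the dependence on the operator and the difference
  quotient of the resolvent.\<close>

lemma resolvent_diff:
  assumes "z \<notin> spectrum X" "z' \<notin> spectrum X'"
  shows "resolvent X' z' - resolvent X z =
    resolvent X' z' o\<^sub>L ((scalar_op z - X) - (scalar_op z' - X')) o\<^sub>L resolvent X z"
  using op_inverse_resolvent[OF assms(1)] op_inverse_resolvent[OF assms(2)]
  unfolding op_inverse_def op_comp.diff_right[of _ "scalar_op z - X"]
    op_comp.diff_left[of "_ o\<^sub>L (scalar_op z - X)"]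
  by (simp add: op_comp_assoc)

lemma closed_spectrum:
  assumes "complex_linear X" shows "closed (spectrum X)"
proof -
  have "open (- spectrum X)"
    unfolding open_dist
  proof
    fix z assume z: "z \<in> - spectrum X"
    let ?n = "norm (resolvent X z)"
    \<comment> \<open>With this radius the perturbation times \<open>?n\<close> is at most 1/2; the
      summand 2 in the denominator also covers \<open>?n = 0\<close>.\<close>
    have "y \<in> - spectrum X" if "dist y z < 1 / (2 * ?n + 2)" for y
    proof -
      have "norm ((scalar_op y - X) - (scalar_op z - X)) * ?n \<le> dist y z * ?n"
        using norm_scalar_op_le[of "y - z"] by (intro mult_right_mono) (auto simp: scalar_op_diff dist_norm)
      also have "\<dots> \<le> 1 / (2 * ?n + 2) * ?n"
        using that by (intro mult_right_mono) auto
      also have "\<dots> \<le> 1 / 2" by (simp add: field_simps add_pos_nonneg)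
      finally show ?thesis using resolvent_perturb(1)[OF assms, of z X y] z by auto
    qed
    moreover have "1 / (2 * ?n + 2) > 0" by (simp add: add_nonneg_pos)
    ultimately show "\<exists>e>0. \<forall>y. dist y z < e \<longrightarrow> y \<in> - spectrum X" by blast
  qed
  then show ?thesis by (simp add: closed_def)
qed

lemma continuous_on_resolvent:
  assumes X: "complex_linear X" shows "continuous_on (- spectrum X) (resolvent X)"
proof -
  have "isCont (resolvent X) z" if z: "z \<notin> spectrum X" for z
  proof -
    let ?n = "norm (resolvent X z)"
    have lim: "((\<lambda>y. scalar_op y - X) \<longlongrightarrow> scalar_op z - X) (at z)"
      by (intro tendsto_intros tendsto_scalar_op)
    then have lim0: "((\<lambda>y. norm ((scalar_op y - X) - (scalar_op z - X))) \<longlongrightarrow> 0) (at z)"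
      by (intro tendsto_norm_zero LIM_zero)
    then have "((\<lambda>y. norm ((scalar_op y - X) - (scalar_op z - X)) * ?n) \<longlongrightarrow> 0) (at z)"
      by (rule tendsto_mult_left_zero)
    then have "eventually (\<lambda>y. norm ((scalar_op y - X) - (scalar_op z - X)) * ?n < 1/2) (at z)"
      by (rule order_tendstoD) simp
    then have "eventually (\<lambda>y. norm (resolvent X y - resolvent X z) \<le>
       norm ((scalar_op y - X) - (scalar_op z - X)) * (2 * ?n * ?n)) (at z)"
    proof (rule eventually_mono)
      fix y assume "norm ((scalar_op y - X) - (scalar_op z - X)) * ?n < 1/2"
      then have y: "y \<notin> spectrum X" "norm (resolvent X y) \<le> 2 * ?n"
        using resolvent_perturb[OF X z, of y] by auto
      have "norm (resolvent X y - resolvent X z) \<le>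
          norm (resolvent X y) * norm ((scalar_op z - X) - (scalar_op y - X)) * ?n"
        unfolding resolvent_diff[OF z y(1)] by (rule norm_op_comp_le3)
      also have "\<dots> \<le> (2 * ?n) * norm ((scalar_op z - X) - (scalar_op y - X)) * ?n"
        using y(2) by (intro mult_right_mono) auto
      finally show "norm (resolvent X y - resolvent X z) \<le>
        norm ((scalar_op y - X) - (scalar_op z - X)) * (2 * ?n * ?n)"
        by (simp add: norm_minus_commute mult_ac)
    qed
    moreover have "((\<lambda>y. norm ((scalar_op y - X) - (scalar_op z - X)) * (2 * ?n * ?n)) \<longlongrightarrow> 0) (at z)"
      using lim0 by (rule tendsto_mult_left_zero)
    ultimately have "((\<lambda>y. resolvent X y - resolvent X z) \<longlongrightarrow> 0) (at z)"
      by (rule Lim_null_comparison)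
    then show ?thesis unfolding isCont_def by (rule LIM_zero_cancel)
  qed
  then show ?thesis by (simp add: continuous_at_imp_continuous_on)
qed

section \<open>Tagged refinements\<close>

text \<open>This makes limits along the filter unique. Finitely many Borel partitions have a common
  refinement that is again finite and Borel, and its cells are nonempty, so they can be
  tagged.\<close>

lemma tagged_refinements_neq_bot: "tagged_refinements S \<noteq> bot"
  unfolding tagged_refinements_def
proof (rule INF_filter_not_bot)
  fix X assume X: "X \<subseteq> {P. borel_partition S P}" "finite X"
  let ?A = "\<lambda>P. {(Q, \<tau>). borel_partition S Q \<and> refines S Q P \<and> (\<forall>B \<in> Q. \<tau> B \<in> B)}"
  show "(INF P\<in>X. principal (?A P)) \<noteq> bot"
  proof (cases "X = {}")
    case False
    have part: "\<And>P. P \<in> X \<Longrightarrow> partition_on S P" "\<And>P. P \<in> X \<Longrightarrow> finite P"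
      "\<And>P. P \<in> X \<Longrightarrow> P \<subseteq> sets borel"
      using X by (auto simp: borel_partition_def)
    define R where "R = common_refinement X"
    have "partition_on S R" unfolding R_def using part False by (intro partition_on_common_refinement)
    moreover have "finite R" unfolding R_def using part X by (intro finite_common_refinement)
    moreover have "R \<subseteq> sets borel"
    proof
      fix B assume "B \<in> R"
      then obtain f where f: "f \<in> (\<Pi> P\<in>X. P)" "B = \<Inter> (f ` X)"
        unfolding R_def common_refinement by blast
      then show "B \<in> sets borel"
        using X False part(3) by (auto intro!: sets.finite_INT)
    qed
    ultimately have R: "borel_partition S R" by (simp add: borel_partition_def)
    have "\<forall>B\<in>R. B \<noteq> {}" by (simp add: R_def common_refinement_def)
    then obtain \<tau> where "\<forall>B\<in>R. \<tau> B \<in> B" by (metis all_not_in_conv)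
    moreover have "refines S R P" if "P \<in> X" for P
      unfolding R_def using part that by (intro refines_common_refinement)
    ultimately have "(R, \<tau>) \<in> (\<Inter>P\<in>X. ?A P)" using R by blast
    then show ?thesis
      unfolding INF_principal_finite[OF X(2)] principal_eq_bot_iff by blast
  qed (simp add: trivial_limit_def)
qed

lemma fibre_partition:
  assumes "S \<in> sets borel" "finite (g ` S)" "\<And>y. y \<in> g ` S \<Longrightarrow> {z \<in> S. g z = y} \<in> sets borel"
  shows "borel_partition S ((\<lambda>y. {z \<in> S. g z = y}) ` g ` S)"
  unfolding borel_partition_def
proof (intro conjI)
  show "partition_on S ((\<lambda>y. {z \<in> S. g z = y}) ` g ` S)"
    by (rule partition_onI) (auto simp: disjnt_iff)
qed (use assms in auto)

definition fine_partition :: "real \<Rightarrow> complex set set \<Rightarrow> bool" where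
  "fine_partition d P \<longleftrightarrow> (\<forall>B\<in>P. \<forall>x\<in>B. \<forall>y\<in>B. cmod (x - y) \<le> d)"

text \<open>One partition suffices, since its refinements inherit both properties: grid squares of
  side \<open>d / 2\<close>, split by \<open>L\<close>. Two points of a square differ by at most
  \<open>d / 2\<close> in each coordinate, hence by at most \<open>d\<close> in modulus.\<close>

lemma eventually_tagged_refinements:
  assumes S: "S \<in> sets borel" "bounded S" and L: "L \<in> sets borel" and d: "d > 0"
  shows "eventually (\<lambda>(P, \<tau>). borel_partition S P \<and> (\<forall>B\<in>P. \<tau> B \<in> B) \<and> fine_partition d P \<and>
           (\<forall>B\<in>P. B \<subseteq> L \<or> B \<inter> L = {})) (tagged_refinements S)"
proof -
  define e where "e = d / 2"
  have e: "e > 0" using d by (simp add: e_def)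
  define g where "g = (\<lambda>z. (\<lfloor>Re z / e\<rfloor>, \<lfloor>Im z / e\<rfloor>, z \<in> L))"
  define P0 where "P0 = (\<lambda>y. {z \<in> S. g z = y}) ` g ` S"
  obtain R where R: "\<And>z. z \<in> S \<Longrightarrow> cmod z \<le> R" using S(2) by (auto simp: bounded_iff)
  define n where "n = \<lceil>R / e\<rceil> + 1"
  have "finite (g ` S)"
  proof (rule finite_subset)
    have fl: "\<lfloor>x / e\<rfloor> \<in> {-n..n}" if "\<bar>x\<bar> \<le> R" for x
    proof -
      have "\<bar>x / e\<bar> \<le> R / e" using that e by (simp add: abs_divide divide_right_mono)
      then have "- (R / e) \<le> x / e" "x / e \<le> R / e" by linarith+
      then have "- n \<le> \<lfloor>x / e\<rfloor>" "\<lfloor>x / e\<rfloor> \<le> n" unfolding n_def by linarith+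
      then show ?thesis by simp
    qed
    show "g ` S \<subseteq> {-n..n} \<times> {-n..n} \<times> UNIV"
    proof
      fix y assume "y \<in> g ` S"
      then obtain z where z: "z \<in> S" "y = g z" by blast
      have "\<bar>Re z\<bar> \<le> R" "\<bar>Im z\<bar> \<le> R"
        using R[OF z(1)] abs_Re_le_cmod[of z] abs_Im_le_cmod[of z] by linarith+
      then show "y \<in> {-n..n} \<times> {-n..n} \<times> UNIV"
        unfolding z(2) g_def using fl by blast
    qed
  qed auto
  moreover have "{z \<in> S. g z = y} \<in> sets borel" for y
  proof (cases y)
    case (fields i j b)
    have "{z \<in> S. g z = y} = S \<inter> ({z. \<lfloor>Re z / e\<rfloor> = i} \<inter> {z. \<lfloor>Im z / e\<rfloor> = j}) \<inter> (if b then L else - L)"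
      by (auto simp: g_def fields)
    also have "\<dots> \<in> sets borel"
      using S L by (intro sets.Int) auto
    finally show ?thesis .
  qed
  ultimately have P0: "borel_partition S P0"
    unfolding P0_def using S by (intro fibre_partition) auto
  have main: "fine_partition d Q \<and> (\<forall>B\<in>Q. B \<subseteq> L \<or> B \<inter> L = {})" if Q: "refines S Q P0" for Q
  proof
    have same: "g x = g y" if xy: "B \<in> Q" "x \<in> B" "y \<in> B" for B x y
    proof -
      obtain B' where B': "B' \<in> P0" "B \<subseteq> B'" using Q xy(1) unfolding refines_def by metis
      obtain y' where "B' = {z \<in> S. g z = y'}" using B'(1) unfolding P0_def by (elim imageE)
      then have "g x = y'" "g y = y'" using B'(2) xy(2,3) by auto
      then show ?thesis by (simp only:)
    qed
    show "fine_partition d Q"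
      unfolding fine_partition_def
    proof (intro ballI)
      fix B x y assume "B \<in> Q" "x \<in> B" "y \<in> B"
      then have "g x = g y" by (rule same)
      then have eq: "\<lfloor>Re x / e\<rfloor> = \<lfloor>Re y / e\<rfloor>" "\<lfloor>Im x / e\<rfloor> = \<lfloor>Im y / e\<rfloor>"
        by (simp_all only: g_def prod.inject)
      have close: "\<bar>u - v\<bar> \<le> e" if "\<lfloor>u / e\<rfloor> = \<lfloor>v / e\<rfloor>" for u v
      proof -
        have "\<bar>u / e - v / e\<bar> \<le> 1" using that by linarith
        then have "\<bar>u - v\<bar> / e \<le> 1" using e by (simp add: abs_divide flip: diff_divide_distrib)
        then show ?thesis using e by simp
      qed
      have "cmod (x - y) \<le> \<bar>Re (x - y)\<bar> + \<bar>Im (x - y)\<bar>" by (rule cmod_le)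
      also have "\<dots> \<le> e + e" using close eq by (intro add_mono) auto
      finally show "cmod (x - y) \<le> d" by (simp add: e_def)
    qed
    have "x \<in> L \<longleftrightarrow> y \<in> L" if "B \<in> Q" "x \<in> B" "y \<in> B" for B x y
      using same[OF that] by (simp only: g_def prod.inject)
    then show "\<forall>B\<in>Q. B \<subseteq> L \<or> B \<inter> L = {}"
      by blast
  qed
  show ?thesis
    unfolding tagged_refinements_def
  proof (rule eventually_INF1[of P0])
    show "P0 \<in> {P. borel_partition S P}" using P0 by simp
  qed (use main in \<open>simp add: eventually_principal split_beta, blast\<close>)
qed

lemma has_op_integral_unique:
  assumes "has_op_integral E S \<Phi> A" "has_op_integral E S \<Phi> B" shows "A = B"
  by (intro blinfun_eqI tendsto_unique[OF tagged_refinements_neq_bot])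
    (rule assms[unfolded has_op_integral_def, rule_format])+

lemma op_integral_eqI: "has_op_integral E S \<Phi> A \<Longrightarrow> op_integral E S \<Phi> = A"
  unfolding op_integral_def by (blast intro: has_op_integral_unique)

lemma has_op_integral_op_integral: "op_integrable E S \<Phi> \<Longrightarrow> has_op_integral E S \<Phi> (op_integral E S \<Phi>)"
  unfolding op_integrable_def using op_integral_eqI by metis

lemma has_op_integral_add:
  assumes "has_op_integral E S \<Phi> A" "has_op_integral E S \<Psi> B"
  shows "has_op_integral E S (\<lambda>z. \<Phi> z + \<Psi> z) (A + B)"
  unfolding has_op_integral_def
proof
  fix x
  note lim = assms[unfolded has_op_integral_def, rule_format, of x]
  show "((\<lambda>(P, \<tau>). \<Sum>B\<in>P. blinfun_apply ((\<Phi> (\<tau> B) + \<Psi> (\<tau> B)) o\<^sub>L E B) x) \<longlongrightarrow> blinfun_apply (A + B) x)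
     (tagged_refinements S)"
    using tendsto_add[OF lim]
    by (simp only: case_prod_unfold op_comp.add_left blinfun.add_left sum.distrib)
qed

lemma has_gdoi_unique:
  assumes "has_gdoi X1 E1 m1 X2 E2 m2 \<beta> Y A" "has_gdoi X1 E1 m1 X2 E2 m2 \<beta> Y B" shows "A = B"
proof -
  have "tagged_refinements (spectrum X1) \<times>\<^sub>F tagged_refinements (spectrum X2) \<noteq> bot"
    by (simp add: prod_filter_eq_bot tagged_refinements_neq_bot)
  then show ?thesis
    by (intro blinfun_eqI)
      (rule tendsto_unique[OF _ assms[unfolded has_gdoi_def has_double_op_integral_def, rule_format]])
qed

lemma gdoi_eqI: "has_gdoi X1 E1 m1 X2 E2 m2 \<beta> Y A \<Longrightarrow> gdoi X1 E1 m1 X2 E2 m2 \<beta> Y = A"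
  unfolding gdoi_def by (blast intro: has_gdoi_unique)

section \<open>Spectral measures\<close>

text \<open>Baire's theorem: the closed sets \<open>F k\<close> cover the space, so one of them
  contains a ball \<open>cball x0 r\<close>. A vector \<open>v\<close> of norm \<open>r\<close> is
  the difference of \<open>x0 + v\<close> and \<open>x0\<close>, both in \<open>F k\<close>, which
  gives the bound \<open>2 * real k / r\<close>.\<close>

lemma Banach_Steinhaus:
  fixes T :: "nat \<Rightarrow> ('a :: banach) \<Rightarrow>\<^sub>L ('b :: real_normed_vector)"
  assumes "\<And>x. \<exists>c. \<forall>n. norm (blinfun_apply (T n) x) \<le> c"
  shows "\<exists>M. \<forall>n. norm (T n) \<le> M"
proof -
  define F where "F = (\<lambda>k :: nat. {x. \<forall>n. norm (blinfun_apply (T n) x) \<le> real k})"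
  have closed: "closed (F k)" for k
    unfolding F_def by (intro closed_Collect_all closed_Collect_le continuous_intros)
  have "\<exists>k. interior (F k) \<noteq> {}"
  proof (rule ccontr)
    assume "\<not> ?thesis"
    then have "interior (F k) = {}" for k by blast
    then have "closure (- F k) = UNIV" for k by (simp add: closure_complement)
    moreover have "Met_TC.mcomplete TYPE('a)"
      by (simp add: complete_UNIV)
    moreover have "openin Met_TC.mtopology (- F k)" for k
      using closed by (simp add: open_Compl)
    ultimately have "Met_TC.mtopology closure_of \<Inter> (range (\<lambda>k. - F k)) = UNIV"
      by (intro Met_TC.metric_Baire_category) auto
    moreover have "\<Inter> (range (\<lambda>k. - F k)) = {}"
    proof -
      have "x \<in> (\<Union>k. F k)" for x
      proof -
        obtain c where "\<forall>n. norm (blinfun_apply (T n) x) \<le> c" using assms by blast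
        moreover obtain k where "c \<le> real k" using real_arch_simple by blast
        ultimately have "x \<in> F k" unfolding F_def using order_trans by blast
        then show ?thesis by blast
      qed
      then show ?thesis by blast
    qed
    ultimately show False by simp
  qed
  then obtain k x0 where "x0 \<in> interior (F k)" by blast
  then obtain r where r: "r > 0" "cball x0 r \<subseteq> F k" by (auto simp: mem_interior_cball)
  have "norm (T n) \<le> 2 * real k / r" for n
  proof (rule norm_blinfun_bound)
    fix y
    show "norm (blinfun_apply (T n) y) \<le> 2 * real k / r * norm y"
    proof (cases "y = 0")
      case False
      define v where "v = (r / norm y) *\<^sub>R y"
      have "x0 + v \<in> F k" "x0 \<in> F k" using r False by (auto intro!: subsetD[OF r(2)] simp: v_def dist_norm)
      then have "norm (blinfun_apply (T n) (x0 + v)) \<le> k" "norm (blinfun_apply (T n) x0) \<le> k" by (auto simp: F_def)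
      moreover have "blinfun_apply (T n) v = blinfun_apply (T n) (x0 + v) - blinfun_apply (T n) x0"
        by (simp add: blinfun.add_right)
      ultimately have "norm (blinfun_apply (T n) v) \<le> 2 * real k"
        using norm_triangle_ineq4[of "blinfun_apply (T n) (x0 + v)" "blinfun_apply (T n) x0"] by simp
      then show ?thesis using r False by (simp add: v_def blinfun.scaleR_right field_simps)
    qed simp
  qed (use r in auto)
  then show ?thesis by blast
qed

text \<open>The norm of \<open>u + \<Sum> c\<^sub>i v\<^sub>i\<close> is convex in \<open>c\<close>, so on the unit cube it is largest at a vertex.\<close>

lemma norm_sum_cube_le:
  fixes v :: "'i \<Rightarrow> 'b :: real_normed_vector"
  assumes "finite I" "\<And>J. J \<subseteq> I \<Longrightarrow> norm (u + (\<Sum>i\<in>J. v i)) \<le> M"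
    and "\<And>i. i \<in> I \<Longrightarrow> 0 \<le> c i \<and> c i \<le> 1"
  shows "norm (u + (\<Sum>i\<in>I. c i *\<^sub>R v i)) \<le> M"
  using assms
proof (induction I arbitrary: u rule: finite_induct)
  case empty
  then show ?case using empty(1)[of "{}"] by simp
next
  case (insert j I)
  let ?s = "\<Sum>i\<in>I. c i *\<^sub>R v i"
  have c: "0 \<le> c j" "c j \<le> 1" using insert.prems by auto
  have 1: "norm ((u + v j) + ?s) \<le> M"
  proof (rule insert.IH)
    fix J assume "J \<subseteq> I"
    then have "j \<notin> J" "finite J" using insert.hyps finite_subset by auto
    then show "norm (u + v j + sum v J) \<le> M"
      using insert.prems(1)[of "insert j J"] insert_mono[OF \<open>J \<subseteq> I\<close>, of j] by (simp add: add.assoc)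
  qed (use insert.prems in auto)
  have 2: "norm (u + ?s) \<le> M"
    by (rule insert.IH) (use insert.prems in auto)
  have "u + (\<Sum>i\<in>insert j I. c i *\<^sub>R v i) = c j *\<^sub>R ((u + v j) + ?s) + (1 - c j) *\<^sub>R (u + ?s)"
    using insert.hyps by (simp add: algebra_simps)
  also have "norm \<dots> \<le> c j * norm ((u + v j) + ?s) + (1 - c j) * norm (u + ?s)"
    using c by (intro order_trans[OF norm_triangle_ineq]) simp
  also have "\<dots> \<le> c j * M + (1 - c j) * M"
    using 1 2 c by (intro add_mono mult_left_mono) auto
  finally show ?case by (simp add: algebra_simps)
qed

text \<open>Writing \<open>c i = r * (2 * d i - 1)\<close> with \<open>d i\<close> between 0 and 1
  reduces to the unit cube; the two summands contribute \<open>2 * r * M\<close> and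
  \<open>r * M\<close>.\<close>

lemma norm_sum_real_le:
  fixes v :: "'i \<Rightarrow> 'b :: real_normed_vector"
  assumes "finite I" "\<And>J. J \<subseteq> I \<Longrightarrow> norm (\<Sum>i\<in>J. v i) \<le> M"
    and c: "\<And>i. i \<in> I \<Longrightarrow> \<bar>c i\<bar> \<le> r" and r: "r > 0"
  shows "norm (\<Sum>i\<in>I. c i *\<^sub>R v i) \<le> 3 * r * M"
proof -
  define d where "d = (\<lambda>i. (c i / r + 1) / 2)"
  have eq: "c i = r * (2 * d i - 1)" for i using r by (simp add: d_def field_simps)
  have "0 \<le> d i \<and> d i \<le> 1" if "i \<in> I" for i
    using c[OF that] r by (auto simp: d_def abs_le_iff field_simps)
  then have 1: "norm (\<Sum>i\<in>I. d i *\<^sub>R v i) \<le> M"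
    using norm_sum_cube_le[OF assms(1), of 0 v M d] assms(2) by simp
  have "(\<Sum>i\<in>I. c i *\<^sub>R v i) = (2 * r) *\<^sub>R (\<Sum>i\<in>I. d i *\<^sub>R v i) - r *\<^sub>R (\<Sum>i\<in>I. v i)"
    unfolding eq by (simp add: scaleR_sum_right sum_subtractf[symmetric] algebra_simps)
  also have "norm \<dots> \<le> 2 * r * norm (\<Sum>i\<in>I. d i *\<^sub>R v i) + r * norm (\<Sum>i\<in>I. v i)"
    using r by (intro order_trans[OF norm_triangle_ineq4]) simp
  also have "\<dots> \<le> 2 * r * M + r * M"
    using 1 assms(2)[of I] r by (intro add_mono mult_left_mono) auto
  finally show ?thesis by (simp add: algebra_simps)
qed

text \<open>Real and imaginary parts contribute \<open>3 * r * M\<close> each. The bound does not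
  grow with the number of terms; this replaces an estimate by total variation.\<close>

lemma norm_sum_scalar_op_le:
  fixes v :: "'i \<Rightarrow> ('a :: complex_hilbert_space) operator"
  assumes "finite I" "\<And>J. J \<subseteq> I \<Longrightarrow> norm (\<Sum>i\<in>J. v i) \<le> M"
    and c: "\<And>i. i \<in> I \<Longrightarrow> cmod (c i) \<le> r" and r: "r > 0"
  shows "norm (\<Sum>i\<in>I. scalar_op (c i) o\<^sub>L v i) \<le> 6 * r * M"
proof -
  have eq: "scalar_op (c i) o\<^sub>L v i = Re (c i) *\<^sub>R v i + (scalar_op \<i> o\<^sub>L (Im (c i) *\<^sub>R v i))" for i
  proof -
    have "(scalar_op (c i) :: 'a operator) = scalar_op (of_real (Re (c i))) + (scalar_op \<i> o\<^sub>L scalar_op (of_real (Im (c i))))"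
      unfolding scalar_op_mult[symmetric] scalar_op_add[symmetric] by (rule arg_cong[OF complex_eq])
    then show ?thesis
      by (simp add: scalar_op_of_real op_comp.add_left op_comp.scaleR_left op_comp.scaleR_right)
  qed
  have re: "norm (\<Sum>i\<in>I. Re (c i) *\<^sub>R v i) \<le> 3 * r * M"
    using assms(2) order_trans[OF abs_Re_le_cmod c] by (intro norm_sum_real_le[OF assms(1)] r) auto
  have im: "norm (\<Sum>i\<in>I. Im (c i) *\<^sub>R v i) \<le> 3 * r * M"
    using assms(2) order_trans[OF abs_Im_le_cmod c] by (intro norm_sum_real_le[OF assms(1)] r) auto
  have "(\<Sum>i\<in>I. scalar_op (c i) o\<^sub>L v i)
     = (\<Sum>i\<in>I. Re (c i) *\<^sub>R v i) + (scalar_op \<i> o\<^sub>L (\<Sum>i\<in>I. Im (c i) *\<^sub>R v i))"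
    by (simp add: eq sum.distrib op_comp.sum_right)
  also have "norm \<dots> \<le> 3 * r * M + 3 * r * M"
  proof (rule order_trans[OF norm_triangle_ineq] add_mono[OF re])+
    have "norm (scalar_op \<i> o\<^sub>L (\<Sum>i\<in>I. Im (c i) *\<^sub>R v i)) \<le>
        norm (scalar_op \<i> :: 'a operator) * norm (\<Sum>i\<in>I. Im (c i) *\<^sub>R v i)" by (rule norm_op_comp_le)
    also have "\<dots> \<le> 1 * (3 * r * M)"
      using norm_scalar_op_le[where ?'a='a, of \<i>] im by (intro mult_mono) auto
    finally show "norm (scalar_op \<i> o\<^sub>L (\<Sum>i\<in>I. Im (c i) *\<^sub>R v i)) \<le> 3 * r * M" by simp
  qed
  finally show ?thesis by (simp add: mult_ac)
qed

locale spectral_resolution =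
  fixes S :: "complex set" and E :: "complex set \<Rightarrow> ('a :: complex_hilbert_space) operator"
  assumes spectral_measure: "spectral_measure S E"
begin

lemma S_borel: "S \<in> sets borel"
  using spectral_measure by (simp add: spectral_measure_def)

abbreviation msets :: "complex set set" where "msets \<equiv> sets (restrict_space borel S)"

lemma msets_iff: "B \<in> msets \<longleftrightarrow> B \<in> sets borel \<and> B \<subseteq> S"
  using S_borel by (auto simp: sets_restrict_space_iff)

lemma S_msets [simp]: "S \<in> msets"
  by (simp add: msets_iff S_borel)

lemma complex_linear_E: "B \<in> msets \<Longrightarrow> complex_linear (E B)"
  using spectral_measure by (simp add: spectral_measure_def msets_iff)

lemma E_comp: "B \<in> msets \<Longrightarrow> C \<in> msets \<Longrightarrow> E B o\<^sub>L E C = E (B \<inter> C)"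
  using spectral_measure by (simp add: spectral_measure_def msets_iff)

lemma E_S: "E S = id_blinfun"
  using spectral_measure by (simp add: spectral_measure_def)

lemma E_sums:
  "range B \<subseteq> msets \<Longrightarrow> disjoint_family B \<Longrightarrow>
    (\<lambda>n :: nat. blinfun_apply (E (B n)) x) sums blinfun_apply (E (\<Union>n. B n)) x"
  using spectral_measure by (auto simp: spectral_measure_def msets_iff image_subset_iff)

lemma E_empty [simp]: "E {} = 0"
proof (rule blinfun_eqI)
  fix x
  have "(\<lambda>n :: nat. blinfun_apply (E {}) x) sums blinfun_apply (E (\<Union>n :: nat. {})) x"
    by (rule E_sums) (auto simp: disjoint_family_on_def)
  then have "(\<lambda>n :: nat. blinfun_apply (E {}) x) \<longlonglongrightarrow> 0"
    by (intro summable_LIMSEQ_zero sums_summable)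
  then show "blinfun_apply (E {}) x = blinfun_apply 0 x"
    by (simp add: LIMSEQ_const_iff)
qed

lemma E_Un: "B \<in> msets \<Longrightarrow> C \<in> msets \<Longrightarrow> B \<inter> C = {} \<Longrightarrow> E (B \<union> C) = E B + E C"
proof (rule blinfun_eqI)
  fix x assume BC: "B \<in> msets" "C \<in> msets" "B \<inter> C = {}"
  have "(\<lambda>n. blinfun_apply (E (binaryset B C n)) x) sums blinfun_apply (E (\<Union>n. binaryset B C n)) x"
    using BC by (intro E_sums) (auto simp: range_binaryset_eq disjoint_family_on_def binaryset_def)
  moreover have "(\<lambda>n. blinfun_apply (E (binaryset B C n)) x) sums (blinfun_apply (E B) x + blinfun_apply (E C) x)"
    by (rule binaryset_sums) simp
  ultimately show "blinfun_apply (E (B \<union> C)) x = blinfun_apply (E B + E C) x"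
    by (simp add: UN_binaryset_eq blinfun.add_left sums_unique2)
qed

lemma E_UN:
  "finite I \<Longrightarrow> A ` I \<subseteq> msets \<Longrightarrow> disjoint_family_on A I \<Longrightarrow> E (\<Union>i\<in>I. A i) = (\<Sum>i\<in>I. E (A i))"
proof (induction I rule: finite_induct)
  case (insert j I)
  have "E (A j \<union> (\<Union>i\<in>I. A i)) = E (A j) + E (\<Union>i\<in>I. A i)"
    using insert.prems insert.hyps by (intro E_Un sets.finite_UN) (auto simp: disjoint_family_on_def)
  moreover have "E (\<Union>i\<in>I. A i) = (\<Sum>i\<in>I. E (A i))"
    using insert.prems by (intro insert.IH) (auto simp: disjoint_family_on_def)
  ultimately show ?case using insert.hyps by simp
qed simp

text \<open>If the projections were unbounded, repeated splitting would give disjoint sets \<open>C\<^sub>n\<close> with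
  \<open>norm (E C\<^sub>n) > n\<close>; but \<open>E C\<^sub>n\<close> tends strongly to \<open>0\<close>.\<close>

lemma E_bounded_ex: "\<exists>M. \<forall>B\<in>msets. norm (E B) \<le> M"
proof (rule ccontr)
  assume contr: "\<not> ?thesis"
  define unb where "unb = (\<lambda>A. \<forall>M. \<exists>B\<in>msets. B \<subseteq> A \<and> norm (E B) > M)"
  have "unb S" unfolding unb_def using contr by (metis msets_iff not_le)
  define P where "P = (\<lambda>(n :: nat) (A, B :: complex set). A \<in> msets \<and> unb A)"
  \<comment> \<open>The first set of a pair is kept for further splitting, the second is the piece
    just split off. The pieces split off along the sequence are disjoint.\<close>
  define Q where "Q = (\<lambda>n (A, B :: complex set) (A', B'). A' \<subseteq> A \<and> B' \<subseteq> A \<and> B' \<in> msets \<and>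
      A' \<inter> B' = {} \<and> norm (E B') > real n)"
  have step: "\<exists>y. P (Suc n) y \<and> Q n x y" if Px: "P n x" for n x
  proof -
    obtain A B0 where x: "x = (A, B0)" by fastforce
    have A: "A \<in> msets" "unb A" using Px by (auto simp: P_def x)
    \<comment> \<open>Exceeding \<open>norm (E A)\<close> by \<open>n\<close> makes the complement
      large too, because \<open>E (A - B) = E A - E B\<close>. So whichever half stays unbounded,
      the other one can be split off.\<close>
    then obtain B where B: "B \<in> msets" "B \<subseteq> A" "norm (E B) > norm (E A) + real n"
      unfolding unb_def by blast
    have AB: "A - B \<in> msets" using A B by blast
    have EA: "E A = E B + E (A - B)" using E_Un[OF B(1) AB] B(2) by (simp add: Un_absorb1)
    then have "norm (E B) \<le> norm (E A) + norm (E (A - B))"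
      using norm_triangle_ineq4[of "E A" "E (A - B)"] by simp
    then have big: "norm (E (A - B)) > real n" "norm (E B) > real n" using B(3) norm_ge_zero[of "E A"] by linarith+
    have "unb B \<or> unb (A - B)"
    proof (rule ccontr)
      assume "\<not> ?thesis"
      then obtain M1 M2 where M: "\<And>C. C \<in> msets \<Longrightarrow> C \<subseteq> B \<Longrightarrow> norm (E C) \<le> M1"
         "\<And>C. C \<in> msets \<Longrightarrow> C \<subseteq> A - B \<Longrightarrow> norm (E C) \<le> M2"
        unfolding unb_def by (meson not_le)
      have "norm (E C) \<le> M1 + M2" if C: "C \<in> msets" "C \<subseteq> A" for C
      proof -
        have CB: "C \<inter> B \<in> msets" "C - B \<in> msets" using C B by blast+
        have "E C = E (C \<inter> B) + E (C - B)" using E_Un[OF CB] by (simp add: Int_Diff_Un Int_Diff_disjoint)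
        also have "norm \<dots> \<le> M1 + M2"
          using C CB by (intro order_trans[OF norm_triangle_ineq] add_mono M) auto
        finally show ?thesis .
      qed
      then show False using A(2) unfolding unb_def by (meson not_le)
    qed
    then show ?thesis
    proof
      assume "unb B"
      then show ?thesis using A B AB big by (intro exI[of _ "(B, A - B)"]) (auto simp: P_def Q_def x)
    next
      assume "unb (A - B)"
      then show ?thesis using A B AB big by (intro exI[of _ "(A - B, B)"]) (auto simp: P_def Q_def x)
    qed
  qed
  have "P 0 (S, {})" using \<open>unb S\<close> by (simp add: P_def)
  then obtain g where g: "\<And>n. P n (g n)" "\<And>n. Q n (g n) (g (Suc n))"
    using dependent_nat_choice[of P Q] step by blast
  define A where "A = (\<lambda>n. fst (g n))"
  define C where "C = (\<lambda>n. snd (g (Suc n)))"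
  have AC: "A (Suc n) \<subseteq> A n" "C n \<subseteq> A n" "C n \<in> msets" "A (Suc n) \<inter> C n = {}" "norm (E (C n)) > real n" for n
    using g(2)[of n] by (auto simp: Q_def A_def C_def split_beta)
  have mono: "A n \<subseteq> A k" if "k \<le> n" for k n
    using that AC(1) by (rule lift_Suc_antimono_le[rotated])
  have "C k \<inter> C n = {}" if "k < n" for k n
  proof -
    have "C n \<subseteq> A (Suc k)" using AC(2)[of n] mono[of "Suc k" n] that by auto
    then show ?thesis using AC(4)[of k] by blast
  qed
  then have disj: "disjoint_family C"
    unfolding disjoint_family_on_def by (metis Int_commute linorder_neqE_nat)
  have "\<exists>c. \<forall>n. norm (blinfun_apply (E (C n)) x) \<le> c" for x
  proof -
    have "(\<lambda>n. blinfun_apply (E (C n)) x) \<longlonglongrightarrow> 0"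
      using E_sums[OF _ disj, of x] AC(3) by (intro summable_LIMSEQ_zero sums_summable) auto
    then have "Bseq (\<lambda>n. blinfun_apply (E (C n)) x)" by (intro convergent_imp_Bseq convergentI)
    then show ?thesis by (auto simp: Bseq_def)
  qed
  then obtain M where "\<And>n. norm (E (C n)) \<le> M"
    using Banach_Steinhaus[of "\<lambda>n. E (C n)"] by blast
  moreover obtain n where "M \<le> real n" using real_arch_simple by blast
  ultimately show False using AC(5)[of n] by (metis not_le order_trans)
qed

definition E_bound :: real where
  "E_bound = (SOME M. \<forall>B\<in>msets. norm (E B) \<le> M)"

lemma norm_E_le: "B \<in> msets \<Longrightarrow> norm (E B) \<le> E_bound"
  using someI_ex[OF E_bounded_ex] unfolding E_bound_def by blast

lemma E_bound_nonneg: "E_bound \<ge> 0"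
  using norm_E_le[of "{}"] by simp

text \<open>Coefficients are controlled on nonempty sets only: a common refinement of two partitions
  is indexed by pairs of cells, and the tags of disjoint cells need not be close.\<close>

lemma norm_simple_le:
  assumes I: "finite I" "A ` I \<subseteq> msets" "disjoint_family_on A I"
    and c: "\<And>i. i \<in> I \<Longrightarrow> A i \<noteq> {} \<Longrightarrow> cmod (c i) \<le> r" and r: "r > 0"
  shows "norm (\<Sum>i\<in>I. scalar_op (c i) o\<^sub>L E (A i)) \<le> 6 * r * E_bound"
proof -
  define J where "J = {i \<in> I. A i \<noteq> {}}"
  have "(\<Sum>i\<in>I. scalar_op (c i) o\<^sub>L E (A i)) = (\<Sum>i\<in>J. scalar_op (c i) o\<^sub>L E (A i))"
    using I(1) by (intro sum.mono_neutral_right) (auto simp: J_def op_comp.zero_right)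
  also have "norm \<dots> \<le> 6 * r * E_bound"
  proof (rule norm_sum_scalar_op_le)
    fix K assume K: "K \<subseteq> J"
    then have KI: "K \<subseteq> I" by (auto simp: J_def)
    then have "finite K" "A ` K \<subseteq> msets" "disjoint_family_on A K"
      using I finite_subset disjoint_family_on_mono by blast+
    then show "norm (\<Sum>i\<in>K. E (A i)) \<le> E_bound"
      using E_UN[of K A] norm_E_le[of "\<Union>i\<in>K. A i"] by (metis sets.finite_UN image_subset_iff)
  qed (use I c r in \<open>auto simp: J_def\<close>)
  finally show ?thesis .
qed

lemma borel_partition_msets: "borel_partition S P \<Longrightarrow> B \<in> P \<Longrightarrow> B \<in> msets"
  by (auto simp: borel_partition_def msets_iff partition_on_def)

lemma borel_partition_disjoint:
  "borel_partition S P \<Longrightarrow> disjoint_family_on (\<lambda>B. B \<inter> L) P"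
  by (auto simp: borel_partition_def partition_on_def disjoint_def disjoint_family_on_def)

lemma sum_E_partition:
  assumes P: "borel_partition S P" and L: "L \<in> msets"
  shows "(\<Sum>B\<in>P. E (B \<inter> L)) = E L"
proof -
  have "(\<Union>B\<in>P. B \<inter> L) = L" using P L by (auto simp: borel_partition_def partition_on_def msets_iff)
  moreover have "finite P" using P by (simp add: borel_partition_def)
  ultimately show ?thesis
    using E_UN[of P "\<lambda>B. B \<inter> L"] borel_partition_msets[OF P] borel_partition_disjoint[OF P] L
    by (simp add: image_subset_iff sets.Int)
qed

section \<open>Norm convergence of the Riemann sums of z dE(z)\<close>

definition op_sum :: "complex set set \<times> (complex set \<Rightarrow> complex) \<Rightarrow> 'a operator" where
  "op_sum = (\<lambda>(P, \<tau>). \<Sum>B\<in>P. scalar_op (\<tau> B) o\<^sub>L E B)"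

lemma op_sum_refine:
  assumes P: "borel_partition S P" and Q: "borel_partition S Q"
  shows "op_sum (P, \<tau>) = (\<Sum>(B, C)\<in>P \<times> Q. scalar_op (\<tau> B) o\<^sub>L E (B \<inter> C))"
proof -
  have "E B = (\<Sum>C\<in>Q. E (B \<inter> C))" if "B \<in> P" for B
    using sum_E_partition[OF Q borel_partition_msets[OF P that]] by (simp add: Int_commute)
  then show ?thesis
    by (simp add: op_sum_def sum.cartesian_product[symmetric] op_comp.sum_right[symmetric])
qed

text \<open>Both sums are written over the intersections of cells. A point in such an intersection
  is within \<open>d\<close> of one tag and within \<open>e\<close> of the other.\<close>

lemma op_sum_dist:
  assumes P: "borel_partition S P" "fine_partition d P" "\<forall>B\<in>P. \<tau> B \<in> B"
    and Q: "borel_partition S Q" "fine_partition e Q" "\<forall>B\<in>Q. \<rho> B \<in> B"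
    and de: "d > 0" "e > 0"
  shows "dist (op_sum (P, \<tau>)) (op_sum (Q, \<rho>)) \<le> 6 * (d + e) * E_bound"
proof -
  have "op_sum (Q, \<rho>) = (\<Sum>(C, B)\<in>Q \<times> P. scalar_op (\<rho> C) o\<^sub>L E (C \<inter> B))"
    by (rule op_sum_refine[OF Q(1) P(1)])
  also have "\<dots> = (\<Sum>(B, C)\<in>P \<times> Q. scalar_op (\<rho> C) o\<^sub>L E (B \<inter> C))"
    unfolding sum.cartesian_product[symmetric] by (subst sum.swap) (simp add: Int_commute)
  finally have "op_sum (P, \<tau>) - op_sum (Q, \<rho>) =
      (\<Sum>i\<in>P \<times> Q. scalar_op (\<tau> (fst i) - \<rho> (snd i)) o\<^sub>L E (fst i \<inter> snd i))"
    by (simp add: op_sum_refine[OF P(1) Q(1)] sum_subtractf scalar_op_diff op_comp.diff_left split_beta)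
  also have "norm \<dots> \<le> 6 * (d + e) * E_bound"
  proof (rule norm_simple_le)
    show "finite (P \<times> Q)" using P Q by (simp add: borel_partition_def)
    show "(\<lambda>i. fst i \<inter> snd i) ` (P \<times> Q) \<subseteq> msets"
      using borel_partition_msets P(1) Q(1) by auto
    show "disjoint_family_on (\<lambda>i. fst i \<inter> snd i) (P \<times> Q)"
      unfolding disjoint_family_on_def
    proof (intro ballI impI)
      fix i j assume ij: "i \<in> P \<times> Q" "j \<in> P \<times> Q" "i \<noteq> j"
      then consider "fst i \<noteq> fst j" | "snd i \<noteq> snd j" by (auto simp: prod_eq_iff)
      then show "(fst i \<inter> snd i) \<inter> (fst j \<inter> snd j) = {}"
      proof cases
        case 1
        then have "fst i \<inter> fst j = {}"
          using disjoint_family_onD[OF borel_partition_disjoint[OF P(1), of UNIV], of "fst i" "fst j"] ij by auto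
        then show ?thesis by blast
      next
        case 2
        then have "snd i \<inter> snd j = {}"
          using disjoint_family_onD[OF borel_partition_disjoint[OF Q(1), of UNIV], of "snd i" "snd j"] ij by auto
        then show ?thesis by blast
      qed
    qed
    fix i assume i: "i \<in> P \<times> Q" "fst i \<inter> snd i \<noteq> {}"
    then obtain x where "x \<in> fst i" "x \<in> snd i" by blast
    then have "cmod (\<tau> (fst i) - x) \<le> d" "cmod (x - \<rho> (snd i)) \<le> e"
      using i P Q by (auto simp: fine_partition_def)
    then show "cmod (\<tau> (fst i) - \<rho> (snd i)) \<le> d + e"
      using norm_triangle_ineq[of "\<tau> (fst i) - x" "x - \<rho> (snd i)"] by simp
  qed (use de in simp)
  finally show ?thesis by (simp add: dist_norm)
qed

text \<open>The limit is in the operator norm, not only strong. Completeness supplies it along a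
  sequence of partitions of fineness \<open>inverse (Suc n)\<close>, and \<open>op_sum_dist\<close>
  carries it over to all fine partitions.\<close>

lemma op_sum_convergent:
  assumes "bounded S"
  shows "\<exists>D. (op_sum \<longlongrightarrow> D) (tagged_refinements S)"
proof -
  define good where "good = (\<lambda>d p. borel_partition S (fst p) \<and> (\<forall>B\<in>fst p. snd p B \<in> B) \<and> fine_partition d (fst p))"
  have ev: "eventually (good d) (tagged_refinements S)" if "d > 0" for d
    using eventually_tagged_refinements[OF S_borel assms S_borel that]
    by (rule eventually_mono) (auto simp: good_def)
  have "\<exists>p. good d p" if "d > 0" for d
    using eventually_happens'[OF tagged_refinements_neq_bot ev[OF that]] .
  then have "\<exists>p. good (inverse (Suc n)) p" for n by simp
  then obtain p where p: "\<And>n. good (inverse (Suc n)) (p n)" by metis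
  have dist: "dist (op_sum x) (op_sum y) \<le> 6 * (d + e) * E_bound" if "good d x" "good e y" "d > 0" "e > 0" for x y d e
    using op_sum_dist[of "fst x" d "snd x" "fst y" e "snd y"] that by (auto simp: good_def)
  have lim0: "(\<lambda>n. 12 * inverse (real (Suc n)) * E_bound) \<longlonglongrightarrow> 0"
    by (rule tendsto_mult_left_zero, rule tendsto_mult_right_zero, rule LIMSEQ_inverse_real_of_nat)
  have "Cauchy (\<lambda>n. op_sum (p n))"
  proof (rule metric_CauchyI)
    fix e :: real assume "e > 0"
    then obtain M where M: "12 * inverse (real (Suc M)) * E_bound < e"
      using order_tendstoD(2)[OF lim0] by (metis (no_types, lifting) eventually_happens trivial_limit_sequentially)
    have "dist (op_sum (p a)) (op_sum (p b)) < e" if "M \<le> a" "M \<le> b" for a b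
    proof -
      have "dist (op_sum (p a)) (op_sum (p b)) \<le> 6 * (inverse (Suc a) + inverse (Suc b)) * E_bound"
        by (rule dist[OF p p]) auto
      also have "\<dots> \<le> 6 * (inverse (Suc M) + inverse (Suc M)) * E_bound"
        using that E_bound_nonneg by (intro mult_right_mono mult_left_mono add_mono le_imp_inverse_le) auto
      finally show ?thesis using M by simp
    qed
    then show "\<exists>M. \<forall>m\<ge>M. \<forall>n\<ge>M. dist (op_sum (p m)) (op_sum (p n)) < e" by blast
  qed
  then obtain D where D: "(\<lambda>n. op_sum (p n)) \<longlonglongrightarrow> D" using Cauchy_convergent convergent_def by blast
  have close: "dist (op_sum x) D \<le> 6 * d * E_bound" if x: "good d x" "d > 0" for x d
  proof (rule LIMSEQ_le)
    show "(\<lambda>n. dist (op_sum x) (op_sum (p n))) \<longlonglongrightarrow> dist (op_sum x) D" by (intro tendsto_intros D)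
    show "(\<lambda>n. 6 * (d + inverse (real (Suc n))) * E_bound) \<longlonglongrightarrow> 6 * d * E_bound"
      by (rule tendsto_eq_intros LIMSEQ_inverse_real_of_nat refl | simp)+
    show "\<exists>N. \<forall>n\<ge>N. dist (op_sum x) (op_sum (p n)) \<le> 6 * (d + inverse (real (Suc n))) * E_bound"
      using dist[OF x(1) p x(2)] by auto
  qed
  have "(op_sum \<longlongrightarrow> D) (tagged_refinements S)"
  proof (rule tendstoI)
    fix e :: real assume e: "e > 0"
    \<comment> \<open>The added 6 keeps the denominator positive when \<open>E_bound = 0\<close> and
      makes \<open>6 * d * E_bound\<close> strictly smaller than \<open>e\<close>.\<close>
    define d where "d = e / (6 * E_bound + 6)"
    have d: "d > 0" using e E_bound_nonneg by (simp add: d_def)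
    have "6 * d * E_bound < e" using e E_bound_nonneg by (simp add: d_def field_simps)
    then show "eventually (\<lambda>x. dist (op_sum x) D < e) (tagged_refinements S)"
      using ev[OF d] close d by (auto elim!: eventually_mono intro: le_less_trans)
  qed
  then show ?thesis by blast
qed

text \<open>Projections of distinct cells annihilate each other, so on the range of
  \<open>E B\<close> the whole Riemann sum acts as multiplication by the tag of
  \<open>B\<close>.\<close>

lemma op_sum_comp_E:
  assumes "borel_partition S P" "B \<in> P"
  shows "op_sum (P, \<tau>) o\<^sub>L E B = scalar_op (\<tau> B) o\<^sub>L E B"
proof -
  have "op_sum (P, \<tau>) o\<^sub>L E B = (\<Sum>C\<in>P. if C = B then scalar_op (\<tau> B) o\<^sub>L E B else 0)"
    unfolding op_sum_def case_prod_conv op_comp.sum_left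
  proof (rule sum.cong[OF refl])
    fix C assume C: "C \<in> P"
    have "C \<inter> B = (if C = B then B else {})"
      using borel_partition_disjoint[OF assms(1), of UNIV] C assms(2) by (auto simp: disjoint_family_on_def)
    then show "(scalar_op (\<tau> C) o\<^sub>L E C) o\<^sub>L E B = (if C = B then scalar_op (\<tau> B) o\<^sub>L E B else 0)"
      using E_comp[of C B] borel_partition_msets[OF assms(1)] C assms(2)
      by (auto simp: op_comp_assoc op_comp.zero_right)
  qed
  also have "\<dots> = scalar_op (\<tau> B) o\<^sub>L E B"
    using assms by (simp add: borel_partition_def)
  finally show ?thesis .
qed

lemma op_sum_E_commute:
  assumes "borel_partition S P" "C \<in> msets"
  shows "op_sum (P, \<tau>) o\<^sub>L E C = E C o\<^sub>L op_sum (P, \<tau>)"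
  unfolding op_sum_def case_prod_conv op_comp.sum_left op_comp.sum_right
proof (rule sum.cong[OF refl])
  fix B assume "B \<in> P"
  then have B: "B \<in> msets" by (rule borel_partition_msets[OF assms(1)])
  have "(scalar_op (\<tau> B) o\<^sub>L E B) o\<^sub>L E C = scalar_op (\<tau> B) o\<^sub>L (E C o\<^sub>L E B)"
    using B assms(2) by (simp add: op_comp_assoc E_comp Int_commute)
  also have "\<dots> = E C o\<^sub>L (scalar_op (\<tau> B) o\<^sub>L E B)"
    using complex_linear_scalar_commute[OF complex_linear_E[OF assms(2)]]
    by (simp add: op_comp_assoc[symmetric])
  finally show "(scalar_op (\<tau> B) o\<^sub>L E B) o\<^sub>L E C = E C o\<^sub>L (scalar_op (\<tau> B) o\<^sub>L E B)" .
qed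

end

section \<open>Riemann sums of the resolvent\<close>

locale spectral_op =
  fixes X :: "('a :: complex_hilbert_space) operator"
    and E :: "complex set \<Rightarrow> 'a operator" and m :: "complex \<Rightarrow> nat"
  assumes complex_linear_X: "complex_linear X"
    and decomposition: "spectral_decomposition X E m"
    and bounded_spectrum: "bounded (spectrum X)"
begin

sublocale spectral_resolution "spectrum X" E
  using decomposition by unfold_locales (simp add: spectral_decomposition_def Let_def)

definition scalar_part :: "'a operator" where
  "scalar_part = op_integral E (spectrum X) scalar_op"

text \<open>Together with \<open>scalar_part\<close> this is Dunford's decomposition of a spectral
  operator. Written as a difference, it is visibly the norm limit of
  \<open>X - op_sum p\<close>.\<close>

definition nil_part :: "'a operator" where
  "nil_part = X - scalar_part"

definition level :: "nat \<Rightarrow> complex set" where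
  "level k = {z \<in> spectrum X. m z = k}"

lemma op_sum_tendsto: "(op_sum \<longlongrightarrow> scalar_part) (tagged_refinements (spectrum X))"
proof -
  obtain D where D: "(op_sum \<longlongrightarrow> D) (tagged_refinements (spectrum X))"
    using op_sum_convergent[OF bounded_spectrum] by blast
  have "has_op_integral E (spectrum X) scalar_op D"
    unfolding has_op_integral_def
  proof
    fix x
    have "((\<lambda>p. blinfun_apply (op_sum p) x) \<longlongrightarrow> blinfun_apply D x) (tagged_refinements (spectrum X))"
      by (intro tendsto_intros D)
    then show "((\<lambda>(P, \<tau>). \<Sum>B\<in>P. blinfun_apply (scalar_op (\<tau> B) o\<^sub>L E B) x) \<longlongrightarrow> blinfun_apply D x)
        (tagged_refinements (spectrum X))"
      by (simp add: op_sum_def case_prod_unfold blinfun.sum_left)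
  qed
  then show ?thesis using D by (simp add: scalar_part_def op_integral_eqI)
qed

lemma eventually_good:
  assumes "L \<in> msets"
  shows "eventually (\<lambda>(P, \<tau>). borel_partition (spectrum X) P \<and> (\<forall>B\<in>P. \<tau> B \<in> B) \<and>
           (\<forall>B\<in>P. B \<subseteq> L \<or> B \<inter> L = {})) (tagged_refinements (spectrum X))"
  using eventually_tagged_refinements[OF S_borel bounded_spectrum, of L 1] assms
  by (auto simp: msets_iff elim!: eventually_mono)

lemma op_integral_X: "op_integral E (spectrum X) (\<lambda>z. X - scalar_op z) = nil_part"
  using decomposition by (simp add: spectral_decomposition_def Let_def nil_part_def scalar_part_def algebra_simps)

lemma nil_part_comp:
  assumes "C \<in> msets"
  shows "E C o\<^sub>L nil_part = op_integral E C (\<lambda>z. X - scalar_op z)"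
    and "nil_part o\<^sub>L E C = op_integral E C (\<lambda>z. X - scalar_op z)"
proof -
  have "spectrum X \<inter> C = C" using assms by (auto simp: msets_iff)
  moreover have "E C o\<^sub>L nil_part = op_integral E (spectrum X \<inter> C) (\<lambda>z. X - scalar_op z)"
    "nil_part o\<^sub>L E C = op_integral E (spectrum X \<inter> C) (\<lambda>z. X - scalar_op z)"
    using decomposition assms S_borel
    unfolding spectral_decomposition_def Let_def op_integral_X[symmetric] by (auto simp: msets_iff)
  ultimately show "E C o\<^sub>L nil_part = op_integral E C (\<lambda>z. X - scalar_op z)"
    "nil_part o\<^sub>L E C = op_integral E C (\<lambda>z. X - scalar_op z)" by simp_all
qed

text \<open>The two parts of \<open>X\<close> commute with \<open>E C\<close> for different reasons:
  \<open>scalar_part\<close> as a limit of Riemann sums that do, \<open>nil_part\<close> by the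
  product rules of the decomposition.\<close>

lemma X_E_commute:
  assumes C: "C \<in> msets"
  shows "X o\<^sub>L E C = E C o\<^sub>L X"
proof -
  have "((\<lambda>p. op_sum p o\<^sub>L E C) \<longlongrightarrow> scalar_part o\<^sub>L E C) (tagged_refinements (spectrum X))"
    by (intro op_comp.tendsto tendsto_const op_sum_tendsto)
  moreover have "eventually (\<lambda>p. op_sum p o\<^sub>L E C = E C o\<^sub>L op_sum p) (tagged_refinements (spectrum X))"
    using eventually_good[OF C] by (rule eventually_mono) (auto simp: op_sum_E_commute[OF _ C])
  ultimately have "((\<lambda>p. E C o\<^sub>L op_sum p) \<longlongrightarrow> scalar_part o\<^sub>L E C) (tagged_refinements (spectrum X))"
    by (simp add: filterlim_cong)
  moreover have "((\<lambda>p. E C o\<^sub>L op_sum p) \<longlongrightarrow> E C o\<^sub>L scalar_part) (tagged_refinements (spectrum X))"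
    by (intro op_comp.tendsto tendsto_const op_sum_tendsto)
  ultimately have "scalar_part o\<^sub>L E C = E C o\<^sub>L scalar_part"
    using tendsto_unique[OF tagged_refinements_neq_bot] by blast
  moreover have "nil_part o\<^sub>L E C = E C o\<^sub>L nil_part" using nil_part_comp[OF C] by simp
  ultimately show ?thesis
    by (simp add: nil_part_def op_comp.diff_left op_comp.diff_right)
qed

lemma level_msets [simp]: "level k \<in> msets"
proof -
  have "m \<in> restrict_space borel (spectrum X) \<rightarrow>\<^sub>M count_space UNIV"
    using decomposition by (simp add: spectral_decomposition_def Let_def)
  from measurable_sets[OF this, of "{k}"]
  have "m -` {k} \<inter> space (restrict_space borel (spectrum X)) \<in> msets" by simp
  moreover have "m -` {k} \<inter> space (restrict_space borel (spectrum X)) = level k"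
    by (auto simp: level_def space_restrict_space)
  ultimately show ?thesis by simp
qed

lemma level_0 [simp]: "level 0 = {}"
  using decomposition by (auto simp: level_def spectral_decomposition_def Let_def)

lemma level_sums: "(\<lambda>k. blinfun_apply (E (level k)) x) sums x"
proof -
  have "(\<lambda>k. blinfun_apply (E (level k)) x) sums blinfun_apply (E (\<Union>k. level k)) x"
  proof (rule E_sums)
    show "disjoint_family level" by (auto simp: disjoint_family_on_def level_def)
  qed auto
  moreover have "(\<Union>k. level k) = spectrum X" by (auto simp: level_def)
  ultimately show ?thesis by (simp add: E_S)
qed

text \<open>This copes with an unbounded order function: by countable additivity every
  \<open>x\<close> is the sum of its components \<open>E (level k) x\<close>, and bounded operators
  respect this sum. The case \<open>k = 0\<close> is void, as \<open>level 0\<close> is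
  empty.\<close>

lemma eqI_levels:
  assumes "\<And>k. k \<ge> 1 \<Longrightarrow> A o\<^sub>L E (level k) = B o\<^sub>L E (level k)"
  shows "A = B"
proof (rule blinfun_eqI)
  fix x
  have eq: "A o\<^sub>L E (level k) = B o\<^sub>L E (level k)" for k
    using assms[of k] by (cases k) (auto simp: op_comp.zero_right)
  have "blinfun_apply A (blinfun_apply (E (level k)) x) = blinfun_apply B (blinfun_apply (E (level k)) x)" for k
    using arg_cong[OF eq[of k], of "\<lambda>T. blinfun_apply T x"] by simp
  then show "blinfun_apply A x = blinfun_apply B x"
    using bounded_linear.sums[OF blinfun.bounded_linear_right[of A] level_sums[of x]]
      bounded_linear.sums[OF blinfun.bounded_linear_right[of B] level_sums[of x]]
    by (simp add: sums_unique2)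
qed

lemma eqI_levels_left:
  assumes "\<And>k. k \<ge> 1 \<Longrightarrow> E (level k) o\<^sub>L A = E (level k) o\<^sub>L B"
  shows "A = B"
proof (rule blinfun_eqI)
  fix x
  have eq: "E (level k) o\<^sub>L A = E (level k) o\<^sub>L B" for k
    using assms[of k] by (cases k) (auto simp: op_comp.zero_left)
  have "blinfun_apply (E (level k)) (blinfun_apply A x) = blinfun_apply (E (level k)) (blinfun_apply B x)" for k
    using arg_cong[OF eq[of k], of "\<lambda>T. blinfun_apply T x"] by simp
  then show "blinfun_apply A x = blinfun_apply B x"
    using level_sums[of "blinfun_apply A x"] level_sums[of "blinfun_apply B x"]
    by (simp add: sums_unique2)
qed

text \<open>The decomposition gives nilpotency of the integral over \<open>level k\<close>, which is
  \<open>nil_part\<close> times \<open>E (level k)\<close>. The factors commute and the projection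
  is idempotent, so the power falls on \<open>nil_part\<close> alone.\<close>

lemma nil_part_power:
  assumes k: "k \<ge> 1"
  shows "op_power nil_part k o\<^sub>L E (level k) = 0"
proof -
  have "op_power (op_integral E (level k) (\<lambda>z. X - scalar_op z)) k = 0"
    using decomposition k level_msets[of k] unfolding spectral_decomposition_def Let_def msets_iff
    by (auto simp: level_def)
  then have "op_power (nil_part o\<^sub>L E (level k)) k = 0" by (simp add: nil_part_comp)
  moreover have "nil_part o\<^sub>L E (level k) = E (level k) o\<^sub>L nil_part" by (simp add: nil_part_comp)
  ultimately have "op_power nil_part k o\<^sub>L op_power (E (level k)) k = 0"
    using op_power_comp[of nil_part "E (level k)" k] by (simp only:)
  then show ?thesis
    using k by (simp add: op_power_idem E_comp)
qed

text \<open>This gathers the powers with cell-dependent tags into a power of one operator. For a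
  single factor it is \<open>op_sum_comp_E\<close>; \<open>E B\<close> commutes with
  \<open>X - scalar_op (\<tau> B)\<close>, so it can be brought next to each further factor.\<close>

lemma op_power_op_sum_comp_E:
  assumes P: "borel_partition (spectrum X) P" and B: "B \<in> P"
  shows "op_power (X - op_sum (P, \<tau>)) k o\<^sub>L E B = op_power (X - scalar_op (\<tau> B)) k o\<^sub>L E B"
proof (induction k)
  case (Suc k)
  have Bm: "B \<in> msets" by (rule borel_partition_msets[OF P B])
  have 1: "(X - op_sum (P, \<tau>)) o\<^sub>L E B = (X - scalar_op (\<tau> B)) o\<^sub>L E B"
    using op_sum_comp_E[OF P B] by (simp add: op_comp.diff_left)
  have "(X - scalar_op (\<tau> B)) o\<^sub>L E B = E B o\<^sub>L (X - scalar_op (\<tau> B))"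
    using X_E_commute[OF Bm] complex_linear_scalar_commute[OF complex_linear_E[OF Bm]]
    by (simp add: op_comp.diff_left op_comp.diff_right)
  note 2 = op_power_commute[OF this]
  have "op_power (X - op_sum (P, \<tau>)) (Suc k) o\<^sub>L E B
      = (X - op_sum (P, \<tau>)) o\<^sub>L (op_power (X - scalar_op (\<tau> B)) k o\<^sub>L E B)"
    by (simp add: op_power_Suc op_comp_assoc Suc)
  also have "\<dots> = ((X - op_sum (P, \<tau>)) o\<^sub>L E B) o\<^sub>L op_power (X - scalar_op (\<tau> B)) k"
    by (simp add: 2 op_comp_assoc)
  also have "\<dots> = (X - scalar_op (\<tau> B)) o\<^sub>L (E B o\<^sub>L op_power (X - scalar_op (\<tau> B)) k)"
    by (simp only: 1 op_comp_assoc)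
  also have "\<dots> = op_power (X - scalar_op (\<tau> B)) (Suc k) o\<^sub>L E B"
    by (simp add: 2[symmetric] op_power_Suc op_comp_assoc)
  finally show ?case .
qed simp

text \<open>By the previous lemma the sum factors as \<open>V\<^sup>k E(level k)\<close>, with \<open>V\<close> the Riemann sum of
  \<open>X - zI\<close>, times a scalar Riemann sum that is bounded uniformly in \<open>\<zeta>\<close>.\<close>

lemma remainder_uniform_limit:
  assumes k: "k \<ge> 1" and r: "r > 0" and \<Gamma>: "\<And>\<zeta> z. \<zeta> \<in> \<Gamma> \<Longrightarrow> z \<in> spectrum X \<Longrightarrow> r \<le> cmod (\<zeta> - z)"
  shows "uniform_limit \<Gamma>
    (\<lambda>(P, \<tau>) \<zeta>. \<Sum>B\<in>P. scalar_op (1 / (\<zeta> - \<tau> B) ^ k) o\<^sub>L op_power (X - scalar_op (\<tau> B)) k o\<^sub>L E (B \<inter> level k))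
    (\<lambda>_. 0) (tagged_refinements (spectrum X))"
proof (rule uniform_limitI)
  fix e :: real assume e: "e > 0"
  let ?L = "level k"
  let ?V = "\<lambda>p. op_power (X - op_sum p) k o\<^sub>L E ?L"
  \<comment> \<open>A bound, uniform in \<open>\<zeta>\<close>, for the scalar Riemann sums with
    coefficients of modulus at most \<open>1 / r ^ k\<close>; the 6 is that of
    \<open>norm_simple_le\<close>.\<close>
  define c where "c = 6 * (1 / r ^ k) * E_bound"
  have c: "c \<ge> 0" using r E_bound_nonneg by (simp add: c_def)
  have "(?V \<longlongrightarrow> op_power nil_part k o\<^sub>L E ?L) (tagged_refinements (spectrum X))"
    unfolding nil_part_def
    by (intro op_comp.tendsto tendsto_op_power tendsto_diff tendsto_const op_sum_tendsto)
  then have "((\<lambda>p. norm (?V p) * c) \<longlongrightarrow> 0) (tagged_refinements (spectrum X))"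
    unfolding nil_part_power[OF k] by (intro tendsto_mult_left_zero tendsto_norm_zero)
  then have "eventually (\<lambda>p. norm (?V p) * c < e) (tagged_refinements (spectrum X))"
    using e by (rule order_tendstoD)
  with eventually_good[OF S_msets]
  show "eventually (\<lambda>p. \<forall>\<zeta>\<in>\<Gamma>. dist ((case p of (P, \<tau>) \<Rightarrow> \<lambda>\<zeta>. \<Sum>B\<in>P. scalar_op (1 / (\<zeta> - \<tau> B) ^ k) o\<^sub>L
      op_power (X - scalar_op (\<tau> B)) k o\<^sub>L E (B \<inter> level k)) \<zeta>) 0 < e) (tagged_refinements (spectrum X))"
  proof eventually_elim
    case (elim p)
    obtain P \<tau> where p: "p = (P, \<tau>)" by fastforce
    have P: "borel_partition (spectrum X) P" and \<tau>: "\<And>B. B \<in> P \<Longrightarrow> \<tau> B \<in> B" using elim(1) by (auto simp: p)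
    have fin: "finite P" using P by (simp add: borel_partition_def)
    have Bm: "B \<in> msets" if "B \<in> P" for B using borel_partition_msets[OF P that] .
    show ?case
    proof
      fix \<zeta> assume \<zeta>: "\<zeta> \<in> \<Gamma>"
      have "(\<Sum>B\<in>P. scalar_op (1 / (\<zeta> - \<tau> B) ^ k) o\<^sub>L op_power (X - scalar_op (\<tau> B)) k o\<^sub>L E (B \<inter> ?L))
         = ?V p o\<^sub>L (\<Sum>B\<in>P. scalar_op (1 / (\<zeta> - \<tau> B) ^ k) o\<^sub>L E B)"
        unfolding op_comp.sum_right
      proof (rule sum.cong[OF refl])
        fix B assume B: "B \<in> P"
        let ?c = "scalar_op (1 / (\<zeta> - \<tau> B) ^ k) :: 'a operator"
        have clp: "complex_linear (op_power (X - scalar_op (\<tau> B)) k)"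
          using complex_linear_X by (intro complex_linear_op_power complex_linear_diff) auto
        have "?V p o\<^sub>L (?c o\<^sub>L E B) = op_power (X - op_sum p) k o\<^sub>L (?c o\<^sub>L (E ?L o\<^sub>L E B))"
          using complex_linear_scalar_commute[OF complex_linear_E[OF level_msets[of k]]]
          by (simp add: op_comp_assoc[symmetric]) (simp add: op_comp_assoc)
        also have "E ?L o\<^sub>L E B = E B o\<^sub>L E ?L"
          using Bm[OF B] by (simp add: E_comp Int_commute)
        also have "op_power (X - op_sum p) k o\<^sub>L (?c o\<^sub>L (E B o\<^sub>L E ?L))
            = (op_power (X - op_sum p) k o\<^sub>L E B) o\<^sub>L (?c o\<^sub>L E ?L)"
          using complex_linear_scalar_commute[OF complex_linear_E[OF Bm[OF B]], symmetric]
          by (simp add: op_comp_assoc[symmetric])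
        also have "\<dots> = op_power (X - scalar_op (\<tau> B)) k o\<^sub>L (E B o\<^sub>L ?c) o\<^sub>L E ?L"
          unfolding p op_power_op_sum_comp_E[OF P B] by (simp add: op_comp_assoc)
        also have "\<dots> = (op_power (X - scalar_op (\<tau> B)) k o\<^sub>L ?c) o\<^sub>L (E B o\<^sub>L E ?L)"
          unfolding complex_linear_scalar_commute[OF complex_linear_E[OF Bm[OF B]]] by (simp add: op_comp_assoc)
        also have "\<dots> = ?c o\<^sub>L op_power (X - scalar_op (\<tau> B)) k o\<^sub>L E (B \<inter> ?L)"
          unfolding complex_linear_scalar_commute[OF clp] using Bm[OF B] by (simp add: E_comp)
        finally show "?c o\<^sub>L op_power (X - scalar_op (\<tau> B)) k o\<^sub>L E (B \<inter> ?L) = ?V p o\<^sub>L (?c o\<^sub>L E B)" ..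
      qed
      moreover have le: "norm (\<Sum>B\<in>P. scalar_op (1 / (\<zeta> - \<tau> B) ^ k) o\<^sub>L E B) \<le> c"
        unfolding c_def
      proof (rule norm_simple_le[OF fin])
        show "disjoint_family_on (\<lambda>x. x) P" using borel_partition_disjoint[OF P, of UNIV] by simp
        fix B assume B: "B \<in> P"
        have "\<tau> B \<in> spectrum X" using \<tau>[OF B] Bm[OF B] by (auto simp: msets_iff)
        then have "r ^ k \<le> cmod (\<zeta> - \<tau> B) ^ k" using \<Gamma>[OF \<zeta>] r by (intro power_mono) auto
        then show "cmod (1 / (\<zeta> - \<tau> B) ^ k) \<le> 1 / r ^ k"
          using r by (simp add: norm_divide norm_power frac_le)
      qed (use Bm r in auto)
      ultimately have "norm (\<Sum>B\<in>P. scalar_op (1 / (\<zeta> - \<tau> B) ^ k) o\<^sub>L op_power (X - scalar_op (\<tau> B)) k o\<^sub>L E (B \<inter> ?L))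
         \<le> norm (?V p) * c"
        using order_trans[OF norm_op_comp_le mult_left_mono[OF le norm_ge_zero]] by simp
      then show "dist ((case p of (P, \<tau>) \<Rightarrow> \<lambda>\<zeta>. \<Sum>B\<in>P. scalar_op (1 / (\<zeta> - \<tau> B) ^ k) o\<^sub>L
          op_power (X - scalar_op (\<tau> B)) k o\<^sub>L E (B \<inter> level k)) \<zeta>) 0 < e"
        using elim(2) by (simp add: p)
    qed
  qed
qed

section \<open>Truncated geometric series for the resolvent\<close>

definition truncated_resolvent :: "nat \<Rightarrow> complex \<Rightarrow> complex \<Rightarrow> 'a operator" where
  "truncated_resolvent k \<zeta> z = (\<Sum>q<k. scalar_op (1 / (\<zeta> - z) ^ Suc q) o\<^sub>L op_power (X - scalar_op z) q)"

text \<open>A finite geometric sum with ratio (X - z I) / (\<zeta> - z): multiplication by \<zeta> I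
  - X = (\<zeta> - z) I - (X - z I) telescopes it to I minus the \<open>k\<close>-th power of the
  ratio.\<close>

lemma truncated_resolvent_eq:
  assumes \<zeta>: "\<zeta> \<notin> spectrum X" and ne: "\<zeta> \<noteq> z"
  shows "truncated_resolvent k \<zeta> z = resolvent X \<zeta> -
    (resolvent X \<zeta> o\<^sub>L scalar_op (1 / (\<zeta> - z) ^ k) o\<^sub>L op_power (X - scalar_op z) k)"
proof -
  let ?P = "\<lambda>q. scalar_op (1 / (\<zeta> - z) ^ q) o\<^sub>L op_power (X - scalar_op z) q"
  have cl: "complex_linear (X - scalar_op z)" using complex_linear_X by auto
  have telescope: "(scalar_op \<zeta> - X) o\<^sub>L (scalar_op (1 / (\<zeta> - z) ^ Suc q) o\<^sub>L op_power (X - scalar_op z) q) = ?P q - ?P (Suc q)" for q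
  proof -
    have split: "scalar_op \<zeta> - X = scalar_op (\<zeta> - z) - (X - scalar_op z)" by (simp add: scalar_op_diff)
    have "scalar_op (\<zeta> - z) o\<^sub>L (scalar_op (1 / (\<zeta> - z) ^ Suc q) o\<^sub>L op_power (X - scalar_op z) q) = ?P q"
      using ne by (simp add: op_comp_assoc[symmetric] scalar_op_mult[symmetric] del: power_Suc) simp
    moreover have "(X - scalar_op z) o\<^sub>L (scalar_op (1 / (\<zeta> - z) ^ Suc q) o\<^sub>L op_power (X - scalar_op z) q) = ?P (Suc q)"
      unfolding op_comp_assoc[symmetric] complex_linear_scalar_commute[OF cl]
      by (simp add: op_comp_assoc op_power_Suc)
    ultimately show ?thesis unfolding split by (simp only: op_comp.diff_left)
  qed
  have "(scalar_op \<zeta> - X) o\<^sub>L truncated_resolvent k \<zeta> z = (\<Sum>q<k. ?P q - ?P (Suc q))"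
    unfolding truncated_resolvent_def op_comp.sum_right telescope ..
  also have "\<dots> = id_blinfun - ?P k"
    by (subst sum_lessThan_telescope') simp
  finally have "resolvent X \<zeta> o\<^sub>L ((scalar_op \<zeta> - X) o\<^sub>L truncated_resolvent k \<zeta> z)
      = resolvent X \<zeta> o\<^sub>L (id_blinfun - ?P k)" by simp
  moreover have "resolvent X \<zeta> o\<^sub>L ((scalar_op \<zeta> - X) o\<^sub>L truncated_resolvent k \<zeta> z) = truncated_resolvent k \<zeta> z"
    using op_inverse_resolvent[OF \<zeta>] by (simp add: op_inverse_def op_comp_assoc[symmetric])
  ultimately show ?thesis by (simp add: op_comp.diff_right op_comp_assoc)
qed

text \<open>The order \<open>k\<close> is the same for all cells; intersection with
  \<open>level k\<close> removes the part of the spectrum where it differs from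
  \<open>m\<close>.\<close>

definition resolvent_sum :: "nat \<Rightarrow> complex set set \<times> (complex set \<Rightarrow> complex) \<Rightarrow> complex \<Rightarrow> 'a operator" where
  "resolvent_sum k = (\<lambda>(P, \<tau>) \<zeta>. \<Sum>B\<in>P. truncated_resolvent k \<zeta> (\<tau> B) o\<^sub>L E (B \<inter> level k))"

text \<open>Uniformity in \<open>\<zeta>\<close> is what lets the limit pass under the contour
  integral. The compact set \<Gamma> has positive distance from the closed spectrum, and the
  resolvent, which multiplies the vanishing remainder, is bounded on it.\<close>

lemma resolvent_sum_uniform_limit:
  assumes k: "k \<ge> 1" and \<Gamma>: "compact \<Gamma>" "\<Gamma> \<inter> spectrum X = {}"
  shows "uniform_limit \<Gamma> (resolvent_sum k) (\<lambda>\<zeta>. resolvent X \<zeta> o\<^sub>L E (level k)) (tagged_refinements (spectrum X))"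
proof -
  have "closed (spectrum X)" using complex_linear_X by (rule closed_spectrum)
  then obtain r where r: "r > 0" "\<And>\<zeta> z. \<zeta> \<in> \<Gamma> \<Longrightarrow> z \<in> spectrum X \<Longrightarrow> r \<le> cmod (\<zeta> - z)"
    using separate_compact_closed[OF \<Gamma>(1) _ \<Gamma>(2)] by (auto simp: dist_norm)
  let ?T = "\<lambda>(P, \<tau>) \<zeta>. \<Sum>B\<in>P. scalar_op (1 / (\<zeta> - \<tau> B) ^ k) o\<^sub>L op_power (X - scalar_op (\<tau> B)) k o\<^sub>L E (B \<inter> level k)"
  have T: "uniform_limit \<Gamma> ?T (\<lambda>_. 0) (tagged_refinements (spectrum X))"
    by (rule remainder_uniform_limit[OF k r])
  have "continuous_on \<Gamma> (resolvent X)"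
    using continuous_on_resolvent[OF complex_linear_X] 
    by (rule continuous_on_subset) (use \<Gamma>(2) in blast)
  then have bR: "bounded (resolvent X ` \<Gamma>)" using \<Gamma>(1) by (intro compact_imp_bounded compact_continuous_image)
  have "uniform_limit \<Gamma> (\<lambda>p \<zeta>. (resolvent X \<zeta> o\<^sub>L E (level k)) - (resolvent X \<zeta> o\<^sub>L ?T p \<zeta>))
     (\<lambda>\<zeta>. (resolvent X \<zeta> o\<^sub>L E (level k)) - (resolvent X \<zeta> o\<^sub>L 0)) (tagged_refinements (spectrum X))"
    by (intro uniform_limit_minus uniform_limit_const op_comp.bounded_uniform_limit T bR)
      (auto intro: finite_imp_bounded finite_subset[of _ "{0}"])
  then have *: "uniform_limit \<Gamma> (\<lambda>p \<zeta>. (resolvent X \<zeta> o\<^sub>L E (level k)) - (resolvent X \<zeta> o\<^sub>L ?T p \<zeta>))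
     (\<lambda>\<zeta>. resolvent X \<zeta> o\<^sub>L E (level k)) (tagged_refinements (spectrum X))"
    by (simp add: op_comp.zero_right)
  have "eventually (\<lambda>p. \<forall>\<zeta>\<in>\<Gamma>. (resolvent X \<zeta> o\<^sub>L E (level k)) - (resolvent X \<zeta> o\<^sub>L ?T p \<zeta>) = resolvent_sum k p \<zeta>)
      (tagged_refinements (spectrum X))"
    using eventually_good[OF S_msets]
  proof (rule eventually_mono)
    fix p assume p1: "case p of (P, \<tau>) \<Rightarrow> borel_partition (spectrum X) P \<and> (\<forall>B\<in>P. \<tau> B \<in> B) \<and>
           (\<forall>B\<in>P. B \<subseteq> spectrum X \<or> B \<inter> spectrum X = {})"
    obtain P \<tau> where p: "p = (P, \<tau>)" by fastforce
    have P: "borel_partition (spectrum X) P" and \<tau>: "\<And>B. B \<in> P \<Longrightarrow> \<tau> B \<in> spectrum X"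
      using p1 borel_partition_msets by (auto simp: p msets_iff)
    show "\<forall>\<zeta>\<in>\<Gamma>. (resolvent X \<zeta> o\<^sub>L E (level k)) - (resolvent X \<zeta> o\<^sub>L ?T p \<zeta>) = resolvent_sum k p \<zeta>"
    proof
      fix \<zeta> assume \<zeta>: "\<zeta> \<in> \<Gamma>"
      have \<zeta>': "\<zeta> \<notin> spectrum X" using \<zeta> \<Gamma>(2) by blast
      have "resolvent_sum k p \<zeta> = (\<Sum>B\<in>P. (resolvent X \<zeta> o\<^sub>L E (B \<inter> level k)) - (resolvent X \<zeta> o\<^sub>L
          (scalar_op (1 / (\<zeta> - \<tau> B) ^ k) o\<^sub>L op_power (X - scalar_op (\<tau> B)) k o\<^sub>L E (B \<inter> level k))))"
        unfolding resolvent_sum_def p case_prod_conv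
      proof (rule sum.cong[OF refl])
        fix B assume "B \<in> P"
        then have "\<zeta> \<noteq> \<tau> B" using \<tau> \<zeta>' by blast
        from truncated_resolvent_eq[OF \<zeta>' this]
        show "truncated_resolvent k \<zeta> (\<tau> B) o\<^sub>L E (B \<inter> level k) =
          (resolvent X \<zeta> o\<^sub>L E (B \<inter> level k)) - (resolvent X \<zeta> o\<^sub>L
          (scalar_op (1 / (\<zeta> - \<tau> B) ^ k) o\<^sub>L op_power (X - scalar_op (\<tau> B)) k o\<^sub>L E (B \<inter> level k)))"
          by (simp add: op_comp.diff_left op_comp_assoc)
      qed
      also have "\<dots> = (resolvent X \<zeta> o\<^sub>L E (level k)) - (resolvent X \<zeta> o\<^sub>L ?T p \<zeta>)"
        by (simp add: sum_subtractf op_comp.sum_right[symmetric] sum_E_partition[OF P] p)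
      finally show "(resolvent X \<zeta> o\<^sub>L E (level k)) - (resolvent X \<zeta> o\<^sub>L ?T p \<zeta>) = resolvent_sum k p \<zeta>" ..
    qed
  qed
  from uniform_limit_cong[OF this] * show ?thesis by blast
qed

end

section \<open>Contour integrals\<close>

text \<open>The data delivered by the grid, apart from their origin: \<open>f\<close> enters through
  its continuity on the segments and its Cauchy formula on \<open>W\<close>.\<close>

locale cauchy_representation =
  fixes I :: "'i set" and w a b :: "'i \<Rightarrow> complex" and f :: "complex \<Rightarrow> complex" and W :: "complex set"
  assumes finite_I: "finite I" and open_W: "open W"
    and continuous_f: "\<And>i. i \<in> I \<Longrightarrow> continuous_on (closed_segment (a i) (b i)) f"
    and segment_W: "\<And>i. i \<in> I \<Longrightarrow> closed_segment (a i) (b i) \<inter> W = {}"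
    and f_eq: "\<And>z. z \<in> W \<Longrightarrow>
      f z = (\<Sum>i\<in>I. w i * contour_integral (linepath (a i) (b i)) (\<lambda>u. f u / (u - z)))"
begin

definition path_set :: "complex set" where
  "path_set = (\<Union>i\<in>I. closed_segment (a i) (b i))"

definition cauchy :: "(complex \<Rightarrow> complex) \<Rightarrow> nat \<Rightarrow> complex \<Rightarrow> complex" where
  "cauchy g q z = (\<Sum>i\<in>I. w i * contour_integral (linepath (a i) (b i)) (\<lambda>u. g u / (u - z) ^ Suc q))"

text \<open>The density \<open>f\<close> and the velocity of the segment are absorbed here, so that
  the integrals below are functionals of the kernel alone.\<close>

definition weight :: "'i \<Rightarrow> real \<Rightarrow> complex" where
  "weight i u = w i * (b i - a i) * f (linepath (a i) (b i) u)"

definition scalar_integral :: "(complex \<Rightarrow> complex) \<Rightarrow> complex" where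
  "scalar_integral h = (\<Sum>i\<in>I. integral {0..1} (\<lambda>u. weight i u * h (linepath (a i) (b i) u)))"

text \<open>Integrating over the parameter in [0,1] admits operator-valued kernels, and bounded
  linear maps pass through the integral.\<close>

definition operator_integral :: "(complex \<Rightarrow> ('a :: complex_hilbert_space) operator) \<Rightarrow> 'a operator" where
  "operator_integral g =
     (\<Sum>i\<in>I. integral {0..1} (\<lambda>u. scalar_op (weight i u) o\<^sub>L g (linepath (a i) (b i) u)))"

lemma compact_path_set: "compact path_set"
  unfolding path_set_def using finite_I by (intro compact_UN) auto

lemma path_set_W: "path_set \<inter> W = {}"
  unfolding path_set_def using segment_W by blast

lemma segment_path_set: "i \<in> I \<Longrightarrow> closed_segment (a i) (b i) \<subseteq> path_set"
  by (auto simp: path_set_def)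

lemma continuous_compose_linepath:
  assumes "i \<in> I" "continuous_on path_set g"
  shows "continuous_on {0..1} (\<lambda>u. g (linepath (a i) (b i) u))"
proof (rule continuous_on_compose2[OF assms(2)])
  show "linepath (a i) (b i) ` {0..1} \<subseteq> path_set"
    using segment_path_set[OF assms(1)] by (simp flip: path_image_def)
qed (rule continuous_on_linepath)

lemma continuous_weight: "i \<in> I \<Longrightarrow> continuous_on {0..1} (weight i)"
  unfolding weight_def
proof (intro continuous_intros)
  assume i: "i \<in> I"
  show "continuous_on {0..1} (\<lambda>u. f (linepath (a i) (b i) u))"
  proof (rule continuous_on_compose2[OF continuous_f[OF i]])
    show "linepath (a i) (b i) ` {0..1} \<subseteq> closed_segment (a i) (b i)"
      by (simp flip: path_image_def)
  qed (rule continuous_on_linepath)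
qed

section \<open>Cauchy formulas for derivatives and divided differences\<close>

lemma cauchy_eq_scalar_integral:
  "cauchy (\<lambda>u. f u * h u) q z = scalar_integral (\<lambda>u. h u / (u - z) ^ Suc q)"
  unfolding cauchy_def scalar_integral_def
proof (rule sum.cong[OF refl])
  fix i
  have "contour_integral (linepath (a i) (b i)) (\<lambda>u. f u * h u / (u - z) ^ Suc q)
      = integral {0..1} (\<lambda>x. (\<lambda>u. f u * h u / (u - z) ^ Suc q) (linepath (a i) (b i) x) * (b i - a i))"
    unfolding contour_integral_integral
    by (rule integral_cong) (simp only: vector_derivative_linepath_at)
  then show "w i * contour_integral (linepath (a i) (b i)) (\<lambda>u. f u * h u / (u - z) ^ Suc q) =
     integral {0..1} (\<lambda>u. weight i u * (h (linepath (a i) (b i) u) / (linepath (a i) (b i) u - z) ^ Suc q))"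
    unfolding weight_def by (simp only: integral_mult_right[symmetric] times_divide_eq_right times_divide_eq_left mult_ac)
qed

lemma has_field_derivative_cauchy:
  assumes g: "\<And>i. i \<in> I \<Longrightarrow> continuous_on (closed_segment (a i) (b i)) g" and z: "z \<in> W"
  shows "(cauchy g q has_field_derivative of_nat (Suc q) * cauchy g (Suc q) z) (at z)"
proof -
  have "((\<lambda>z. \<Sum>i\<in>I. w i * contour_integral (linepath (a i) (b i)) (\<lambda>u. g u / (u - z) ^ Suc q)) has_field_derivative
     (\<Sum>i\<in>I. w i * (of_nat (Suc q) * contour_integral (linepath (a i) (b i)) (\<lambda>u. g u / (u - z) ^ Suc (Suc q))))) (at z)"
    using segment_W z
    by (intro DERIV_sum DERIV_cmult contour_integral_linepath_power_deriv g) blast+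
  moreover have "(\<Sum>i\<in>I. w i * (of_nat (Suc q) * contour_integral (linepath (a i) (b i)) (\<lambda>u. g u / (u - z) ^ Suc (Suc q))))
     = of_nat (Suc q) * cauchy g (Suc q) z"
    unfolding cauchy_def sum_distrib_left by (intro sum.cong) (auto simp: mult_ac)
  ultimately show ?thesis by (simp only: cauchy_def[abs_def])
qed

text \<open>\<open>F\<close> has to agree with the Cauchy integral on the open set \<open>W\<close>
  only, which determines its derivatives there. It stands for \<open>f\<close> and for the divided
  difference in either variable.\<close>

lemma higher_deriv_cauchy:
  assumes g: "\<And>i. i \<in> I \<Longrightarrow> continuous_on (closed_segment (a i) (b i)) g"
    and F: "\<And>z. z \<in> W \<Longrightarrow> F z = cauchy g 0 z" and z: "z \<in> W"
  shows "(deriv ^^ q) F z = fact q * cauchy g q z"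
  using z
proof (induction q arbitrary: z)
  case 0
  then show ?case using F by simp
next
  case (Suc q)
  have "eventually (\<lambda>y. y \<in> W) (nhds z)" using open_W Suc.prems by (rule eventually_nhds_in_open)
  then have "eventually (\<lambda>y. (deriv ^^ q) F y = fact q * cauchy g q y) (nhds z)"
    by (rule eventually_mono) (rule Suc.IH)
  then have "deriv ((deriv ^^ q) F) z = deriv (\<lambda>y. fact q * cauchy g q y) z"
    by (intro deriv_cong_ev) auto
  also have "\<dots> = fact q * (of_nat (Suc q) * cauchy g (Suc q) z)"
    by (intro DERIV_imp_deriv DERIV_cmult has_field_derivative_cauchy[OF g] Suc.prems)
  also have "\<dots> = fact (Suc q) * cauchy g (Suc q) z" by (simp add: mult_ac)
  finally show ?case by simp
qed

lemma f_eq_cauchy: "z \<in> W \<Longrightarrow> f z = cauchy f 0 z"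
  using f_eq[of z] by (simp add: cauchy_def)

lemma higher_deriv_f:
  assumes z: "z \<in> W"
  shows "(deriv ^^ q) f z / fact q = scalar_integral (\<lambda>u. 1 / (u - z) ^ Suc q)"
proof -
  have "(deriv ^^ q) f z = fact q * cauchy f q z"
    by (rule higher_deriv_cauchy[OF continuous_f f_eq_cauchy z])
  then show ?thesis using cauchy_eq_scalar_integral[of "\<lambda>_. 1" q z] by simp
qed

text \<open>Partial fractions: 1/(u - x) - 1/(u - y) = (x - y) / ((u - x) (u - y)). On the diagonal
  the kernel becomes 1/(u - x)^2, that of the derivative.\<close>

lemma divided_difference_eq:
  assumes x: "x \<in> W" and y: "y \<in> W"
  shows "divided_difference f x y = cauchy (\<lambda>u. f u / (u - x)) 0 y"
proof (cases "x = y")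
  case True
  have "deriv f x = cauchy f 1 x"
    using higher_deriv_cauchy[OF continuous_f f_eq_cauchy x, of 1] by simp
  then show ?thesis
    using True by (simp add: divided_difference_def cauchy_def power2_eq_square)
next
  case False
  have "f x - f y = (x - y) * cauchy (\<lambda>u. f u / (u - x)) 0 y"
    unfolding f_eq[OF x] f_eq[OF y] cauchy_def sum_distrib_left sum_subtractf[symmetric]
  proof (rule sum.cong[OF refl])
    fix i assume i: "i \<in> I"
    have ne: "u \<noteq> x" "u \<noteq> y" if "u \<in> closed_segment (a i) (b i)" for u
      using segment_W[OF i] x y that by auto
    have int: "(\<lambda>u. f u / (u - z)) contour_integrable_on linepath (a i) (b i)" if "z = x \<or> z = y" for z
      using ne that by (intro contour_integrable_continuous_linepath continuous_intros continuous_f i) auto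
    have "(x - y) * contour_integral (linepath (a i) (b i)) (\<lambda>u. f u / (u - x) / (u - y) ^ Suc 0)
       = contour_integral (linepath (a i) (b i)) (\<lambda>u. (x - y) * (f u / (u - x) / (u - y) ^ Suc 0))"
      using ne by (intro contour_integral_lmul[symmetric] contour_integrable_continuous_linepath
          continuous_intros continuous_f i) auto
    also have "\<dots> = contour_integral (linepath (a i) (b i)) (\<lambda>u. f u / (u - x) - f u / (u - y))"
      using ne by (intro contour_integral_cong) (auto simp: divide_simps algebra_simps)
    also have "\<dots> = contour_integral (linepath (a i) (b i)) (\<lambda>u. f u / (u - x))
       - contour_integral (linepath (a i) (b i)) (\<lambda>u. f u / (u - y))"
      using int by (intro contour_integral_diff) auto
    finally show "w i * contour_integral (linepath (a i) (b i)) (\<lambda>u. f u / (u - x)) -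
        w i * contour_integral (linepath (a i) (b i)) (\<lambda>u. f u / (u - y)) =
        (x - y) * (w i * contour_integral (linepath (a i) (b i)) (\<lambda>u. f u / (u - x) / (u - y) ^ Suc 0))"
      by (metis (no_types, lifting) mult.left_commute right_diff_distrib)
  qed
  then show ?thesis using False by (simp add: divided_difference_def)
qed

text \<open>The kernel is a product of a function of \<open>x\<close> and one of \<open>y\<close>,
  so the derivatives act on separate factors. This separation later turns the double sum into a
  product of two resolvent sums.\<close>

lemma partial_deriv_divided_difference:
  assumes x: "x \<in> W" and y: "y \<in> W"
  shows "partial_deriv p q (divided_difference f) x y / (fact p * fact q) =
    scalar_integral (\<lambda>u. 1 / (u - x) ^ Suc p * (1 / (u - y) ^ Suc q))"
proof -
  let ?g = "\<lambda>u. f u * (fact q / (u - y) ^ Suc q)"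
  have ne: "u \<noteq> z" if "u \<in> closed_segment (a i) (b i)" "i \<in> I" "z \<in> W" for u i z
    using segment_W that by blast
  \<comment> \<open>Stated for all \<open>x\<close> in \<open>W\<close>, because the outer
    derivative depends on the values near the given point.\<close>
  have inner: "(deriv ^^ q) (\<lambda>y. divided_difference f x y) y = cauchy ?g 0 x" if x: "x \<in> W" for x
  proof -
    have "(deriv ^^ q) (\<lambda>y. divided_difference f x y) y = fact q * cauchy (\<lambda>u. f u / (u - x)) q y"
    proof (rule higher_deriv_cauchy[OF _ _ y])
      show "continuous_on (closed_segment (a i) (b i)) (\<lambda>u. f u / (u - x))" if "i \<in> I" for i
        using ne[OF _ that x] by (intro continuous_intros continuous_f that) auto
    qed (rule divided_difference_eq[OF x])
    also have "\<dots> = cauchy ?g 0 x"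
      unfolding cauchy_def sum_distrib_left
    proof (rule sum.cong[OF refl])
      fix i assume i: "i \<in> I"
      have "fact q * contour_integral (linepath (a i) (b i)) (\<lambda>u. f u / (u - x) / (u - y) ^ Suc q)
         = contour_integral (linepath (a i) (b i)) (\<lambda>u. fact q * (f u / (u - x) / (u - y) ^ Suc q))"
        using ne[OF _ i x] ne[OF _ i y]
        by (intro contour_integral_lmul[symmetric] contour_integrable_continuous_linepath
          continuous_intros continuous_f i) auto
      then show "fact q * (w i * contour_integral (linepath (a i) (b i)) (\<lambda>u. f u / (u - x) / (u - y) ^ Suc q)) =
          w i * contour_integral (linepath (a i) (b i)) (\<lambda>u. ?g u / (u - x) ^ Suc 0)"
        by (simp add: mult_ac)
    qed
    finally show ?thesis .
  qed
  have "partial_deriv p q (divided_difference f) x y = fact p * cauchy ?g p x"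
    unfolding partial_deriv_def
  proof (rule higher_deriv_cauchy[OF _ inner x])
    show "continuous_on (closed_segment (a i) (b i)) ?g" if "i \<in> I" for i
      using ne[OF _ that y] by (intro continuous_intros continuous_f that) auto
  qed
  also have "cauchy ?g p x = scalar_integral (\<lambda>u. fact q / (u - y) ^ Suc q / (u - x) ^ Suc p)"
    by (rule cauchy_eq_scalar_integral)
  also have "\<dots> = fact q * scalar_integral (\<lambda>u. 1 / (u - x) ^ Suc p * (1 / (u - y) ^ Suc q))"
    unfolding scalar_integral_def sum_distrib_left integral_mult_right[symmetric]
    by (intro sum.cong integral_cong) (auto simp: mult_ac)
  finally show ?thesis by simp
qed

end

section \<open>Operator-valued contour integrals\<close>

context cauchy_representation
begin

lemma continuous_weighted:
  assumes "i \<in> I" "continuous_on path_set g"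
  shows "continuous_on {0..1} (\<lambda>u. scalar_op (weight i u) o\<^sub>L g (linepath (a i) (b i) u))"
  by (intro op_comp.continuous_on bounded_linear.continuous_on[OF bounded_linear_scalar_op]
      continuous_weight continuous_compose_linepath assms)

lemmas integrable_weighted = integrable_continuous_real[OF continuous_weighted]

lemma operator_integral_diff:
  assumes "continuous_on path_set g" "continuous_on path_set h"
  shows "operator_integral (\<lambda>\<zeta>. g \<zeta> - h \<zeta>) = operator_integral g - operator_integral h"
  unfolding operator_integral_def sum_subtractf[symmetric]
  using assms by (intro sum.cong refl) (simp add: op_comp.diff_right integral_diff integrable_weighted)

lemma operator_integral_sum:
  assumes "finite J" "\<And>j. j \<in> J \<Longrightarrow> continuous_on path_set (g j)"
  shows "operator_integral (\<lambda>\<zeta>. \<Sum>j\<in>J. g j \<zeta>) = (\<Sum>j\<in>J. operator_integral (g j))"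
  unfolding operator_integral_def
  using assms by (subst sum.swap) (intro sum.cong refl, simp add: op_comp.sum_right integral_sum integrable_weighted)

text \<open>The left factor must be complex linear, as the complex weights have to be moved past it;
  the right factor never meets them.\<close>

lemma operator_integral_comp:
  assumes A: "complex_linear A" and g: "continuous_on path_set g"
  shows "operator_integral (\<lambda>\<zeta>. A o\<^sub>L g \<zeta> o\<^sub>L B) = A o\<^sub>L operator_integral g o\<^sub>L B"
  unfolding operator_integral_def op_comp.sum_left op_comp.sum_right
proof (rule sum.cong[OF refl])
  fix i assume i: "i \<in> I"
  let ?G = "\<lambda>u. scalar_op (weight i u) o\<^sub>L g (linepath (a i) (b i) u)"
  have bl: "bounded_linear (\<lambda>T. A o\<^sub>L T o\<^sub>L B)"
    by (rule bounded_linear_compose[OF op_comp.bounded_linear_left op_comp.bounded_linear_right])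
  have "integral {0..1} ((\<lambda>T. A o\<^sub>L T o\<^sub>L B) \<circ> ?G) = A o\<^sub>L integral {0..1} ?G o\<^sub>L B"
    using integral_linear[OF integrable_weighted[OF i g] bl] .
  moreover have "(\<lambda>T. A o\<^sub>L T o\<^sub>L B) \<circ> ?G = (\<lambda>u. scalar_op (weight i u) o\<^sub>L (A o\<^sub>L g (linepath (a i) (b i) u) o\<^sub>L B))"
    by (simp add: fun_eq_iff op_comp_assoc[symmetric] complex_linear_scalar_commute[OF A])
  ultimately show "integral {0..1} (\<lambda>u. scalar_op (weight i u) o\<^sub>L (A o\<^sub>L g (linepath (a i) (b i) u) o\<^sub>L B)) =
      A o\<^sub>L integral {0..1} ?G o\<^sub>L B" by simp
qed

lemma operator_integral_comp_right:
  "continuous_on path_set g \<Longrightarrow> operator_integral (\<lambda>\<zeta>. g \<zeta> o\<^sub>L B) = operator_integral g o\<^sub>L B"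
  using operator_integral_comp[of id_blinfun g B] by simp

lemma operator_integral_scalar:
  assumes h: "continuous_on path_set h"
  shows "operator_integral (\<lambda>\<zeta>. scalar_op (h \<zeta>) o\<^sub>L A) = scalar_op (scalar_integral h) o\<^sub>L A"
  unfolding operator_integral_def scalar_integral_def scalar_op_sum op_comp.sum_left
proof (rule sum.cong[OF refl])
  fix i assume i: "i \<in> I"
  let ?H = "\<lambda>u. weight i u * h (linepath (a i) (b i) u)"
  have "?H integrable_on {0..1}"
    by (intro integrable_continuous_real continuous_on_mult continuous_weight continuous_compose_linepath i h)
  moreover have "bounded_linear (\<lambda>c. scalar_op c o\<^sub>L A)"
    by (rule bounded_linear_compose[OF op_comp.bounded_linear_left bounded_linear_scalar_op])
  ultimately have "integral {0..1} ((\<lambda>c. scalar_op c o\<^sub>L A) \<circ> ?H) = scalar_op (integral {0..1} ?H) o\<^sub>L A"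
    by (rule integral_linear)
  moreover have "(\<lambda>c. scalar_op c o\<^sub>L A) \<circ> ?H = (\<lambda>u. scalar_op (weight i u) o\<^sub>L (scalar_op (h (linepath (a i) (b i) u)) o\<^sub>L A))"
    by (simp add: fun_eq_iff op_comp_assoc scalar_op_mult)
  ultimately show "integral {0..1} (\<lambda>u. scalar_op (weight i u) o\<^sub>L (scalar_op (h (linepath (a i) (b i) u)) o\<^sub>L A)) =
    scalar_op (integral {0..1} ?H) o\<^sub>L A" by simp
qed

lemma operator_integral_bound:
  obtains C where "C > 0"
    "\<And>(g :: complex \<Rightarrow> ('a :: complex_hilbert_space) operator) e. continuous_on path_set g \<Longrightarrow>
       (\<And>\<zeta>. \<zeta> \<in> path_set \<Longrightarrow> norm (g \<zeta>) \<le> e) \<Longrightarrow> e \<ge> 0 \<Longrightarrow> norm (operator_integral g) \<le> C * e"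
proof -
  have "\<exists>M. \<forall>u\<in>{0..1}. cmod (weight i u) \<le> M" if "i \<in> I" for i
    using compact_imp_bounded[OF compact_continuous_image[OF continuous_weight[OF that] compact_Icc]]
    by (auto simp: bounded_iff)
  then obtain M where M: "\<And>i u. i \<in> I \<Longrightarrow> u \<in> {0..1} \<Longrightarrow> cmod (weight i u) \<le> M i" by metis
  have M0: "M i \<ge> 0" if "i \<in> I" for i
    using order_trans[OF norm_ge_zero M[OF that, of 0]] by simp
  \<comment> \<open>The added 1 keeps \<open>C\<close> positive even without segments;
    \<open>C\<close> serves as a divisor later.\<close>
  define C where "C = (\<Sum>i\<in>I. M i) + 1"
  have C: "C > 0" unfolding C_def using sum_nonneg[of I M] M0 by fastforce
  show thesis
  proof (rule that[OF C])
    fix g :: "complex \<Rightarrow> 'a operator" and e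
    assume g: "continuous_on path_set g" and e: "\<And>\<zeta>. \<zeta> \<in> path_set \<Longrightarrow> norm (g \<zeta>) \<le> e" "e \<ge> 0"
    have "norm (operator_integral g) \<le> (\<Sum>i\<in>I. M i * e)"
      unfolding operator_integral_def
    proof (rule sum_norm_le)
      fix i assume i: "i \<in> I"
      have "norm (scalar_op (weight i u) o\<^sub>L g (linepath (a i) (b i) u)) \<le> M i * e" if u: "u \<in> {0..1}" for u
      proof -
        have "linepath (a i) (b i) u \<in> path_set"
          using segment_path_set[OF i] linepath_in_path[OF u] by blast
        then show ?thesis
          using M[OF i u] e M0[OF i] norm_scalar_op_le[where ?'a='a, of "weight i u"]
          by (intro order_trans[OF norm_op_comp_le] mult_mono) auto
      qed
      then have "norm (integral {0..1} (\<lambda>u. scalar_op (weight i u) o\<^sub>L g (linepath (a i) (b i) u))) \<le> M i * e * (1 - 0)"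
        by (intro integral_bound continuous_weighted i g) auto
      then show "norm (integral {0..1} (\<lambda>u. scalar_op (weight i u) o\<^sub>L g (linepath (a i) (b i) u))) \<le> M i * e" by simp
    qed
    also have "\<dots> \<le> C * e" using e(2) by (simp add: C_def distrib_right flip: sum_distrib_right)
    finally show "norm (operator_integral g) \<le> C * e" .
  qed
qed

lemma tendsto_operator_integral:
  fixes g :: "'x \<Rightarrow> complex \<Rightarrow> ('a :: complex_hilbert_space) operator"
  assumes lim: "uniform_limit path_set g l F"
    and g: "eventually (\<lambda>x. continuous_on path_set (g x)) F" and l: "continuous_on path_set l"
  shows "((\<lambda>x. operator_integral (g x)) \<longlongrightarrow> operator_integral l) F"
proof (rule tendstoI)
  fix e :: real assume e: "e > 0"
  obtain C where C: "C > 0" "\<And>(g :: complex \<Rightarrow> 'a operator) e. continuous_on path_set g \<Longrightarrow>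
       (\<And>\<zeta>. \<zeta> \<in> path_set \<Longrightarrow> norm (g \<zeta>) \<le> e) \<Longrightarrow> e \<ge> 0 \<Longrightarrow> norm (operator_integral g) \<le> C * e"
    using operator_integral_bound[where ?'a='a] by blast
  define d where "d = e / (2 * C)"
  have d: "d > 0" using e C by (simp add: d_def)
  from uniform_limitD[OF lim d] g
  show "eventually (\<lambda>x. dist (operator_integral (g x)) (operator_integral l) < e) F"
  proof eventually_elim
    case (elim x)
    have "norm (operator_integral (\<lambda>\<zeta>. g x \<zeta> - l \<zeta>)) \<le> C * d"
      using elim l d by (intro C(2) continuous_on_diff) (auto simp: dist_norm less_imp_le)
    also have "C * d < e" using C(1) e by (simp add: d_def)
    finally show ?case using operator_integral_diff[OF elim(2) l] by (simp add: dist_norm)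
  qed
qed

end

section \<open>The functional calculus as a contour integral\<close>

locale spectral_op_calculus = spectral_op X E m + cauchy_representation I w a b f W
  for X :: "('a :: complex_hilbert_space) operator" and E m and I :: "'i set" and w a b f W +
  assumes spectrum_W: "spectrum X \<subseteq> W"
begin

lemma path_set_spectrum: "path_set \<inter> spectrum X = {}"
  using path_set_W spectrum_W by blast

lemma continuous_resolvent: "continuous_on path_set (resolvent X)"
  by (rule continuous_on_subset[OF continuous_on_resolvent[OF complex_linear_X]])
    (use path_set_spectrum in blast)

lemma continuous_power:
  assumes "z \<in> spectrum X" shows "continuous_on path_set (\<lambda>\<zeta>. 1 / (\<zeta> - z) ^ q)"
  using assms path_set_spectrum by (intro continuous_intros) auto

lemma continuous_truncated_resolvent:
  assumes "z \<in> spectrum X" shows "continuous_on path_set (\<lambda>\<zeta>. truncated_resolvent k \<zeta> z)"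
  unfolding truncated_resolvent_def
  by (intro continuous_on_sum op_comp.continuous_on bounded_linear.continuous_on[OF bounded_linear_scalar_op]
      continuous_power assms continuous_on_const)

lemma continuous_resolvent_sum:
  assumes "\<And>B. B \<in> P \<Longrightarrow> \<tau> B \<in> spectrum X"
  shows "continuous_on path_set (resolvent_sum k (P, \<tau>))"
proof -
  have "continuous_on path_set (\<lambda>\<zeta>. \<Sum>B\<in>P. truncated_resolvent k \<zeta> (\<tau> B) o\<^sub>L E (B \<inter> level k))"
    using assms by (intro continuous_on_sum op_comp.continuous_on continuous_truncated_resolvent continuous_on_const) auto
  then show ?thesis by (simp add: resolvent_sum_def)
qed

lemma eventually_continuous_resolvent_sum:
  "eventually (\<lambda>p. continuous_on path_set (resolvent_sum k p)) (tagged_refinements (spectrum X))"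
  using eventually_good[OF S_msets]
proof (rule eventually_mono)
  fix p assume p: "case p of (P, \<tau>) \<Rightarrow> borel_partition (spectrum X) P \<and> (\<forall>B\<in>P. \<tau> B \<in> B) \<and>
           (\<forall>B\<in>P. B \<subseteq> spectrum X \<or> B \<inter> spectrum X = {})"
  obtain P \<tau> where "p = (P, \<tau>)" by fastforce
  then show "continuous_on path_set (resolvent_sum k p)"
    using p borel_partition_msets by (auto intro!: continuous_resolvent_sum simp: msets_iff)
qed

lemma operator_integral_truncated_resolvent:
  assumes z: "z \<in> spectrum X" "m z = k" "k \<ge> 1"
  shows "operator_integral (\<lambda>\<zeta>. truncated_resolvent k \<zeta> z) = scalar_op (f z) + nilpotent_integrand X m f z"
proof -
  have zW: "z \<in> W" using z spectrum_W by blast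
  have "operator_integral (\<lambda>\<zeta>. truncated_resolvent k \<zeta> z)
     = (\<Sum>q<k. scalar_op (scalar_integral (\<lambda>\<zeta>. 1 / (\<zeta> - z) ^ Suc q)) o\<^sub>L op_power (X - scalar_op z) q)"
    unfolding truncated_resolvent_def
    by (subst operator_integral_sum)
      (auto intro!: sum.cong operator_integral_scalar op_comp.continuous_on continuous_on_const
         bounded_linear.continuous_on[OF bounded_linear_scalar_op] continuous_power z simp del: power_Suc)
  also have "\<dots> = (\<Sum>q<k. scalar_op ((deriv ^^ q) f z / fact q) o\<^sub>L op_power (X - scalar_op z) q)"
    by (simp only: higher_deriv_f[OF zW])
  \<comment> \<open>The term \<open>q = 0\<close> is \<open>f z\<close>; the others form the
    nilpotent integrand of order \<open>k\<close>.\<close>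
  also have "{..<k} = insert 0 {1..k - 1}" using z(3) by auto
  finally show ?thesis by (simp add: nilpotent_integrand_def z(2))
qed

text \<open>The Riemann sums of \<open>op_fun\<close>, multiplied by \<open>E (level k)\<close>, are
  contour integrals of resolvent sums. These converge in norm, which identifies the strong limit
  level by level.\<close>

lemma op_fun_eq:
  assumes "op_fun_defined X E m f"
  shows "op_fun X E m f = operator_integral (resolvent X)"
proof -
  let ?F = "tagged_refinements (spectrum X)"
  let ?\<Phi> = "\<lambda>z. scalar_op (f z) + nilpotent_integrand X m f z"
  have int: "has_op_integral E (spectrum X) ?\<Phi> (op_fun X E m f)"
    unfolding op_fun_def using assms unfolding op_fun_defined_def
    by (intro has_op_integral_add has_op_integral_op_integral) auto
  show ?thesis
  proof (rule eqI_levels)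
    fix k :: nat assume k: "k \<ge> 1"
    let ?L = "level k"
    have "((\<lambda>p. operator_integral (resolvent_sum k p)) \<longlongrightarrow> operator_integral (\<lambda>\<zeta>. resolvent X \<zeta> o\<^sub>L E ?L)) ?F"
      by (intro tendsto_operator_integral resolvent_sum_uniform_limit k compact_path_set path_set_spectrum
          eventually_continuous_resolvent_sum op_comp.continuous_on continuous_on_const continuous_resolvent)
    then have lim: "((\<lambda>p. operator_integral (resolvent_sum k p)) \<longlongrightarrow> operator_integral (resolvent X) o\<^sub>L E ?L) ?F"
      by (simp add: operator_integral_comp_right continuous_resolvent)
    \<comment> \<open>For partitions that respect \<open>level k\<close>, a cell inside it has
      \<open>m (\<tau> B) = k\<close>, so the truncation order is the right one; on the other cells
      both sides vanish.\<close>
    have ev: "eventually (\<lambda>p. (case p of (P, \<tau>) \<Rightarrow> \<Sum>B\<in>P. ?\<Phi> (\<tau> B) o\<^sub>L E B) o\<^sub>L E ?L = operator_integral (resolvent_sum k p)) ?F"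
      using eventually_good[OF level_msets[of k]]
    proof (rule eventually_mono)
      fix p assume p1: "case p of (P, \<tau>) \<Rightarrow> borel_partition (spectrum X) P \<and> (\<forall>B\<in>P. \<tau> B \<in> B) \<and>
           (\<forall>B\<in>P. B \<subseteq> ?L \<or> B \<inter> ?L = {})"
      obtain P \<tau> where p: "p = (P, \<tau>)" by fastforce
      have P: "borel_partition (spectrum X) P" and \<tau>: "\<And>B. B \<in> P \<Longrightarrow> \<tau> B \<in> B"
        and sub: "\<And>B. B \<in> P \<Longrightarrow> B \<subseteq> ?L \<or> B \<inter> ?L = {}" using p1 by (auto simp: p)
      have Bm: "B \<in> msets" if "B \<in> P" for B using borel_partition_msets[OF P that] .
      have \<tau>S: "\<tau> B \<in> spectrum X" if "B \<in> P" for B using Bm[OF that] \<tau>[OF that] by (auto simp: msets_iff)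
      have fin: "finite P" using P by (simp add: borel_partition_def)
      have "operator_integral (resolvent_sum k p) =
          (\<Sum>B\<in>P. operator_integral (\<lambda>\<zeta>. truncated_resolvent k \<zeta> (\<tau> B) o\<^sub>L E (B \<inter> ?L)))"
        unfolding p resolvent_sum_def case_prod_conv
        using fin \<tau>S by (intro operator_integral_sum op_comp.continuous_on continuous_truncated_resolvent continuous_on_const) auto
      also have "\<dots> = (\<Sum>B\<in>P. ?\<Phi> (\<tau> B) o\<^sub>L E B o\<^sub>L E ?L)"
      proof (rule sum.cong[OF refl])
        fix B assume B: "B \<in> P"
        have 1: "operator_integral (\<lambda>\<zeta>. truncated_resolvent k \<zeta> (\<tau> B) o\<^sub>L E (B \<inter> ?L))
            = operator_integral (\<lambda>\<zeta>. truncated_resolvent k \<zeta> (\<tau> B)) o\<^sub>L E (B \<inter> ?L)"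
          by (intro operator_integral_comp_right continuous_truncated_resolvent \<tau>S B)
        have 2: "?\<Phi> (\<tau> B) o\<^sub>L E B o\<^sub>L E ?L = ?\<Phi> (\<tau> B) o\<^sub>L E (B \<inter> ?L)"
          using Bm[OF B] by (simp add: op_comp_assoc E_comp)
        show "operator_integral (\<lambda>\<zeta>. truncated_resolvent k \<zeta> (\<tau> B) o\<^sub>L E (B \<inter> ?L)) = ?\<Phi> (\<tau> B) o\<^sub>L E B o\<^sub>L E ?L"
        proof (cases "B \<inter> ?L = {}")
          case True
          then show ?thesis unfolding 1 2 by (simp add: op_comp.zero_right)
        next
          case False
          then have "m (\<tau> B) = k" using sub[OF B] \<tau>[OF B] by (auto simp: level_def)
          then show ?thesis
            unfolding 1 2 using operator_integral_truncated_resolvent[OF \<tau>S[OF B] _ k] by (simp only:)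
        qed
      qed
      finally show "(case p of (P, \<tau>) \<Rightarrow> \<Sum>B\<in>P. ?\<Phi> (\<tau> B) o\<^sub>L E B) o\<^sub>L E ?L = operator_integral (resolvent_sum k p)"
        by (simp add: p op_comp.sum_left)
    qed
    \<comment> \<open>The strong limit is tested at the vector \<open>E ?L\<close> applied to
      \<open>x\<close>, which puts the projection to the right of the Riemann sums.\<close>
    show "op_fun X E m f o\<^sub>L E ?L = operator_integral (resolvent X) o\<^sub>L E ?L"
    proof (rule blinfun_eqI)
      fix x
      have "((\<lambda>(P, \<tau>). \<Sum>B\<in>P. blinfun_apply (?\<Phi> (\<tau> B) o\<^sub>L E B) (blinfun_apply (E ?L) x)) \<longlongrightarrow>
          blinfun_apply (op_fun X E m f) (blinfun_apply (E ?L) x)) ?F"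
        using int unfolding has_op_integral_def by blast
      then have "((\<lambda>p. blinfun_apply ((case p of (P, \<tau>) \<Rightarrow> \<Sum>B\<in>P. ?\<Phi> (\<tau> B) o\<^sub>L E B) o\<^sub>L E ?L) x) \<longlongrightarrow>
          blinfun_apply (op_fun X E m f o\<^sub>L E ?L) x) ?F"
        by (simp add: case_prod_unfold blinfun.sum_left)
      moreover have "eventually (\<lambda>p. blinfun_apply ((case p of (P, \<tau>) \<Rightarrow> \<Sum>B\<in>P. ?\<Phi> (\<tau> B) o\<^sub>L E B) o\<^sub>L E ?L) x =
          blinfun_apply (operator_integral (resolvent_sum k p)) x) ?F"
        using ev by (rule eventually_mono) (simp only:)
      ultimately have "((\<lambda>p. blinfun_apply (operator_integral (resolvent_sum k p)) x) \<longlongrightarrow>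
          blinfun_apply (op_fun X E m f o\<^sub>L E ?L) x) ?F"
        by (rule Lim_transform_eventually)
      moreover have "((\<lambda>p. blinfun_apply (operator_integral (resolvent_sum k p)) x) \<longlongrightarrow>
          blinfun_apply (operator_integral (resolvent X) o\<^sub>L E ?L) x) ?F"
        by (intro blinfun.tendsto lim tendsto_const)
      ultimately show "blinfun_apply (op_fun X E m f o\<^sub>L E ?L) x = blinfun_apply (operator_integral (resolvent X) o\<^sub>L E ?L) x"
        by (rule tendsto_unique[OF tagged_refinements_neq_bot])
    qed
  qed
qed

end

section \<open>The double operator integral as a contour integral\<close>

context spectral_op_calculus
begin

text \<open>An exact identity of finite sums. Both variables share one contour parameter, so the
  fourfold sum is a single integral of a product. The two levels \<open>j\<close> and
  \<open>k\<close> are independent, as the orders at the two tags are.\<close>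

lemma double_resolvent_sum:
  assumes Y: "complex_linear Y"
    and P: "borel_partition (spectrum X) P" "\<And>B. B \<in> P \<Longrightarrow> \<tau> B \<in> B" "\<And>B. B \<in> P \<Longrightarrow> B \<subseteq> level j \<or> B \<inter> level j = {}"
    and Q: "borel_partition (spectrum X) Q" "\<And>C. C \<in> Q \<Longrightarrow> \<rho> C \<in> C" "\<And>C. C \<in> Q \<Longrightarrow> C \<subseteq> level k \<or> C \<inter> level k = {}"
  shows "E (level j) o\<^sub>L (\<Sum>B\<in>P. \<Sum>C\<in>Q. \<Sum>p<m (\<tau> B). \<Sum>q<m (\<rho> C).
      scalar_op (partial_deriv p q (divided_difference f) (\<tau> B) (\<rho> C) / (fact p * fact q)) o\<^sub>L
        op_power (X - scalar_op (\<tau> B)) p o\<^sub>L E B o\<^sub>L Y o\<^sub>L op_power (X - scalar_op (\<rho> C)) q o\<^sub>L E C) o\<^sub>L E (level k)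
    = operator_integral (\<lambda>\<zeta>. resolvent_sum j (P, \<tau>) \<zeta> o\<^sub>L Y o\<^sub>L resolvent_sum k (Q, \<rho>) \<zeta>)"
proof -
  let ?c = "\<lambda>p q x y. partial_deriv p q (divided_difference f) x y / (fact p * fact q)"
  let ?M = "\<lambda>p B. op_power (X - scalar_op (\<tau> B)) p o\<^sub>L E (B \<inter> level j) o\<^sub>L Y"
  let ?N = "\<lambda>q C. op_power (X - scalar_op (\<rho> C)) q o\<^sub>L E (C \<inter> level k)"
  let ?r = "\<lambda>B \<zeta>. truncated_resolvent j \<zeta> (\<tau> B) o\<^sub>L E (B \<inter> level j)"
  let ?s = "\<lambda>C \<zeta>. truncated_resolvent k \<zeta> (\<rho> C) o\<^sub>L E (C \<inter> level k)"
  have Pm: "B \<in> msets" "\<tau> B \<in> spectrum X" if "B \<in> P" for B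
    using borel_partition_msets[OF P(1) that] P(2)[OF that] by (auto simp: msets_iff)
  have Qm: "C \<in> msets" "\<rho> C \<in> spectrum X" if "C \<in> Q" for C
    using borel_partition_msets[OF Q(1) that] Q(2)[OF that] by (auto simp: msets_iff)
  have fin: "finite P" "finite Q" using P Q by (auto simp: borel_partition_def)
  have clp: "complex_linear (op_power (X - scalar_op z) q)" for z q
    using complex_linear_X by (intro complex_linear_op_power complex_linear_diff) auto
  have cont_rs: "continuous_on path_set (\<lambda>\<zeta>. ?r B \<zeta> o\<^sub>L Y o\<^sub>L ?s C \<zeta>)" if "B \<in> P" "C \<in> Q" for B C
    by (intro op_comp.continuous_on continuous_on_const continuous_truncated_resolvent Pm Qm that)
  \<comment> \<open>Unless a cell lies outside its level, where both sides vanish, the orders at the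
    tags are the truncation orders \<open>j\<close> and \<open>k\<close>.\<close>
  have cell: "operator_integral (\<lambda>\<zeta>. ?r B \<zeta> o\<^sub>L Y o\<^sub>L ?s C \<zeta>) =
     (\<Sum>p<m (\<tau> B). \<Sum>q<m (\<rho> C). scalar_op (?c p q (\<tau> B) (\<rho> C)) o\<^sub>L (?M p B o\<^sub>L ?N q C))"
    if B: "B \<in> P" and C: "C \<in> Q" for B C
  proof (cases "B \<inter> level j = {} \<or> C \<inter> level k = {}")
    case True
    then show ?thesis
      by (auto simp: op_comp.zero_left op_comp.zero_right operator_integral_def)
  next
    case False
    then have "\<tau> B \<in> level j" "\<rho> C \<in> level k" using P(2,3)[OF B] Q(2,3)[OF C] by blast+
    then have mjk: "m (\<tau> B) = j" "m (\<rho> C) = k" by (auto simp: level_def)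
    let ?h = "\<lambda>p q \<zeta>. 1 / (\<zeta> - \<tau> B) ^ Suc p * (1 / (\<zeta> - \<rho> C) ^ Suc q)"
    \<comment> \<open>This lets the scalars of the right-hand kernel pass to the front; the complex
      linearity of \<open>Y\<close> enters here.\<close>
    have clM: "complex_linear (?M p B)" for p
      by (intro complex_linear_comp clp Y complex_linear_E sets.Int Pm(1)[OF B] level_msets)
    have eq: "?r B \<zeta> o\<^sub>L Y o\<^sub>L ?s C \<zeta> = (\<Sum>p<j. \<Sum>q<k. scalar_op (?h p q \<zeta>) o\<^sub>L (?M p B o\<^sub>L ?N q C))" for \<zeta>
    proof -
      have "?r B \<zeta> o\<^sub>L Y = (\<Sum>p<j. scalar_op (1 / (\<zeta> - \<tau> B) ^ Suc p) o\<^sub>L ?M p B)"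
        by (simp only: truncated_resolvent_def op_comp.sum_left op_comp_assoc)
      moreover have "?s C \<zeta> = (\<Sum>q<k. scalar_op (1 / (\<zeta> - \<rho> C) ^ Suc q) o\<^sub>L ?N q C)"
        by (simp only: truncated_resolvent_def op_comp.sum_left op_comp_assoc)
      moreover have "(scalar_op c o\<^sub>L ?M p B) o\<^sub>L (scalar_op d o\<^sub>L ?N q C) = scalar_op (c * d) o\<^sub>L (?M p B o\<^sub>L ?N q C)" for c d p q
      proof -
        have "(scalar_op c o\<^sub>L ?M p B) o\<^sub>L (scalar_op d o\<^sub>L ?N q C) = scalar_op c o\<^sub>L (?M p B o\<^sub>L scalar_op d) o\<^sub>L ?N q C"
          by (simp only: op_comp_assoc)
        also have "\<dots> = scalar_op (c * d) o\<^sub>L (?M p B o\<^sub>L ?N q C)"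
          unfolding complex_linear_scalar_commute[OF clM] scalar_op_mult by (simp only: op_comp_assoc)
        finally show ?thesis .
      qed
      ultimately have "?r B \<zeta> o\<^sub>L Y o\<^sub>L ?s C \<zeta> = (\<Sum>q<k. \<Sum>p<j. scalar_op (?h p q \<zeta>) o\<^sub>L (?M p B o\<^sub>L ?N q C))"
        by (simp only: op_comp.sum_left op_comp.sum_right)
      then show ?thesis by (simp only: sum.swap[of _ "{..<k}"])
    qed
    have cont_h: "continuous_on path_set (?h p q)" for p q
      by (intro continuous_on_mult continuous_power Pm Qm B C)
    have cont: "continuous_on path_set (\<lambda>\<zeta>. scalar_op (?h p q \<zeta>) o\<^sub>L T)" for p q and T :: "'a operator"
      by (intro op_comp.continuous_on bounded_linear.continuous_on[OF bounded_linear_scalar_op] continuous_on_const cont_h)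
    have "operator_integral (\<lambda>\<zeta>. ?r B \<zeta> o\<^sub>L Y o\<^sub>L ?s C \<zeta>)
        = (\<Sum>p<j. \<Sum>q<k. operator_integral (\<lambda>\<zeta>. scalar_op (?h p q \<zeta>) o\<^sub>L (?M p B o\<^sub>L ?N q C)))"
      unfolding eq by (simp only: operator_integral_sum finite_lessThan continuous_on_sum cont)
    also have "\<dots> = (\<Sum>p<j. \<Sum>q<k. scalar_op (scalar_integral (?h p q)) o\<^sub>L (?M p B o\<^sub>L ?N q C))"
      by (simp only: operator_integral_scalar cont_h)
    also have "\<dots> = (\<Sum>p<j. \<Sum>q<k. scalar_op (?c p q (\<tau> B) (\<rho> C)) o\<^sub>L (?M p B o\<^sub>L ?N q C))"
    proof -
      have "\<tau> B \<in> W" "\<rho> C \<in> W" using Pm[OF B] Qm[OF C] spectrum_W by auto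
      then show ?thesis by (simp only: partial_deriv_divided_difference)
    qed
    finally show ?thesis by (simp only: mjk)
  qed
  \<comment> \<open>On the left the level projection must cross scalars and powers of
    \<open>X\<close> to reach \<open>E B\<close>; on the right \<open>E C\<close> already stands
    next to it.\<close>
  have move: "E (level j) o\<^sub>L (scalar_op c o\<^sub>L op_power (X - scalar_op (\<tau> B)) p o\<^sub>L E B o\<^sub>L Y o\<^sub>L
       op_power (X - scalar_op (\<rho> C)) q o\<^sub>L E C) o\<^sub>L E (level k) = scalar_op c o\<^sub>L (?M p B o\<^sub>L ?N q C)"
    if B: "B \<in> P" and C: "C \<in> Q" for B C c p q
  proof -
    let ?L = "E (level j)" and ?p = "op_power (X - scalar_op (\<tau> B)) p"
    have comm_s: "?L o\<^sub>L scalar_op c = scalar_op c o\<^sub>L ?L" for c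
      by (intro complex_linear_scalar_commute complex_linear_E level_msets)
    have "(X - scalar_op (\<tau> B)) o\<^sub>L ?L = ?L o\<^sub>L (X - scalar_op (\<tau> B))"
      using X_E_commute[OF level_msets[of j]] comm_s by (simp add: op_comp.diff_left op_comp.diff_right)
    then have comm_p: "?L o\<^sub>L ?p = ?p o\<^sub>L ?L" by (rule op_power_commute[symmetric])
    have "?L o\<^sub>L (scalar_op c o\<^sub>L ?p o\<^sub>L E B o\<^sub>L Y o\<^sub>L op_power (X - scalar_op (\<rho> C)) q o\<^sub>L E C) o\<^sub>L E (level k)
        = ((?L o\<^sub>L scalar_op c) o\<^sub>L ?p) o\<^sub>L E B o\<^sub>L Y o\<^sub>L op_power (X - scalar_op (\<rho> C)) q o\<^sub>L (E C o\<^sub>L E (level k))"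
      by (simp only: op_comp_assoc)
    also have "(?L o\<^sub>L scalar_op c) o\<^sub>L ?p = scalar_op c o\<^sub>L (?L o\<^sub>L ?p)" unfolding comm_s by (simp only: op_comp_assoc)
    also have "scalar_op c o\<^sub>L (?L o\<^sub>L ?p) o\<^sub>L E B = scalar_op c o\<^sub>L ?p o\<^sub>L (?L o\<^sub>L E B)"
      unfolding comm_p by (simp only: op_comp_assoc)
    also have "?L o\<^sub>L E B = E (B \<inter> level j)" using Pm[OF B] by (simp add: E_comp Int_commute)
    also have "E C o\<^sub>L E (level k) = E (C \<inter> level k)" using Qm[OF C] by (simp add: E_comp)
    finally show ?thesis by (simp only: op_comp_assoc)
  qed
  have "operator_integral (\<lambda>\<zeta>. resolvent_sum j (P, \<tau>) \<zeta> o\<^sub>L Y o\<^sub>L resolvent_sum k (Q, \<rho>) \<zeta>)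
      = operator_integral (\<lambda>\<zeta>. \<Sum>C\<in>Q. \<Sum>B\<in>P. ?r B \<zeta> o\<^sub>L Y o\<^sub>L ?s C \<zeta>)"
    by (simp only: resolvent_sum_def case_prod_conv op_comp.sum_left op_comp.sum_right)
  also have "\<dots> = (\<Sum>C\<in>Q. \<Sum>B\<in>P. operator_integral (\<lambda>\<zeta>. ?r B \<zeta> o\<^sub>L Y o\<^sub>L ?s C \<zeta>))"
    by (subst operator_integral_sum[OF fin(2)])
      (auto intro!: continuous_on_sum cont_rs sum.cong operator_integral_sum[OF fin(1)])
  also have "\<dots> = (\<Sum>B\<in>P. \<Sum>C\<in>Q. \<Sum>p<m (\<tau> B). \<Sum>q<m (\<rho> C). scalar_op (?c p q (\<tau> B) (\<rho> C)) o\<^sub>L (?M p B o\<^sub>L ?N q C))"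
    by (subst sum.swap) (intro sum.cong refl cell)
  also have "\<dots> = E (level j) o\<^sub>L (\<Sum>B\<in>P. \<Sum>C\<in>Q. \<Sum>p<m (\<tau> B). \<Sum>q<m (\<rho> C).
      scalar_op (?c p q (\<tau> B) (\<rho> C)) o\<^sub>L
        op_power (X - scalar_op (\<tau> B)) p o\<^sub>L E B o\<^sub>L Y o\<^sub>L op_power (X - scalar_op (\<rho> C)) q o\<^sub>L E C) o\<^sub>L E (level k)"
    unfolding op_comp.sum_left op_comp.sum_right by (intro sum.cong refl move[symmetric])
  finally show ?thesis ..
qed

text \<open>The product filter lets the two partitions be refined independently. Each resolvent sum
  converges uniformly on the contour to a bounded limit, so their product around \<open>Y\<close>
  does too. Comparison takes place between two level projections.\<close>

lemma gdoi_eq: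
  assumes Y: "complex_linear Y" and A: "has_gdoi X E m X E m (divided_difference f) Y A"
  shows "A = operator_integral (\<lambda>\<zeta>. resolvent X \<zeta> o\<^sub>L Y o\<^sub>L resolvent X \<zeta>)"
proof (rule eqI_levels, rule eqI_levels_left)
  fix k j :: nat assume k: "k \<ge> 1" and j: "j \<ge> 1"
  let ?F = "tagged_refinements (spectrum X)"
  let ?FF = "?F \<times>\<^sub>F ?F"
  let ?Ej = "E (level j)" and ?Ek = "E (level k)"
  let ?S = "\<lambda>((P, \<tau>), (Q, \<rho>)). \<Sum>B\<in>P. \<Sum>C\<in>Q. \<Sum>p<m (\<tau> B). \<Sum>q<m (\<rho> C).
      scalar_op (partial_deriv p q (divided_difference f) (\<tau> B) (\<rho> C) / (fact p * fact q)) o\<^sub>L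
        op_power (X - scalar_op (\<tau> B)) p o\<^sub>L E B o\<^sub>L Y o\<^sub>L op_power (X - scalar_op (\<rho> C)) q o\<^sub>L E C"
  let ?R = "\<lambda>x \<zeta>. resolvent_sum j (fst x) \<zeta> o\<^sub>L Y o\<^sub>L resolvent_sum k (snd x) \<zeta>"
  let ?l = "\<lambda>\<zeta>. (resolvent X \<zeta> o\<^sub>L ?Ej) o\<^sub>L Y o\<^sub>L (resolvent X \<zeta> o\<^sub>L ?Ek)"
  have bounded: "bounded ((\<lambda>\<zeta>. resolvent X \<zeta> o\<^sub>L T) ` path_set)" "bounded ((\<lambda>\<zeta>. resolvent X \<zeta> o\<^sub>L T o\<^sub>L Y) ` path_set)" for T
    by (intro compact_imp_bounded compact_continuous_image compact_path_set op_comp.continuous_on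
        continuous_on_const continuous_resolvent)+
  have "uniform_limit path_set (\<lambda>x. resolvent_sum j (fst x)) (\<lambda>\<zeta>. resolvent X \<zeta> o\<^sub>L ?Ej) ?FF"
    by (rule filterlim_compose[OF resolvent_sum_uniform_limit[OF j compact_path_set path_set_spectrum] filterlim_fst])
  moreover have "uniform_limit path_set (\<lambda>x. resolvent_sum k (snd x)) (\<lambda>\<zeta>. resolvent X \<zeta> o\<^sub>L ?Ek) ?FF"
    by (rule filterlim_compose[OF resolvent_sum_uniform_limit[OF k compact_path_set path_set_spectrum] filterlim_snd])
  ultimately have "uniform_limit path_set ?R ?l ?FF"
    by (intro op_comp.bounded_uniform_limit uniform_limit_const bounded)
      (auto intro: finite_imp_bounded finite_subset[of _ "{Y}"])
  moreover have "eventually (\<lambda>x. continuous_on path_set (?R x)) ?FF"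
    unfolding eventually_prod_filter
    by (intro exI[of _ "\<lambda>p. continuous_on path_set (resolvent_sum j p)"]
        exI[of _ "\<lambda>p. continuous_on path_set (resolvent_sum k p)"] conjI eventually_continuous_resolvent_sum)
      (auto intro!: op_comp.continuous_on continuous_on_const)
  moreover have "continuous_on path_set ?l"
    by (intro op_comp.continuous_on continuous_on_const continuous_resolvent)
  ultimately have "((\<lambda>x. operator_integral (?R x)) \<longlongrightarrow> operator_integral ?l) ?FF"
    by (rule tendsto_operator_integral)
  moreover have "operator_integral ?l = ?Ej o\<^sub>L operator_integral (\<lambda>\<zeta>. resolvent X \<zeta> o\<^sub>L Y o\<^sub>L resolvent X \<zeta>) o\<^sub>L ?Ek"
  proof -
    have "operator_integral ?l = operator_integral (\<lambda>\<zeta>. ?Ej o\<^sub>L (resolvent X \<zeta> o\<^sub>L Y o\<^sub>L resolvent X \<zeta>) o\<^sub>L ?Ek)"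
      unfolding operator_integral_def
    proof (intro sum.cong refl integral_cong)
      fix i and u :: real assume i: "i \<in> I" and u: "u \<in> {0..1}"
      let ?z = "linepath (a i) (b i) u"
      have "?z \<in> path_set" using segment_path_set[OF i] linepath_in_path[OF u] by blast
      then have z: "?z \<notin> spectrum X" using path_set_spectrum by blast
      \<comment> \<open>Multiplying this relation by the resolvent on both sides shows that
        \<open>?Ej\<close> commutes with the resolvent.\<close>
      have "(scalar_op ?z - X) o\<^sub>L ?Ej = ?Ej o\<^sub>L (scalar_op ?z - X)"
        using X_E_commute[OF level_msets[of j]] complex_linear_scalar_commute[OF complex_linear_E[OF level_msets[of j]]]
        by (simp add: op_comp.diff_left op_comp.diff_right)
      then have "resolvent X ?z o\<^sub>L ((scalar_op ?z - X) o\<^sub>L ?Ej) o\<^sub>L resolvent X ?z =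
          resolvent X ?z o\<^sub>L (?Ej o\<^sub>L (scalar_op ?z - X)) o\<^sub>L resolvent X ?z" by (simp only:)
      then have "(resolvent X ?z o\<^sub>L (scalar_op ?z - X)) o\<^sub>L (?Ej o\<^sub>L resolvent X ?z) =
          (resolvent X ?z o\<^sub>L ?Ej) o\<^sub>L ((scalar_op ?z - X) o\<^sub>L resolvent X ?z)" by (simp only: op_comp_assoc)
      then have "?Ej o\<^sub>L resolvent X ?z = resolvent X ?z o\<^sub>L ?Ej"
        using op_inverse_resolvent[OF z] by (simp add: op_inverse_def)
      then show "scalar_op (weight i u) o\<^sub>L ?l ?z =
        scalar_op (weight i u) o\<^sub>L (?Ej o\<^sub>L (resolvent X ?z o\<^sub>L Y o\<^sub>L resolvent X ?z) o\<^sub>L ?Ek)"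
        by (simp only: op_comp_assoc[symmetric])
    qed
    also have "\<dots> = ?Ej o\<^sub>L operator_integral (\<lambda>\<zeta>. resolvent X \<zeta> o\<^sub>L Y o\<^sub>L resolvent X \<zeta>) o\<^sub>L ?Ek"
      by (intro operator_integral_comp complex_linear_E level_msets op_comp.continuous_on continuous_on_const continuous_resolvent)
    finally show ?thesis .
  qed
  ultimately have lim: "((\<lambda>x. operator_integral (?R x)) \<longlongrightarrow>
      ?Ej o\<^sub>L operator_integral (\<lambda>\<zeta>. resolvent X \<zeta> o\<^sub>L Y o\<^sub>L resolvent X \<zeta>) o\<^sub>L ?Ek) ?FF" by (simp only:)
  have ev: "eventually (\<lambda>x. ?Ej o\<^sub>L ?S x o\<^sub>L ?Ek = operator_integral (?R x)) ?FF"
    unfolding eventually_prod_filter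
  proof (intro exI conjI allI impI)
    fix x y
    assume x: "case x of (P, \<tau>) \<Rightarrow> borel_partition (spectrum X) P \<and> (\<forall>B\<in>P. \<tau> B \<in> B) \<and> (\<forall>B\<in>P. B \<subseteq> level j \<or> B \<inter> level j = {})"
      and y: "case y of (P, \<tau>) \<Rightarrow> borel_partition (spectrum X) P \<and> (\<forall>B\<in>P. \<tau> B \<in> B) \<and> (\<forall>B\<in>P. B \<subseteq> level k \<or> B \<inter> level k = {})"
    obtain P \<tau> where P: "x = (P, \<tau>)" by fastforce
    obtain Q \<rho> where Q: "y = (Q, \<rho>)" by fastforce
    show "?Ej o\<^sub>L ?S (x, y) o\<^sub>L ?Ek = operator_integral (?R (x, y))"
      unfolding P Q case_prod_conv fst_conv snd_conv
      by (rule double_resolvent_sum[OF Y]) (use x y in \<open>auto simp: P Q\<close>)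
  qed (rule eventually_good level_msets)+
  show "?Ej o\<^sub>L (A o\<^sub>L ?Ek) = ?Ej o\<^sub>L (operator_integral (\<lambda>\<zeta>. resolvent X \<zeta> o\<^sub>L Y o\<^sub>L resolvent X \<zeta>) o\<^sub>L ?Ek)"
  proof (rule blinfun_eqI)
    fix v
    have "((\<lambda>x. \<Sum>B\<in>fst (fst x). \<Sum>C\<in>fst (snd x). blinfun_apply (\<Sum>p<m (snd (fst x) B). \<Sum>q<m (snd (snd x) C).
        scalar_op (partial_deriv p q (divided_difference f) (snd (fst x) B) (snd (snd x) C) / (fact p * fact q)) o\<^sub>L
        op_power (X - scalar_op (snd (fst x) B)) p o\<^sub>L E B o\<^sub>L Y o\<^sub>L op_power (X - scalar_op (snd (snd x) C)) q o\<^sub>L E C)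
          (blinfun_apply ?Ek v))
        \<longlongrightarrow> blinfun_apply A (blinfun_apply ?Ek v)) ?FF"
      using A[unfolded has_gdoi_def has_double_op_integral_def, rule_format, of "blinfun_apply ?Ek v"]
      by (simp only: case_prod_unfold)
    then have "((\<lambda>x. blinfun_apply (?S x) (blinfun_apply ?Ek v)) \<longlongrightarrow> blinfun_apply A (blinfun_apply ?Ek v)) ?FF"
      by (simp only: case_prod_unfold blinfun.sum_left)
    then have "((\<lambda>x. blinfun_apply ?Ej (blinfun_apply (?S x) (blinfun_apply ?Ek v))) \<longlongrightarrow>
        blinfun_apply ?Ej (blinfun_apply A (blinfun_apply ?Ek v))) ?FF"
      by (rule bounded_linear.tendsto[OF blinfun.bounded_linear_right])
    then have "((\<lambda>x. blinfun_apply (?Ej o\<^sub>L ?S x o\<^sub>L ?Ek) v) \<longlongrightarrow> blinfun_apply (?Ej o\<^sub>L (A o\<^sub>L ?Ek)) v) ?FF"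
      by (simp only: blinfun_apply_blinfun_compose)
    moreover have "eventually (\<lambda>x. blinfun_apply (?Ej o\<^sub>L ?S x o\<^sub>L ?Ek) v = blinfun_apply (operator_integral (?R x)) v) ?FF"
      using ev by (rule eventually_mono) (simp only:)
    ultimately have "((\<lambda>x. blinfun_apply (operator_integral (?R x)) v) \<longlongrightarrow> blinfun_apply (?Ej o\<^sub>L (A o\<^sub>L ?Ek)) v) ?FF"
      by (rule Lim_transform_eventually)
    moreover have "((\<lambda>x. blinfun_apply (operator_integral (?R x)) v) \<longlongrightarrow>
        blinfun_apply (?Ej o\<^sub>L operator_integral (\<lambda>\<zeta>. resolvent X \<zeta> o\<^sub>L Y o\<^sub>L resolvent X \<zeta>) o\<^sub>L ?Ek) v) ?FF"
      by (intro blinfun.tendsto lim tendsto_const)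
    moreover have "?FF \<noteq> bot" by (simp add: prod_filter_eq_bot tagged_refinements_neq_bot)
    ultimately have "blinfun_apply (?Ej o\<^sub>L (A o\<^sub>L ?Ek)) v =
       blinfun_apply (?Ej o\<^sub>L operator_integral (\<lambda>\<zeta>. resolvent X \<zeta> o\<^sub>L Y o\<^sub>L resolvent X \<zeta>) o\<^sub>L ?Ek) v"
      using tendsto_unique by blast
    then show "blinfun_apply (?Ej o\<^sub>L (A o\<^sub>L ?Ek)) v =
       blinfun_apply (?Ej o\<^sub>L (operator_integral (\<lambda>\<zeta>. resolvent X \<zeta> o\<^sub>L Y o\<^sub>L resolvent X \<zeta>) o\<^sub>L ?Ek)) v"
      by (simp only: op_comp_assoc)
  qed
qed

end

section \<open>The derivative\<close>

text \<open>Applied to difference quotients, this makes the derivative of \<open>X\<close> complex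
  linear, as required of the middle operator \<open>Y\<close>.\<close>

lemma complex_linear_tendsto:
  assumes "(A \<longlongrightarrow> L) F" "F \<noteq> bot" "eventually (\<lambda>x. complex_linear (A x)) F"
  shows "complex_linear L"
  unfolding complex_linear_def
proof (intro allI)
  fix c x
  have "((\<lambda>y. blinfun_apply (A y) (c *\<^sub>C x)) \<longlongrightarrow> blinfun_apply L (c *\<^sub>C x)) F"
    by (intro blinfun.tendsto assms(1) tendsto_const)
  moreover have "eventually (\<lambda>y. blinfun_apply (A y) (c *\<^sub>C x) = c *\<^sub>C blinfun_apply (A y) x) F"
    using assms(3) by (rule eventually_mono) (simp add: complex_linear_def)
  ultimately have "((\<lambda>y. c *\<^sub>C blinfun_apply (A y) x) \<longlongrightarrow> blinfun_apply L (c *\<^sub>C x)) F"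
    by (rule Lim_transform_eventually)
  moreover have "((\<lambda>y. c *\<^sub>C blinfun_apply (A y) x) \<longlongrightarrow> c *\<^sub>C blinfun_apply L x) F"
    by (intro bounded_linear.tendsto[OF bounded_linear_scaleC] blinfun.tendsto assms(1) tendsto_const)
  ultimately show "blinfun_apply L (c *\<^sub>C x) = c *\<^sub>C blinfun_apply L x"
    by (rule tendsto_unique[OF assms(2)])
qed

text \<open>Serves two compact sets: on the contour it bounds the resolvents near \<open>t\<close>;
  on a set off the spectrum of \<open>X t\<close> it keeps the nearby spectra away.\<close>

lemma uniform_resolvent_perturb:
  fixes X :: "real \<Rightarrow> ('a :: complex_hilbert_space) operator"
  assumes X: "\<And>s. complex_linear (X s)" and lim: "(X \<longlongrightarrow> X t) (at t)"
    and K: "compact K" "K \<inter> spectrum (X t) = {}"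
  obtains C where "C > 0" "\<And>\<zeta>. \<zeta> \<in> K \<Longrightarrow> norm (resolvent (X t) \<zeta>) \<le> C"
    "eventually (\<lambda>s. \<forall>\<zeta>\<in>K. \<zeta> \<notin> spectrum (X s) \<and> norm (resolvent (X s) \<zeta>) \<le> 2 * C) (at t)"
proof -
  have "continuous_on K (resolvent (X t))"
    by (rule continuous_on_subset[OF continuous_on_resolvent[OF X]]) (use K(2) in blast)
  then have "bounded (resolvent (X t) ` K)"
    using K(1) by (intro compact_imp_bounded compact_continuous_image)
  then obtain C where C: "C > 0" "\<And>\<zeta>. \<zeta> \<in> K \<Longrightarrow> norm (resolvent (X t) \<zeta>) \<le> C"
    by (auto simp: bounded_pos)
  have "((\<lambda>s. norm (X s - X t)) \<longlongrightarrow> 0) (at t)" by (intro tendsto_norm_zero LIM_zero lim)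
  then have "((\<lambda>s. norm (X s - X t) * C) \<longlongrightarrow> 0) (at t)" by (rule tendsto_mult_left_zero)
  then have "eventually (\<lambda>s. norm (X s - X t) * C < 1 / 2) (at t)" by (rule order_tendstoD) simp
  then have "eventually (\<lambda>s. \<forall>\<zeta>\<in>K. \<zeta> \<notin> spectrum (X s) \<and> norm (resolvent (X s) \<zeta>) \<le> 2 * C) (at t)"
  proof (rule eventually_mono, intro ballI)
    fix s \<zeta> assume s: "norm (X s - X t) * C < 1 / 2" and \<zeta>: "\<zeta> \<in> K"
    have \<zeta>t: "\<zeta> \<notin> spectrum (X t)" using \<zeta> K(2) by blast
    have "norm ((scalar_op \<zeta> - X s) - (scalar_op \<zeta> - X t)) * norm (resolvent (X t) \<zeta>) \<le> norm (X s - X t) * C"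
      using C(2)[OF \<zeta>] by (intro mult_mono) (auto simp: norm_minus_commute)
    then have "norm ((scalar_op \<zeta> - X s) - (scalar_op \<zeta> - X t)) * norm (resolvent (X t) \<zeta>) \<le> 1 / 2"
      using s by linarith
    from resolvent_perturb[OF X \<zeta>t this]
    show "\<zeta> \<notin> spectrum (X s) \<and> norm (resolvent (X s) \<zeta>) \<le> 2 * C"
      using C(2)[OF \<zeta>] by auto
  qed
  with C show thesis by (rule that)
qed

lemma resolvent_uniform_limit:
  fixes X :: "real \<Rightarrow> ('a :: complex_hilbert_space) operator"
  assumes X: "\<And>s. complex_linear (X s)" and lim: "(X \<longlongrightarrow> X t) (at t)"
    and K: "compact K" "K \<inter> spectrum (X t) = {}"
  shows "uniform_limit K (\<lambda>s. resolvent (X s)) (resolvent (X t)) (at t)"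
proof (rule uniform_limitI)
  fix e :: real assume e: "e > 0"
  obtain C where C: "C > 0" "\<And>\<zeta>. \<zeta> \<in> K \<Longrightarrow> norm (resolvent (X t) \<zeta>) \<le> C"
    "eventually (\<lambda>s. \<forall>\<zeta>\<in>K. \<zeta> \<notin> spectrum (X s) \<and> norm (resolvent (X s) \<zeta>) \<le> 2 * C) (at t)"
    by (rule uniform_resolvent_perturb[OF X lim K]) blast
  have "((\<lambda>s. norm (X s - X t)) \<longlongrightarrow> 0) (at t)" by (intro tendsto_norm_zero LIM_zero lim)
  then have "((\<lambda>s. norm (X s - X t) * (2 * C * C)) \<longlongrightarrow> 0) (at t)" by (rule tendsto_mult_left_zero)
  then have "eventually (\<lambda>s. norm (X s - X t) * (2 * C * C) < e) (at t)" using e by (rule order_tendstoD)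
  with C(3) show "eventually (\<lambda>s. \<forall>\<zeta>\<in>K. dist (resolvent (X s) \<zeta>) (resolvent (X t) \<zeta>) < e) (at t)"
  proof eventually_elim
    case (elim s)
    show ?case
    proof
      fix \<zeta> assume \<zeta>: "\<zeta> \<in> K"
      have t: "\<zeta> \<notin> spectrum (X t)" and s: "\<zeta> \<notin> spectrum (X s)" using \<zeta> K(2) elim(1) by auto
      have "norm (resolvent (X s) \<zeta> - resolvent (X t) \<zeta>) \<le> norm (resolvent (X s) \<zeta>) *
          norm ((scalar_op \<zeta> - X t) - (scalar_op \<zeta> - X s)) * norm (resolvent (X t) \<zeta>)"
        unfolding resolvent_diff[OF t s] by (rule norm_op_comp_le3)
      also have "\<dots> \<le> 2 * C * norm (X s - X t) * C"
        using elim(1) \<zeta> C by (intro mult_mono) auto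
      finally show "dist (resolvent (X s) \<zeta>) (resolvent (X t) \<zeta>) < e"
        using elim(2) by (simp add: dist_norm mult_ac)
    qed
  qed
qed

lemma has_vector_derivative_iff_tendsto:
  fixes g :: "real \<Rightarrow> 'b :: real_normed_vector"
  shows "(g has_vector_derivative D) (at t) \<longleftrightarrow> ((\<lambda>s. (g s - g t) /\<^sub>R (s - t)) \<longlongrightarrow> D) (at t)"
proof -
  have "norm ((1 / norm (s - t)) *\<^sub>R (g s - (g t + (s - t) *\<^sub>R D))) = norm ((g s - g t) /\<^sub>R (s - t) - D)"
    if "s \<noteq> t" for s
  proof -
    have "(g s - g t) /\<^sub>R (s - t) - D = (g s - (g t + (s - t) *\<^sub>R D)) /\<^sub>R (s - t)"
      using that by (simp add: scaleR_diff_right flip: diff_diff_eq)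
    then show ?thesis by (simp add: divide_inverse abs_inverse)
  qed
  then have "((\<lambda>s. norm ((1 / norm (s - t)) *\<^sub>R (g s - (g t + (s - t) *\<^sub>R D)))) \<longlongrightarrow> 0) (at t) \<longleftrightarrow>
      ((\<lambda>s. norm ((g s - g t) /\<^sub>R (s - t) - D)) \<longlongrightarrow> 0) (at t)"
    by (intro filterlim_cong refl) (simp add: eventually_at_filter)
  then show ?thesis
    by (simp only: tendsto_norm_zero_iff LIM_zero_iff has_vector_derivative_def has_derivative_at_within
        bounded_linear_scaleR_left simp_thms diff_diff_eq inverse_eq_divide)
qed

lemma smooth_has_vector_derivative:
  assumes "smooth X" shows "(X has_vector_derivative vector_derivative X (at t)) (at t)"
proof -
  have "((\<lambda>g s. vector_derivative g (at s)) ^^ 0) X differentiable at t"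
    using assms unfolding smooth_def by blast
  then show ?thesis by (simp add: vector_derivative_works)
qed

theorem theorem11:
  fixes X :: "real \<Rightarrow> ('a :: complex_hilbert_space) operator"
    and E :: "real \<Rightarrow> complex set \<Rightarrow> 'a operator"
    and m :: "real \<Rightarrow> complex \<Rightarrow> nat"
    and f :: "complex \<Rightarrow> complex"
    and U K :: "complex set"
    and t :: real
  assumes "\<And>s. complex_linear (X s)"
    and "\<And>s. spectral_decomposition (X s) (E s) (m s)"
    and "smooth X"
    and "compact K" and "\<And>s. spectrum (X s) \<subseteq> K"
    and "open U" and "\<And>s. spectrum (X s) \<subseteq> U" and "f holomorphic_on U"
    and "\<And>s. op_fun_defined (X s) (E s) (m s) f"
    and "\<And>s. gdoi_defined (X s) (E s) (m s) (X s) (E s) (m s)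
           (divided_difference f) (vector_derivative X (at s))"
  shows "((\<lambda>s. op_fun (X s) (E s) (m s) f) has_vector_derivative
           gdoi (X t) (E t) (m t) (X t) (E t) (m t)
             (divided_difference f) (vector_derivative X (at t))) (at t)"
proof -
  note cl = assms(1) and decomp = assms(2) and defined = assms(9)
  let ?Y = "vector_derivative X (at t)"
  let ?D = "\<lambda>s. (X s - X t) /\<^sub>R (s - t)"
  let ?R = "\<lambda>s. resolvent (X s)"
  have bounded_spec: "bounded (spectrum (X s))" for s
    by (rule bounded_subset[OF compact_imp_bounded[OF assms(4)] assms(5)])
  have "compact (spectrum (X t))"
    using closed_spectrum[OF cl] bounded_spec by (simp add: compact_eq_bounded_closed)
  \<comment> \<open>The cycle surrounds the spectrum of \<open>X t\<close>, not \<open>K\<close>,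
    which may reach outside \<open>U\<close>.\<close>
  then obtain I :: "(bool \<times> int \<times> int) set" and w a b W where
    I: "finite I" "open W" "spectrum (X t) \<subseteq> W" "W \<subseteq> U"
    "\<And>i. i \<in> I \<Longrightarrow> closed_segment (a i) (b i) \<subseteq> U - W"
    "\<And>z. z \<in> W \<Longrightarrow> f z = (\<Sum>i\<in>I. w i * contour_integral (linepath (a i) (b i)) (\<lambda>u. f u / (u - z)))"
    by (rule Cauchy_cycle[OF _ assms(6,7,8)]) blast
  have cont_f: "continuous_on (closed_segment (a i) (b i)) f" if "i \<in> I" for i
    using I(5)[OF that] assms(8) by (intro continuous_on_subset[OF holomorphic_on_imp_continuous_on]) auto
  interpret rep: cauchy_representation I w a b f W
  proof
    show "closed_segment (a i) (b i) \<inter> W = {}" if "i \<in> I" for i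
      using I(5)[OF that] by blast
  qed (fact I(1) I(2) cont_f I(6))+
  let ?J = "rep.operator_integral :: (complex \<Rightarrow> 'a operator) \<Rightarrow> 'a operator"
  let ?P = "rep.path_set"
  have calc: "spectral_op_calculus (X s) (E s) (m s) I w a b f W" if "spectrum (X s) \<subseteq> W" for s
    by unfold_locales (use cl decomp bounded_spec that in auto)
  have deriv: "(X has_vector_derivative ?Y) (at t)" by (rule smooth_has_vector_derivative[OF assms(3)])
  have limX: "(X \<longlongrightarrow> X t) (at t)"
    using has_vector_derivative_continuous[OF deriv] by (simp add: isCont_def)
  have limD: "(?D \<longlongrightarrow> ?Y) (at t)"
    using deriv by (simp add: has_vector_derivative_iff_tendsto)
  have "complex_linear (?D s)" for s
    using complex_linear_comp[OF complex_linear_scalar_op complex_linear_diff[OF cl cl]]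
    by (metis scalar_op_of_real op_comp.scaleR_left op_comp_id(1))
  then have Y: "complex_linear ?Y"
    by (intro complex_linear_tendsto[OF limD]) auto
  have Pt: "?P \<inter> spectrum (X t) = {}" using rep.path_set_W I(3) by blast
  \<comment> \<open>Spectra lie in \<open>K\<close>, and those of nearby operators avoid the compact
    set \<open>K - W\<close>; hence they lie in \<open>W\<close>, and one cycle serves all
    parameters near \<open>t\<close>.\<close>
  have "compact (K - W)" "(K - W) \<inter> spectrum (X t) = {}"
    using assms(4) I(2,3) by (auto intro: compact_diff)
  then have "eventually (\<lambda>s. \<forall>\<zeta>\<in>K - W. \<zeta> \<notin> spectrum (X s)) (at t)"
    by (rule uniform_resolvent_perturb[OF cl limX]) (auto elim: eventually_mono)
  then have evW: "eventually (\<lambda>s. spectrum (X s) \<subseteq> W) (at t)"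
    by (rule eventually_mono) (use assms(5) in blast)
  have op_fun: "op_fun (X s) (E s) (m s) f = ?J (?R s)" if "spectrum (X s) \<subseteq> W" for s
    by (rule spectral_op_calculus.op_fun_eq[OF calc[OF that] defined])
  have gdoi: "gdoi (X t) (E t) (m t) (X t) (E t) (m t) (divided_difference f) ?Y =
      ?J (\<lambda>\<zeta>. ?R t \<zeta> o\<^sub>L ?Y o\<^sub>L ?R t \<zeta>)"
  proof -
    obtain A where A: "has_gdoi (X t) (E t) (m t) (X t) (E t) (m t) (divided_difference f) ?Y A"
      using assms(10)[of t] by (auto simp: gdoi_defined_def)
    show ?thesis
      using gdoi_eqI[OF A] spectral_op_calculus.gdoi_eq[OF calc[OF I(3)] Y A] by simp
  qed
  have cont_R: "continuous_on ?P (?R s)" if "spectrum (X s) \<subseteq> W" for s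
    by (rule spectral_op_calculus.continuous_resolvent[OF calc[OF that]])
  have lim: "((\<lambda>s. ?J (\<lambda>\<zeta>. ?R s \<zeta> o\<^sub>L ?D s o\<^sub>L ?R t \<zeta>)) \<longlongrightarrow> ?J (\<lambda>\<zeta>. ?R t \<zeta> o\<^sub>L ?Y o\<^sub>L ?R t \<zeta>)) (at t)"
  proof (rule rep.tendsto_operator_integral)
    have bR: "bounded ((\<lambda>\<zeta>. ?R t \<zeta> o\<^sub>L T) ` ?P)" "bounded (?R t ` ?P)" for T
      by (intro compact_imp_bounded compact_continuous_image rep.compact_path_set op_comp.continuous_on
        continuous_on_const cont_R I(3))+
    have "uniform_limit ?P (\<lambda>s \<zeta>. ?D s) (\<lambda>\<zeta>. ?Y) (at t)"
      using limD by (auto simp: uniform_limit_iff tendsto_iff elim: eventually_mono)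
    then show "uniform_limit ?P (\<lambda>s \<zeta>. ?R s \<zeta> o\<^sub>L ?D s o\<^sub>L ?R t \<zeta>) (\<lambda>\<zeta>. ?R t \<zeta> o\<^sub>L ?Y o\<^sub>L ?R t \<zeta>) (at t)"
      by (intro op_comp.bounded_uniform_limit resolvent_uniform_limit[OF cl limX rep.compact_path_set Pt]
        uniform_limit_const bR) (auto intro: finite_imp_bounded finite_subset[of _ "{?Y}"])
    show "eventually (\<lambda>s. continuous_on ?P (\<lambda>\<zeta>. ?R s \<zeta> o\<^sub>L ?D s o\<^sub>L ?R t \<zeta>)) (at t)"
      using evW by (rule eventually_mono) (intro op_comp.continuous_on continuous_on_const cont_R I(3))
    show "continuous_on ?P (\<lambda>\<zeta>. ?R t \<zeta> o\<^sub>L ?Y o\<^sub>L ?R t \<zeta>)"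
      by (intro op_comp.continuous_on continuous_on_const cont_R I(3))
  qed
  have "eventually (\<lambda>s. ?J (\<lambda>\<zeta>. ?R s \<zeta> o\<^sub>L ?D s o\<^sub>L ?R t \<zeta>) =
      (op_fun (X s) (E s) (m s) f - op_fun (X t) (E t) (m t) f) /\<^sub>R (s - t)) (at t)"
    using evW
  proof (rule eventually_mono)
    fix s assume s: "spectrum (X s) \<subseteq> W"
    have Ps: "?P \<inter> spectrum (X s) = {}" using rep.path_set_W s by blast
    \<comment> \<open>The real quotient becomes a complex scalar operator, which can be pulled out
      of the contour integral. For \<open>s = t\<close> both sides are 0, since
      \<open>inverse 0 = 0\<close>.\<close>
    let ?c = "scalar_op (of_real (inverse (s - t))) :: 'a operator"
    have c: "?c = inverse (s - t) *\<^sub>R id_blinfun" by (rule scalar_op_of_real)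
    have eq: "?R s \<zeta> o\<^sub>L ?D s o\<^sub>L ?R t \<zeta> = ?c o\<^sub>L (?R s \<zeta> - ?R t \<zeta>)" if "\<zeta> \<in> ?P" for \<zeta>
    proof -
      have "\<zeta> \<notin> spectrum (X t)" "\<zeta> \<notin> spectrum (X s)" using that Pt Ps by auto
      from resolvent_diff[OF this]
      show ?thesis
        unfolding c by (simp add: op_comp.scaleR_left op_comp.scaleR_right)
    qed
    have "?J (\<lambda>\<zeta>. ?R s \<zeta> o\<^sub>L ?D s o\<^sub>L ?R t \<zeta>) = ?J (\<lambda>\<zeta>. ?c o\<^sub>L (?R s \<zeta> - ?R t \<zeta>) o\<^sub>L id_blinfun)"
      unfolding rep.operator_integral_def
    proof (intro sum.cong refl integral_cong)
      fix i and u :: real assume i: "i \<in> I" and u: "u \<in> {0..1}"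
      have "linepath (a i) (b i) u \<in> ?P" using rep.segment_path_set[OF i] linepath_in_path[OF u] by blast
      from eq[OF this] show "scalar_op (rep.weight i u) o\<^sub>L (?R s (linepath (a i) (b i) u) o\<^sub>L ?D s o\<^sub>L ?R t (linepath (a i) (b i) u)) =
         scalar_op (rep.weight i u) o\<^sub>L (?c o\<^sub>L (?R s (linepath (a i) (b i) u) - ?R t (linepath (a i) (b i) u)) o\<^sub>L id_blinfun)"
        by simp
    qed
    also have "\<dots> = ?c o\<^sub>L ?J (\<lambda>\<zeta>. ?R s \<zeta> - ?R t \<zeta>) o\<^sub>L id_blinfun"
      by (intro rep.operator_integral_comp complex_linear_scalar_op continuous_on_diff cont_R s I(3))
    also have "\<dots> = (?J (?R s) - ?J (?R t)) /\<^sub>R (s - t)"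
      unfolding c by (simp add: rep.operator_integral_diff cont_R s I(3) op_comp.scaleR_left)
    finally show "?J (\<lambda>\<zeta>. ?R s \<zeta> o\<^sub>L ?D s o\<^sub>L ?R t \<zeta>) =
      (op_fun (X s) (E s) (m s) f - op_fun (X t) (E t) (m t) f) /\<^sub>R (s - t)"
      by (simp add: op_fun s I(3))
  qed
  from Lim_transform_eventually[OF lim this]
  have "((\<lambda>s. (op_fun (X s) (E s) (m s) f - op_fun (X t) (E t) (m t) f) /\<^sub>R (s - t)) \<longlongrightarrow>
      gdoi (X t) (E t) (m t) (X t) (E t) (m t) (divided_difference f) ?Y) (at t)"
    unfolding gdoi .
  then show ?thesis
    by (simp add: has_vector_derivative_iff_tendsto)
qed

end
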